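(* Let $\mathbb{F}_q$ be a finite field of characteristic $p$, let $m\ge 1$ be an integer, let $\bar f\in\mathbb{F}_q[x_1,\dots,x_n]$ be a polynomial of total degree $d$, and let $X$ be the hypersurface in the torus $\mathbb{G}_m^n/\mathbb{F}_q$ defined by $\bar f=0$. Let $f\in\mathcal{O}_m[x_1,\dots,x_n]$ be a polynomial of total degree $d$ lifting $\bar f$. Let $R_{m,d}$ be the free $\mathcal{O}_m$-module of all polynomials in $\mathcal{O}_m[x_1,\dots,x_n]$ of total degree at most $dp^{m-1}$. The operator $\psi_q\circ f^{(q-1)p^{m-1}}$ maps $R_{m,d}$ to itself, and $$\left(\frac{Z(X,T)}{Z(\mathbb{G}_m^n,T)}\right)^{(-1)^n} \equiv \prod_{i=0}^n \det\bigl(I - q^i(\psi_q \circ f^{(q-1)p^{m-1}})T \,\big|\, R_{m,d}\bigr)^{(-1)^i \binom{n}{i}} \pmod{p^m}.$$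
   Context: Let $K$ be the unramified finite extension of $\mathbb{Q}_p$ with residue field $\mathbb{F}_q$, $\mathcal{O}_K$ its ring of integers, and $\mathcal{O}_m=\mathcal{O}_K/(p^m)$, a finite ring with $q^m$ elements. (In the symbol $\mathbb{G}_m^n$, the subscript is part of the standard name of the multiplicative group and is unrelated to the integer $m$; $\mathbb{G}_m^n$ is the $n$-dimensional torus, i.e. the points with $x_1\cdots x_n\ne 0$.) A lift of $\bar f$ is a polynomial over $\mathcal{O}_m$ whose reduction modulo $p$ is $\bar f$. The operator $\psi_q$ on $\mathcal{O}_m[x_1,\dots,x_n]$ is the $\mathcal{O}_m$-linear map with $\psi_q(x_1^{u_1}\cdots x_n^{u_n}) = x_1^{u_1/q}\cdots x_n^{u_n/q}$ if $q$ divides every $u_i$, and $0$ otherwise; $f^{(q-1)p^{m-1}}$ also denotes multiplication by that polynomial, so $(\psi_q\circ f^{(q-1)p^{m-1}})(h)=\psi_q(f^{(q-1)p^{m-1}}h)$. The zeta function of a variety $Y/\mathbb{F}_q$ is $Z(Y,T)=\exp\bigl(\sum_{k\ge 1}\frac{N_k(Y)}{k}T^k\bigr)\in 1+T\mathbb{Z}[[T]]$, where $N_k(Y)$ is the number of $\mathbb{F}_{q^k}$-rational points of $Y$. The congruence modulo $p^m$ means that the image of the left side in $(\mathbb{Z}/p^m\mathbb{Z})[[T]]\subset\mathcal{O}_m[[T]]$ equals the right side, where negative powers are taken in the group $1+T\mathcal{O}_m[[T]]$. *)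

theory Defs
  imports
    "HOL-Library.Cardinality"
    "HOL-Library.Poly_Mapping"
    "HOL-Computational_Algebra.Formal_Power_Series"
    "HOL-Computational_Algebra.Polynomial_FPS"
    "HOL-Algebra.Algebraic_Closure_Type"
    "Jordan_Normal_Form.Determinant"
begin

section \<open>Unramified extensions of the p-adic numbers and their finite quotients\<close>

definition nonarch_abs :: "('K::field \<Rightarrow> real) \<Rightarrow> bool" where
  "nonarch_abs v \<longleftrightarrow>
     (\<forall>x. 0 \<le> v x) \<and> (\<forall>x. v x = 0 \<longleftrightarrow> x = 0) \<and>
     (\<forall>x y. v (x * y) = v x * v y) \<and> (\<forall>x y. v (x + y) \<le> max (v x) (v y))"

text \<open>The closure of the prime field. If \<open>v\<close> restricts to the p-adic absolute value on the
  rationals and this set is complete, it is the completion of the rationals, i.e. the field of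
  p-adic numbers.\<close>

definition Qp :: "('K::field_char_0 \<Rightarrow> real) \<Rightarrow> 'K set" where
  "Qp v = {x. \<forall>e>0. \<exists>r\<in>\<rat>. v (x - r) < e}"

definition abs_Cauchy :: "('K::field \<Rightarrow> real) \<Rightarrow> (nat \<Rightarrow> 'K) \<Rightarrow> bool" where
  "abs_Cauchy v s \<longleftrightarrow> (\<forall>e>0. \<exists>N. \<forall>i\<ge>N. \<forall>j\<ge>N. v (s i - s j) < e)"

definition abs_complete :: "('K::field \<Rightarrow> real) \<Rightarrow> 'K set \<Rightarrow> bool" where
  "abs_complete v S \<longleftrightarrow>
     (\<forall>s. range s \<subseteq> S \<and> abs_Cauchy v s \<longrightarrow> (\<exists>l\<in>S. (\<lambda>i. v (s i - l)) \<longlonglongrightarrow> 0))"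

text \<open>The whole type is a finite extension of the p-adic numbers, with \<open>v\<close> the extension of the
  p-adic absolute value. An ultrametric absolute value with \<open>v p = 1 / p\<close> agrees on the rationals
  with the p-adic one.\<close>

definition padic_extension :: "nat \<Rightarrow> ('K::field_char_0 \<Rightarrow> real) \<Rightarrow> bool" where
  "padic_extension p v \<longleftrightarrow>
     nonarch_abs v \<and> v (of_nat p) = 1 / real p \<and> abs_complete v (Qp v) \<and>
     (\<exists>B. finite B \<and> (\<forall>x. \<exists>c. (\<forall>b\<in>B. c b \<in> Qp v) \<and> x = (\<Sum>b\<in>B. c b * b)))"

text \<open>Ramification index one. Residue fields are finite below, so no separability condition is
  needed.\<close>

definition unramified :: "('K::field_char_0 \<Rightarrow> real) \<Rightarrow> bool" where
  "unramified v \<longleftrightarrow> v ` (UNIV - {0}) = v ` (Qp v - {0})"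

definition int_ring :: "('K::field \<Rightarrow> real) \<Rightarrow> 'K set" where
  "int_ring v = {x. v x \<le> 1}"

definition max_ideal :: "('K::field \<Rightarrow> real) \<Rightarrow> 'K set" where
  "max_ideal v = {x. v x < 1}"

definition power_ideal :: "nat \<Rightarrow> nat \<Rightarrow> ('K::field \<Rightarrow> real) \<Rightarrow> 'K set" where
  "power_ideal p m v = (\<lambda>y. of_nat (p ^ m) * y) ` int_ring v"

text \<open>\<open>\<phi>\<close> exhibits the type \<open>'r\<close> as the quotient of the subring \<open>S\<close> by the ideal \<open>I\<close>. The values
  of \<open>\<phi>\<close> outside \<open>S\<close> are irrelevant.\<close>

definition quotient_map :: "'K::comm_ring_1 set \<Rightarrow> 'K set \<Rightarrow> ('K \<Rightarrow> 'r::comm_ring_1) \<Rightarrow> bool" where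
  "quotient_map S I \<phi> \<longleftrightarrow>
     \<phi> 1 = 1 \<and>
     (\<forall>x\<in>S. \<forall>y\<in>S. \<phi> (x + y) = \<phi> x + \<phi> y \<and> \<phi> (x * y) = \<phi> x * \<phi> y) \<and>
     \<phi> ` S = UNIV \<and> (\<forall>x\<in>S. \<phi> x = 0 \<longleftrightarrow> x \<in> I)"

section \<open>Polynomials in several variables\<close>

type_synonym ('n, 'a) mpoly = "('n \<Rightarrow>\<^sub>0 nat) \<Rightarrow>\<^sub>0 'a"

definition mdeg :: "('n::finite \<Rightarrow>\<^sub>0 nat) \<Rightarrow> nat" where
  "mdeg u = (\<Sum>i\<in>UNIV. Poly_Mapping.lookup u i)"

text \<open>The zero polynomial gets degree 0.\<close>

definition total_degree :: "('n::finite, 'a::zero) mpoly \<Rightarrow> nat" where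
  "total_degree f = Max (insert 0 (mdeg ` Poly_Mapping.keys f))"

definition mpoly_scale :: "'a \<Rightarrow> ('n, 'a) mpoly \<Rightarrow> ('n, 'a::comm_ring_1) mpoly" where
  "mpoly_scale c f = Poly_Mapping.single 0 c * f"

global_interpretation mpoly: Modules.module mpoly_scale
  by unfold_locales
     (simp_all add: mpoly_scale_def algebra_simps single_add mult_single flip: mult.assoc)

definition polys_upto :: "nat \<Rightarrow> ('n::finite, 'a::zero) mpoly set" where
  "polys_upto D = {h. total_degree h \<le> D}"

definition psi :: "nat \<Rightarrow> ('n, 'a) mpoly \<Rightarrow> ('n, 'a::comm_ring_1) mpoly" where
  "psi q h = (\<Sum>u\<in>Poly_Mapping.keys h.
     if \<forall>i. q dvd Poly_Mapping.lookup u i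
     then Poly_Mapping.single (Poly_Mapping.map (\<lambda>k. k div q) u) (Poly_Mapping.lookup h u)
     else 0)"

definition psi_op ::
  "nat \<Rightarrow> ('n, 'a) mpoly \<Rightarrow> ('n, 'a) mpoly \<Rightarrow> ('n, 'a::comm_ring_1) mpoly" where
  "psi_op q g h = psi q (g * h)"

section \<open>The determinant of I - LT on a free module\<close>

definition ordered_basis :: "('n, 'a::comm_ring_1) mpoly set \<Rightarrow> ('n, 'a) mpoly list \<Rightarrow> bool" where
  "ordered_basis M bs \<longleftrightarrow>
     distinct bs \<and> mpoly.independent (set bs) \<and> mpoly.span (set bs) = M"

lemma finite_mdeg_le: "finite {u :: 'n::finite \<Rightarrow>\<^sub>0 nat. mdeg u \<le> D}"
proof -
  have le: "Poly_Mapping.lookup u i \<le> mdeg u" for u :: "'n \<Rightarrow>\<^sub>0 nat" and i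
    unfolding mdeg_def by (rule member_le_sum) auto
  have "Poly_Mapping.lookup ` {u :: 'n \<Rightarrow>\<^sub>0 nat. mdeg u \<le> D} \<subseteq> UNIV \<rightarrow>\<^sub>E {..D}"
    unfolding PiE_UNIV_domain
  proof (intro image_subsetI PiE_I Pi_I)
    fix u :: "'n \<Rightarrow>\<^sub>0 nat" and i assume "u \<in> {u. mdeg u \<le> D}"
    then show "Poly_Mapping.lookup u i \<in> {..D}" using le[of u i] by simp
  qed
  then have "finite (Poly_Mapping.lookup ` {u :: 'n \<Rightarrow>\<^sub>0 nat. mdeg u \<le> D})"
    by (rule finite_subset) (auto intro: finite_PiE)
  then show ?thesis
    by (rule finite_imageD) (auto simp: inj_on_def intro: poly_mapping_eqI)
qed

lemma total_degree_le_iff: "total_degree f \<le> D \<longleftrightarrow> (\<forall>u\<in>Poly_Mapping.keys f. mdeg u \<le> D)"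
  by (auto simp: total_degree_def)

lemma mpoly_scale_lookup:
  "Poly_Mapping.lookup (mpoly_scale c f) u = c * Poly_Mapping.lookup f u"
proof -
  have *: "Poly_Mapping.map ((*) c) f = mpoly_scale c f"
    by (metis mpoly_scale_def mult_map_scale_conv_mult)
  then show ?thesis by (simp add: map.rep_eq when_def flip: *)
qed

lemma scale_monomial: "mpoly_scale c (Poly_Mapping.single u 1) = Poly_Mapping.single u c"
  by (simp add: mpoly_scale_def mult_single)

lemma ordered_basis_polys_upto:
  "\<exists>bs. ordered_basis (polys_upto D :: ('n::finite, 'a::comm_ring_1) mpoly set) bs"
proof -
  define U where "U = {u :: 'n \<Rightarrow>\<^sub>0 nat. mdeg u \<le> D}"
  define E where "E = (\<lambda>u :: 'n \<Rightarrow>\<^sub>0 nat. Poly_Mapping.single u (1::'a))"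
  have fin: "finite U" unfolding U_def by (rule finite_mdeg_le)
  have inj: "inj E" unfolding E_def inj_on_def by (metis lookup_single_eq lookup_single_not_eq one_neq_zero)
  have EL: "Poly_Mapping.lookup (E u) w = (if u = w then 1 else 0)" for u w
    by (simp add: E_def lookup_single when_def)
  have indep: "mpoly.independent (E ` U)"
  proof
    assume "mpoly.dependent (E ` U)"
    then obtain a b where a: "b \<in> E ` U" "a b \<noteq> 0" "(\<Sum>b\<in>E ` U. mpoly_scale (a b) b) = 0"
      using mpoly.dependent_finite[of "E ` U"] fin by auto
    then obtain w where w: "w \<in> U" "b = E w" by auto
    have "0 = Poly_Mapping.lookup (\<Sum>u\<in>U. mpoly_scale (a (E u)) (E u)) w"
      using a(3) inj by (subst (asm) sum.reindex) (auto intro: inj_on_subset)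
    also have "\<dots> = (\<Sum>u\<in>U. a (E u) * (if u = w then 1 else 0))"
      by (simp add: lookup_sum mpoly_scale_lookup EL)
    also have "\<dots> = a b" using fin w by (simp add: if_distrib sum.delta cong: if_cong)
    finally show False using a by simp
  qed
  have sub: "mpoly.subspace (polys_upto D :: ('n, 'a) mpoly set)"
    unfolding mpoly.subspace_def polys_upto_def mem_Collect_eq total_degree_le_iff
    by (auto simp: in_keys_iff lookup_add mpoly_scale_lookup)
  have "mpoly.span (E ` U) = polys_upto D"
  proof
    have "E ` U \<subseteq> polys_upto D"
      by (auto simp: U_def polys_upto_def total_degree_le_iff in_keys_iff EL split: if_splits)
    then show "mpoly.span (E ` U) \<subseteq> polys_upto D" using sub by (rule mpoly.span_minimal)
  next
    show "polys_upto D \<subseteq> mpoly.span (E ` U)"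
    proof
      fix h :: "('n, 'a) mpoly" assume "h \<in> polys_upto D"
      then have keys: "Poly_Mapping.keys h \<subseteq> U"
        by (auto simp: polys_upto_def total_degree_le_iff U_def)
      define g where "g = (\<Sum>u\<in>Poly_Mapping.keys h. mpoly_scale (Poly_Mapping.lookup h u) (E u))"
      have "Poly_Mapping.lookup h w = Poly_Mapping.lookup g w" for w
      proof -
        have "Poly_Mapping.lookup g w =
            (\<Sum>u\<in>Poly_Mapping.keys h. if u = w then Poly_Mapping.lookup h u else 0)"
          unfolding g_def lookup_sum mpoly_scale_lookup EL by (rule sum.cong) auto
        also have "\<dots> = Poly_Mapping.lookup h w"
          by (subst sum.delta) (auto simp: in_keys_iff)
        finally show ?thesis by (rule sym)
      qed
      then have "h = g" by (rule poly_mapping_eqI)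
      moreover have "g \<in> mpoly.span (E ` U)"
        unfolding g_def
      proof (rule mpoly.span_sum)
        fix u assume "u \<in> Poly_Mapping.keys h"
        then have "E u \<in> mpoly.span (E ` U)" using keys by (blast intro: mpoly.span_base)
        then show "mpoly_scale (Poly_Mapping.lookup h u) (E u) \<in> mpoly.span (E ` U)"
          by (rule mpoly.span_scale)
      qed
      ultimately show "h \<in> mpoly.span (E ` U)" by (rule ssubst)
    qed
  qed
  moreover obtain bs where "set bs = E ` U" "distinct bs"
    using finite_distinct_list[OF finite_imageI[OF fin, of E]] by blast
  ultimately show ?thesis using indep by (auto simp: ordered_basis_def)
qed

definition det_wrt ::
  "('n, 'a::comm_ring_1) mpoly list \<Rightarrow> (('n, 'a) mpoly \<Rightarrow> ('n, 'a) mpoly) \<Rightarrow> 'a poly" where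
  "det_wrt bs L = det (1\<^sub>m (length bs) -
     mat (length bs) (length bs)
       (\<lambda>(i, j). monom (mpoly.representation (set bs) (L (bs ! j)) (bs ! i)) 1))"

text \<open>For a free \<open>M\<close> of finite rank and a linear \<open>L\<close> mapping \<open>M\<close> to itself the result does not
  depend on the chosen basis. The variable of the resulting polynomial is \<open>T\<close>.\<close>

definition det_one_minus ::
  "(('n, 'a) mpoly \<Rightarrow> ('n, 'a) mpoly) \<Rightarrow> ('n, 'a::comm_ring_1) mpoly set \<Rightarrow> 'a poly" where
  "det_one_minus L M = det_wrt (SOME bs. ordered_basis M bs) L"

section \<open>Zeta functions\<close>

definition eval_ac :: "('n::finite, 'k::field) mpoly \<Rightarrow> ('n \<Rightarrow> 'k alg_closure) \<Rightarrow> 'k alg_closure" where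
  "eval_ac f x = (\<Sum>u\<in>Poly_Mapping.keys f. to_ac (Poly_Mapping.lookup f u) * (\<Prod>i\<in>UNIV. x i ^ Poly_Mapping.lookup u i))"

text \<open>Varieties are given by their sets of geometric points.\<close>

definition torus :: "('n::finite \<Rightarrow> 'k::field alg_closure) set" where
  "torus = {x. (\<Prod>i\<in>UNIV. x i) \<noteq> 0}"

definition torus_hypersurface ::
  "('n::finite, 'k::field) mpoly \<Rightarrow> ('n \<Rightarrow> 'k alg_closure) set" where
  "torus_hypersurface f = {x \<in> torus. eval_ac f x = 0}"

text \<open>The subfield with \<open>q ^ k\<close> elements of the algebraic closure consists of the roots of
  \<open>X ^ (q ^ k) - X\<close>.\<close>

definition finite_subfield :: "nat \<Rightarrow> 'k::{field,finite} alg_closure set" where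
  "finite_subfield k = {a. a ^ (CARD('k) ^ k) = a}"

definition num_points :: "('n \<Rightarrow> 'k::{field,finite} alg_closure) set \<Rightarrow> nat \<Rightarrow> nat" where
  "num_points Y k = card {x \<in> Y. \<forall>i. x i \<in> finite_subfield k}"

definition zeta :: "('n \<Rightarrow> 'k::{field,finite} alg_closure) set \<Rightarrow> rat fps" where
  "zeta Y = fps_compose (fps_exp 1)
     (Abs_fps (\<lambda>k. if k = 0 then 0 else of_nat (num_points Y k) / of_nat k))"

section \<open>Power series over a commutative ring\<close>

definition fps_map :: "('a \<Rightarrow> 'b) \<Rightarrow> 'a fps \<Rightarrow> 'b fps" where
  "fps_map h F = Abs_fps (\<lambda>k. h (fps_nth F k))"

text \<open>Integer powers in the group of power series with constant term 1. The library's \<open>powi\<close> is not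
  available, since the coefficient ring need not have an \<open>inverse\<close> operation.\<close>

definition fps_powi :: "'a::comm_ring_1 fps \<Rightarrow> int \<Rightarrow> 'a fps" where
  "fps_powi F e = (if 0 \<le> e then F ^ nat e else fps_right_inverse F 1 ^ nat (- e))"

end

theory Submission
  imports Defs "HOL-Algebra.Multiplicative_Group" "HOL-Algebra.Sylow"
begin

text \<open>
  The congruence is the reduction modulo \<open>p ^ m\<close> of Dwork's trace formula over the ring of integers
  of \<open>K\<close>. Lift \<open>f\<close> to a polynomial with coefficients there, put \<open>F = f ^ ((q - 1) * p ^ (m - 1))\<close>
  and let \<open>A\<close> be the matrix of the operator that multiplies by \<open>F\<close> and then applies \<open>\<psi>\<^sub>q\<close>, in the
  basis of monomials. Since \<open>\<psi>\<^sub>q (g(x ^ q) h(x)) = g \<psi>\<^sub>q h\<close>, the \<open>k\<close>-th power of the operator is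
  \<open>\<psi>\<close> for the number \<open>Q = q ^ k\<close> after multiplication by \<open>G = F(x) F(x ^ q) \<dots> F(x ^ (q ^ (k - 1)))\<close>
  (\<open>psi_op_funpow\<close>), so the trace of \<open>A ^ k\<close> is the sum of the coefficients of \<open>G\<close> at the exponents
  divisible by \<open>Q - 1\<close>. By orthogonality of characters, \<open>(Q - 1) ^ n\<close> times this trace is the sum
  of the values of \<open>G\<close> at the points whose coordinates are roots of unity of order \<open>Q - 1\<close>
  (\<open>sum_evalX_teich\<close>).

  At the Teichmueller lift of a point \<open>x\<close> of the torus, the value of \<open>G\<close> is close to 0 if the reduction
  of \<open>f\<close> vanishes at \<open>x\<close> and close to 1 otherwise, because a congruence modulo \<open>p\<close> becomes one modulo
  \<open>p ^ m\<close> on raising both sides to the power \<open>p ^ (m - 1)\<close>. Summing over the orbits of Frobenius even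
  gains the power of \<open>p\<close> that divides \<open>k\<close>: if \<open>U\<^sub>k\<close> counts the points of the torus over the field with
  \<open>q ^ k\<close> elements outside the hypersurface, then \<open>(Q - 1) ^ n * tr (A ^ k)\<close> is congruent to \<open>U\<^sub>k\<close>
  modulo \<open>p ^ m * k\<close> (\<open>trace_congruence\<close>).

  Finally, by the binomial theorem and \<open>T d/dT log det (1 - A T) = - \<Sum>\<^sub>k tr (A ^ k) T ^ k\<close>, the product
  of determinants is \<open>exp (- (- 1) ^ n * \<Sum>\<^sub>k (q ^ k - 1) ^ n * tr (A ^ k) * T ^ k / k)\<close>, while the power of the
  quotient of zeta functions is the same expression with \<open>U\<^sub>k\<close> in place of \<open>(q ^ k - 1) ^ n * tr (A ^ k)\<close>.
  The two differ by the exponential of a power series divisible by \<open>p ^ m\<close>, and such an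
  exponential is 1 modulo \<open>p ^ m\<close> (\<open>exp_pideal\<close>).

  Teichmueller lifts are needed only to finite precision, for one \<open>k\<close> at a time. They are taken in
  \<open>R[X]/(h)\<close>, where \<open>R\<close> is the ring of integers and \<open>h\<close> lifts the minimal polynomial of a generator
  of the field with \<open>q ^ k\<close> elements; calculations in this ring appear as congruences between
  polynomials over \<open>K\<close>.
\<close>

type_synonym 'n exponent = "'n \<Rightarrow>\<^sub>0 nat"

abbreviation (input) lookup where "lookup \<equiv> Poly_Mapping.lookup"
abbreviation (input) keys where "keys \<equiv> Poly_Mapping.keys"
abbreviation (input) single where "single \<equiv> Poly_Mapping.single"

section \<open>Power series with a given logarithmic derivative\<close>

text \<open>In characteristic zero this says that \<open>F\<close> is the exponential of \<open>\<Sum>\<^sub>k A\<^sub>k T ^ k / k\<close>. The formulation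
  as a differential equation contains no denominators, so it makes sense for the integer power series
  and for determinants over any commutative ring.\<close>

definition has_log_deriv :: "'a::comm_ring_1 fps \<Rightarrow> 'a fps \<Rightarrow> bool" where
  "has_log_deriv F A \<longleftrightarrow> fps_nth F 0 = 1 \<and> fps_X * fps_deriv F = A * F"

lemma has_log_deriv_one: "has_log_deriv 1 0"
  by (simp add: has_log_deriv_def)

lemma has_log_deriv_mult:
  assumes "has_log_deriv F A" "has_log_deriv G B"
  shows "has_log_deriv (F * G) (A + B)"
proof -
  have "fps_X * fps_deriv (F * G) = F * (fps_X * fps_deriv G) + (fps_X * fps_deriv F) * G"
    by (simp add: algebra_simps)
  also have "\<dots> = (A + B) * (F * G)"
    using assms by (simp add: has_log_deriv_def algebra_simps)
  finally show ?thesis using assms by (simp add: has_log_deriv_def)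
qed

lemma has_log_deriv_power: "has_log_deriv F A \<Longrightarrow> has_log_deriv (F ^ k) (of_nat k * A)"
proof (induction k)
  case 0 show ?case by (simp add: has_log_deriv_one)
next
  case (Suc k)
  from has_log_deriv_mult[OF Suc.prems Suc.IH[OF Suc.prems]] show ?case
    by (simp add: algebra_simps)
qed

lemma has_log_deriv_prod:
  "finite S \<Longrightarrow> (\<And>i. i \<in> S \<Longrightarrow> has_log_deriv (F i) (A i)) \<Longrightarrow>
     has_log_deriv (\<Prod>i\<in>S. F i) (\<Sum>i\<in>S. A i)"
  by (induction S rule: finite_induct) (auto intro: has_log_deriv_one has_log_deriv_mult)

lemma has_log_deriv_cancel:
  assumes "has_log_deriv F A" and FG: "F * G = 1"
  shows "has_log_deriv G (- A)"
proof -
  have 0: "fps_nth G 0 = 1"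
    using assms(1) arg_cong[OF FG, of "\<lambda>x. fps_nth x 0"] by (simp add: has_log_deriv_def)
  have "F * fps_deriv G + fps_deriv F * G = 0"
    using arg_cong[OF FG, of fps_deriv] by simp
  then have "F * (fps_X * fps_deriv G) = - ((fps_X * fps_deriv F) * G)"
    by (simp add: add_eq_0_iff algebra_simps)
  also have "\<dots> = - (A * (F * G))" using assms(1) by (simp add: has_log_deriv_def algebra_simps)
  finally have "F * (fps_X * fps_deriv G) = - A" using FG by simp
  then have "(F * (fps_X * fps_deriv G)) * G = - A * G" by simp
  also have "(F * (fps_X * fps_deriv G)) * G = (F * G) * (fps_X * fps_deriv G)"
    by (simp only: ac_simps)
  finally show ?thesis using 0 FG by (simp add: has_log_deriv_def)
qed

lemma has_log_deriv_fps_powi: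
  assumes "has_log_deriv F A"
  shows "has_log_deriv (fps_powi F e) (of_int e * A)"
proof (cases "e \<ge> 0")
  case True
  then show ?thesis
    using has_log_deriv_power[OF assms, of "nat e"] by (simp add: fps_powi_def)
next
  case False
  have "F * fps_right_inverse F 1 = 1"
    using assms by (intro fps_right_inverse) (simp add: has_log_deriv_def)
  from has_log_deriv_power[OF has_log_deriv_cancel[OF assms this], of "nat (- e)"] False
  show ?thesis by (simp add: fps_powi_def)
qed

text \<open>The differential equation is a recursion: \<open>k\<close> times the \<open>k\<close>-th coefficient is a polynomial in
  the earlier ones. Cancelling \<open>k\<close> is possible in a domain of characteristic zero, also in the
  integers.\<close>

lemma has_log_deriv_unique_upto:
  fixes F G :: "'a::{idom,ring_char_0} fps"
  assumes F: "has_log_deriv F A" and G: "has_log_deriv G B"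
    and AB: "\<And>i. i \<le> K \<Longrightarrow> fps_nth A i = fps_nth B i"
  shows "k \<le> K \<Longrightarrow> fps_nth F k = fps_nth G k"
proof (induction k rule: less_induct)
  case (less k)
  show ?case
  proof (cases "k = 0")
    case True
    then show ?thesis using F G by (simp add: has_log_deriv_def)
  next
    case False
    have rec: "of_nat k * fps_nth E k = (\<Sum>i\<in>{1..k}. fps_nth C i * fps_nth E (k - i))"
      if E: "has_log_deriv E C" for E C :: "'a fps"
    proof -
      have eq: "fps_X * fps_deriv E = C * E" using E by (simp add: has_log_deriv_def)
      have "fps_nth C 0 = 0"
        using arg_cong[OF eq, of "\<lambda>x. fps_nth x 0"] E by (simp add: has_log_deriv_def)
      moreover have "of_nat k * fps_nth E k = (\<Sum>i=0..k. fps_nth C i * fps_nth E (k - i))"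
        using arg_cong[OF eq, of "\<lambda>x. fps_nth x k"]
        by (simp add: fps_mult_fps_X_deriv_shift fps_mult_nth)
      ultimately show ?thesis by (simp add: sum.atLeast_Suc_atMost)
    qed
    have "of_nat k * fps_nth F k = of_nat k * fps_nth G k"
      unfolding rec[OF F] rec[OF G]
    proof (rule sum.cong)
      fix i assume i: "i \<in> {1..k}"
      have "fps_nth A i = fps_nth B i" using i less.prems by (intro AB) simp
      moreover have "fps_nth F (k - i) = fps_nth G (k - i)"
        using i less.prems by (intro less.IH) auto
      ultimately show "fps_nth A i * fps_nth F (k - i) = fps_nth B i * fps_nth G (k - i)"
        by simp
    qed simp
    then show ?thesis using False by simp
  qed
qed

lemma has_log_deriv_unique:
  fixes F G :: "'a::{idom,ring_char_0} fps"
  assumes "has_log_deriv F A" "has_log_deriv G A"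
  shows "F = G"
  using has_log_deriv_unique_upto[OF assms] by (intro fps_ext) blast

lemma has_log_deriv_exp:
  fixes H :: "'a::field_char_0 fps"
  assumes "fps_nth H 0 = 0"
  shows "has_log_deriv (fps_compose (fps_exp 1) H) (fps_X * fps_deriv H)"
  using assms fps_compose_deriv[of H "fps_exp 1"]
  by (simp add: has_log_deriv_def algebra_simps)

section \<open>Determinants and traces of powers\<close>

definition mat_trace :: "'a::comm_ring_1 mat \<Rightarrow> 'a" where
  "mat_trace A = (\<Sum>i<dim_row A. A $$ (i, i))"

lemma mult_mat_index_sum:
  assumes "A \<in> carrier_mat n m" "B \<in> carrier_mat m l" "i < n" "j < l"
  shows "(A * B) $$ (i, j) = (\<Sum>k<m. A $$ (i, k) * B $$ (k, j))"
  using assms by (simp add: scalar_prod_def lessThan_atLeast0)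

lemma fps_deriv_prod:
  "finite S \<Longrightarrow> fps_deriv (\<Prod>i\<in>S. F i) =
     (\<Sum>i\<in>S. fps_deriv (F i) * (\<Prod>l\<in>S - {i}. F l :: 'a::comm_ring_1 fps))"
proof (induction S rule: finite_induct)
  case (insert x S)
  have "(\<Sum>i\<in>S. fps_deriv (F i) * (\<Prod>l\<in>insert x S - {i}. F l)) =
      (\<Sum>i\<in>S. F x * (fps_deriv (F i) * (\<Prod>l\<in>S - {i}. F l)))"
  proof (rule sum.cong)
    fix i assume i: "i \<in> S"
    then have "insert x S - {i} = insert x (S - {i})" using insert.hyps by auto
    then show "fps_deriv (F i) * (\<Prod>l\<in>insert x S - {i}. F l) =
        F x * (fps_deriv (F i) * (\<Prod>l\<in>S - {i}. F l))"
      using insert.hyps by (simp add: mult.left_commute)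
  qed simp
  then show ?case using insert by (simp add: sum_distrib_left algebra_simps)
qed simp

text \<open>Jacobi's formula. The derivative of the Leibniz expansion is a sum over the row that is
  differentiated, and expanding each summand along that row gives the cofactors.\<close>

lemma fps_deriv_det:
  fixes M :: "'a::comm_ring_1 fps mat"
  assumes M: "M \<in> carrier_mat n n"
  shows "fps_deriv (det M) = mat_trace (map_mat fps_deriv M * adj_mat M)"
proof -
  define R where "R i = mat n n (\<lambda>(r, j). if r = i then fps_deriv (M $$ (i, j)) else M $$ (r, j))" for i
  have R: "R i \<in> carrier_mat n n" for i by (simp add: R_def)
  have dsig: "fps_deriv (signof p * G) = signof p * fps_deriv G" for p :: "nat \<Rightarrow> nat" and G :: "'a fps"
    by (simp add: sign_def)
  have "fps_deriv (det M) =
      (\<Sum>p | p permutes {0..<n}. signof p *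
         (\<Sum>i\<in>{0..<n}. fps_deriv (M $$ (i, p i)) * (\<Prod>l\<in>{0..<n} - {i}. M $$ (l, p l))))"
    by (simp add: det_def'[OF M] fps_deriv_sum dsig fps_deriv_prod)
  also have "\<dots> = (\<Sum>p | p permutes {0..<n}. \<Sum>i\<in>{0..<n}. signof p * (\<Prod>l\<in>{0..<n}. R i $$ (l, p l)))"
    unfolding sum_distrib_left
  proof (intro sum.cong refl)
    fix p i assume p: "p \<in> {p. p permutes {0..<n}}" and i: "i \<in> {0..<n}"
    have lt: "p l < n" if "l < n" for l using p that permutes_in_image[of p "{0..<n}" l] by simp
    have "(\<Prod>l\<in>{0..<n}. R i $$ (l, p l)) = R i $$ (i, p i) * (\<Prod>l\<in>{0..<n} - {i}. R i $$ (l, p l))"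
      using i by (intro prod.remove) auto
    also have "(\<Prod>l\<in>{0..<n} - {i}. R i $$ (l, p l)) = (\<Prod>l\<in>{0..<n} - {i}. M $$ (l, p l))"
      using lt by (intro prod.cong) (auto simp: R_def)
    also have "R i $$ (i, p i) = fps_deriv (M $$ (i, p i))" using i lt by (simp add: R_def)
    finally show "signof p * (fps_deriv (M $$ (i, p i)) * (\<Prod>l\<in>{0..<n} - {i}. M $$ (l, p l))) =
       signof p * (\<Prod>l\<in>{0..<n}. R i $$ (l, p l))" by simp
  qed
  also have "\<dots> = (\<Sum>i\<in>{0..<n}. det (R i))"
    by (subst sum.swap) (simp add: det_def'[OF R])
  also have "\<dots> = (\<Sum>i<n. \<Sum>j<n. fps_deriv (M $$ (i, j)) * cofactor M i j)"
    unfolding lessThan_atLeast0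
  proof (intro sum.cong refl)
    fix i assume "i \<in> {0..<n}"
    then have i: "i < n" by simp
    have del: "mat_delete (R i) i j = mat_delete M i j" for j
      using M by (intro eq_matI) (auto simp: mat_delete_def R_def)
    show "det (R i) = (\<Sum>j\<in>{0..<n}. fps_deriv (M $$ (i, j)) * cofactor M i j)"
      unfolding laplace_expansion_row[OF R i] lessThan_atLeast0
      using i by (intro sum.cong) (auto simp: cofactor_def del, simp add: R_def)
  qed
  also have "\<dots> = mat_trace (map_mat fps_deriv M * adj_mat M)"
    using M adj_mat(1)[OF M]
    by (simp add: mat_trace_def mult_mat_index_sum[of _ n n _ n] del: index_mult_mat(1))
       (simp add: adj_mat_def)
  finally show ?thesis .
qed

definition fps_one_minus :: "'a::comm_ring_1 mat \<Rightarrow> 'a fps mat" where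
  "fps_one_minus A = 1\<^sub>m (dim_row A) - map_mat (\<lambda>a. fps_const a * fps_X) A"

text \<open>The geometric series \<open>V\<close> of \<open>A * T\<close> is inverse to \<open>1 - A * T\<close>, so the adjugate of the latter
  is \<open>V\<close> times the determinant; Jacobi's formula then reads off the traces of the powers of \<open>A\<close>.\<close>

lemma has_log_deriv_det:
  fixes A :: "'a::comm_ring_1 mat"
  assumes A: "A \<in> carrier_mat n n"
  shows "has_log_deriv (det (fps_one_minus A))
           (Abs_fps (\<lambda>k. if k = 0 then 0 else - mat_trace (A ^\<^sub>m k)))"
proof -
  define M where "M = fps_one_minus A"
  define V where "V = mat n n (\<lambda>ij. Abs_fps (\<lambda>k. (A ^\<^sub>m k) $$ ij))"
  have M: "M \<in> carrier_mat n n" and V: "V \<in> carrier_mat n n"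
    using A by (auto simp: M_def V_def fps_one_minus_def)
  have Ak: "A ^\<^sub>m k \<in> carrier_mat n n" for k using A by simp
  have adj: "adj_mat M \<in> carrier_mat n n" "M * adj_mat M = det M \<cdot>\<^sub>m 1\<^sub>m n"
    using adj_mat[OF M] by auto
  have VM: "V * M = 1\<^sub>m n"
  proof (rule eq_matI)
    fix i j assume "i < dim_row (1\<^sub>m n :: 'a fps mat)" "j < dim_col (1\<^sub>m n :: 'a fps mat)"
    then have i: "i < n" and j: "j < n" by auto
    have "(V * M) $$ (i, j) = (\<Sum>l<n. V $$ (i, l) * (if l = j then 1 else 0)) -
        (\<Sum>l<n. V $$ (i, l) * (fps_const (A $$ (l, j)) * fps_X))"
      using A i j by (subst mult_mat_index_sum[OF V M])
        (auto simp: M_def fps_one_minus_def right_diff_distrib simp flip: sum_subtractf intro!: sum.cong)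
    also have "\<dots> = V $$ (i, j) - (\<Sum>l<n. V $$ (i, l) * fps_const (A $$ (l, j))) * fps_X"
      using j by (simp add: if_distrib cong: if_cong) (simp add: sum_distrib_right mult.assoc)
    also have "\<dots> = (if i = j then 1 else 0)"
    proof (rule fps_ext)
      fix k
      show "fps_nth (V $$ (i, j) - (\<Sum>l<n. V $$ (i, l) * fps_const (A $$ (l, j))) * fps_X) k =
        fps_nth (if i = j then 1 else 0) k"
      proof (cases k)
        case 0 then show ?thesis using i j A by (simp add: V_def)
      next
        case (Suc r)
        then show ?thesis
          using i j by (simp add: V_def fps_sum_nth mult_mat_index_sum[OF Ak A] del: index_mult_mat(1))
      qed
    qed
    finally show "(V * M) $$ (i, j) = 1\<^sub>m n $$ (i, j)" using i j by simp
  qed (use V M in auto)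
  have "adj_mat M = (V * M) * adj_mat M" using VM adj(1) by simp
  also have "\<dots> = V * (M * adj_mat M)" using V M adj(1) by (intro assoc_mult_mat) auto
  also have "\<dots> = det M \<cdot>\<^sub>m V" using V adj by (simp add: mult_smult_distrib[of _ n n _ n])
  finally have adjV: "adj_mat M = det M \<cdot>\<^sub>m V" .
  define B where "B = Abs_fps (\<lambda>k. if k = 0 then 0 else - mat_trace (A ^\<^sub>m k))"
  have dM: "map_mat fps_deriv M $$ (i, l) = - fps_const (A $$ (i, l))" if "i < n" "l < n" for i l
    using that A M by (simp add: M_def fps_one_minus_def)
  have "fps_deriv (det M) = mat_trace (map_mat fps_deriv M * adj_mat M)"
    by (rule fps_deriv_det[OF M])
  also have "\<dots> = (\<Sum>i<n. \<Sum>l<n. - fps_const (A $$ (i, l)) * (det M * V $$ (l, i)))"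
    using M V by (auto simp add: mat_trace_def adjV mult_mat_index_sum[of _ n n _ n] dM
        simp del: index_mult_mat(1) index_map_mat(1) intro!: sum.cong)
  also have "\<dots> = det M * (\<Sum>i<n. \<Sum>l<n. - fps_const (A $$ (i, l)) * V $$ (l, i))"
    by (simp add: sum_distrib_left mult.left_commute)
  finally have "fps_X * fps_deriv (det M) =
      (fps_X * (\<Sum>i<n. \<Sum>l<n. - fps_const (A $$ (i, l)) * V $$ (l, i))) * det M"
    by (simp add: mult_ac)
  also have "fps_X * (\<Sum>i<n. \<Sum>l<n. - fps_const (A $$ (i, l)) * V $$ (l, i)) = B"
  proof (rule fps_ext)
    fix k
    show "fps_nth (fps_X * (\<Sum>i<n. \<Sum>l<n. - fps_const (A $$ (i, l)) * V $$ (l, i))) k = fps_nth B k"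
    proof (cases k)
      case 0 then show ?thesis by (simp add: B_def)
    next
      case (Suc r)
      have "(\<Sum>i<n. \<Sum>l<n. A $$ (i, l) * (A ^\<^sub>m r) $$ (l, i)) = mat_trace (A ^\<^sub>m Suc r)"
        using A by (subst sum.swap)
          (simp add: mat_trace_def mult_mat_index_sum[OF Ak A] mult.commute del: index_mult_mat(1))
      then show ?thesis
        using Suc by (simp add: B_def fps_sum_nth V_def sum_negf del: pow_mat.simps)
    qed
  qed
  finally have "fps_X * fps_deriv (det M) = B * det M" .
  moreover have "fps_nth (det M) 0 = 1"
  proof -
    interpret h: comm_ring_hom "\<lambda>F :: 'a fps. fps_nth F 0"
      by unfold_locales auto
    have "fps_nth (det M) 0 = det (map_mat (\<lambda>F. fps_nth F 0) M)" by simp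
    also have "map_mat (\<lambda>F. fps_nth F 0) M = 1\<^sub>m n"
      using A by (intro eq_matI) (auto simp: M_def fps_one_minus_def)
    finally show ?thesis by simp
  qed
  ultimately show ?thesis by (simp add: has_log_deriv_def M_def B_def)
qed

section \<open>Homomorphisms defined on a subring\<close>

text \<open>The reduction maps have as their source the ring of integers of a valued field, which is a subset of
  the type of the field. Their values outside this subset are arbitrary.\<close>

locale subring_hom =
  fixes S :: "'a::comm_ring_1 set" and h :: "'a \<Rightarrow> 'b::comm_ring_1"
  assumes one_mem: "1 \<in> S" and add_mem: "x \<in> S \<Longrightarrow> y \<in> S \<Longrightarrow> x + y \<in> S"
    and uminus_mem: "x \<in> S \<Longrightarrow> - x \<in> S" and mult_mem: "x \<in> S \<Longrightarrow> y \<in> S \<Longrightarrow> x * y \<in> S"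
    and hom_one: "h 1 = 1" and hom_add: "x \<in> S \<Longrightarrow> y \<in> S \<Longrightarrow> h (x + y) = h x + h y"
    and hom_mult: "x \<in> S \<Longrightarrow> y \<in> S \<Longrightarrow> h (x * y) = h x * h y"
begin

lemma zero_mem: "0 \<in> S"
  using add_mem[OF one_mem uminus_mem[OF one_mem]] by simp

lemma hom_zero: "h 0 = 0"
  using hom_add[OF zero_mem zero_mem] by simp

lemma hom_uminus: "x \<in> S \<Longrightarrow> h (- x) = - h x"
  using hom_add[of x "- x"] by (simp add: uminus_mem hom_zero add_eq_0_iff)

lemma diff_mem: "x \<in> S \<Longrightarrow> y \<in> S \<Longrightarrow> x - y \<in> S"
  using add_mem[of x "- y"] by (simp add: uminus_mem)

lemma hom_diff: "x \<in> S \<Longrightarrow> y \<in> S \<Longrightarrow> h (x - y) = h x - h y"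
  using hom_add[of x "- y"] by (simp add: uminus_mem hom_uminus)

lemma sum_mem: "(\<And>i. i \<in> I \<Longrightarrow> F i \<in> S) \<Longrightarrow> sum F I \<in> S"
  by (induction I rule: infinite_finite_induct) (auto simp: zero_mem add_mem)

lemma hom_sum: "(\<And>i. i \<in> I \<Longrightarrow> F i \<in> S) \<Longrightarrow> h (sum F I) = (\<Sum>i\<in>I. h (F i))"
  by (induction I rule: infinite_finite_induct) (auto simp: hom_zero hom_add sum_mem)

lemma prod_mem: "(\<And>i. i \<in> I \<Longrightarrow> F i \<in> S) \<Longrightarrow> prod F I \<in> S"
  by (induction I rule: infinite_finite_induct) (auto simp: one_mem mult_mem)

lemma hom_prod: "(\<And>i. i \<in> I \<Longrightarrow> F i \<in> S) \<Longrightarrow> h (prod F I) = (\<Prod>i\<in>I. h (F i))"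
  by (induction I rule: infinite_finite_induct) (auto simp: hom_one hom_mult prod_mem)

lemma power_mem: "x \<in> S \<Longrightarrow> x ^ k \<in> S"
  by (induction k) (auto simp: one_mem mult_mem)

lemma hom_power: "x \<in> S \<Longrightarrow> h (x ^ k) = h x ^ k"
  by (induction k) (auto simp: hom_one hom_mult power_mem)

lemma of_nat_mem: "of_nat k \<in> S" and hom_of_nat: "h (of_nat k) = of_nat k"
  by (induction k) (auto simp: zero_mem one_mem add_mem hom_zero hom_one hom_add)

lemma of_int_mem: "of_int k \<in> S" and hom_of_int: "h (of_int k) = of_int k"
proof -
  have "of_int k \<in> S \<and> h (of_int k) = of_int k"
    by (cases k rule: int_cases2)
       (auto simp: of_nat_mem hom_of_nat uminus_mem hom_uminus)
  then show "of_int k \<in> S" "h (of_int k) = of_int k" by auto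
qed

lemma det_mem_hom:
  assumes A: "A \<in> carrier_mat n n" and S: "\<And>i j. i < n \<Longrightarrow> j < n \<Longrightarrow> A $$ (i, j) \<in> S"
  shows "det A \<in> S" and "h (det A) = det (map_mat h A)"
proof -
  have mem: "(\<Prod>i = 0..<n. A $$ (i, p i)) \<in> S"
    and hom: "h (\<Prod>i = 0..<n. A $$ (i, p i)) = (\<Prod>i = 0..<n. map_mat h A $$ (i, p i))"
    if "p permutes {0..<n}" for p
  proof -
    have lt: "p i < n" if "i < n" for i
      using \<open>p permutes {0..<n}\<close> that permutes_in_image[of p "{0..<n}" i] by simp
    show "(\<Prod>i = 0..<n. A $$ (i, p i)) \<in> S" using S lt by (intro prod_mem) auto
    have "h (\<Prod>i = 0..<n. A $$ (i, p i)) = (\<Prod>i = 0..<n. h (A $$ (i, p i)))"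
      using S lt by (intro hom_prod) auto
    also have "\<dots> = (\<Prod>i = 0..<n. map_mat h A $$ (i, p i))"
      using A lt by (intro prod.cong) auto
    finally show "h (\<Prod>i = 0..<n. A $$ (i, p i)) = (\<Prod>i = 0..<n. map_mat h A $$ (i, p i))" .
  qed
  show "det A \<in> S"
    unfolding det_def'[OF A] by (intro sum_mem mult_mem of_int_mem mem) auto
  have B: "map_mat h A \<in> carrier_mat n n" using A by simp
  show "h (det A) = det (map_mat h A)"
    unfolding det_def'[OF A] det_def'[OF B]
    by (subst hom_sum) (auto intro!: mult_mem of_int_mem mem sum.cong simp: hom_mult of_int_mem mem hom_of_int hom)
qed

end

definition fps_over :: "'a set \<Rightarrow> 'a fps set" where
  "fps_over S = {F. \<forall>k. fps_nth F k \<in> S}"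

lemma fps_map_nth [simp]: "fps_nth (fps_map h F) k = h (fps_nth F k)"
  by (simp add: fps_map_def)

lemma subring_hom_fps:
  assumes "subring_hom S h"
  shows "subring_hom (fps_over S) (fps_map h)"
proof -
  interpret subring_hom S h by fact
  show ?thesis
  proof
    show "1 \<in> fps_over S" by (auto simp: fps_over_def one_mem zero_mem)
    show "fps_map h 1 = 1" by (rule fps_ext) (auto simp: hom_one hom_zero)
  next
    fix x y assume "x \<in> fps_over S" "y \<in> fps_over S"
    then have mem: "fps_nth x i \<in> S" "fps_nth y i \<in> S" for i by (auto simp: fps_over_def)
    show "x * y \<in> fps_over S" by (auto simp: fps_over_def fps_mult_nth mem intro!: sum_mem mult_mem)
    show "fps_map h (x * y) = fps_map h x * fps_map h y"
      by (rule fps_ext) (simp add: fps_mult_nth hom_sum hom_mult mult_mem mem)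
  qed (auto simp: fps_over_def add_mem uminus_mem hom_add intro!: fps_ext)
qed

lemma (in subring_hom) fps_right_inverse_hom:
  assumes F: "F \<in> fps_over S"
  shows "fps_right_inverse F 1 \<in> fps_over S"
    and "fps_map h (fps_right_inverse F 1) = fps_right_inverse (fps_map h F) 1"
proof -
  have FS: "fps_nth F i \<in> S" for i using F by (simp add: fps_over_def)
  have *: "fps_right_inverse_constructor F 1 k \<in> S \<and>
        h (fps_right_inverse_constructor F 1 k) = fps_right_inverse_constructor (fps_map h F) 1 k" for k
  proof (induction k rule: less_induct)
    case (less k)
    show ?case
    proof (cases k)
      case 0 then show ?thesis by (simp add: one_mem hom_one)
    next
      case (Suc r)
      have mem: "fps_right_inverse_constructor F 1 (Suc r - i) \<in> S"
        and hom: "h (fps_right_inverse_constructor F 1 (Suc r - i)) =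
          fps_right_inverse_constructor (fps_map h F) 1 (Suc r - i)" if "i \<in> {1..Suc r}" for i
        using less.IH[of "Suc r - i"] that Suc by auto
      have sum: "(\<Sum>i\<in>{1..Suc r}. fps_nth F i * fps_right_inverse_constructor F 1 (Suc r - i)) \<in> S"
        by (intro sum_mem mult_mem FS mem)
      have eq: "fps_right_inverse_constructor F 1 k =
          - (\<Sum>i\<in>{1..Suc r}. fps_nth F i * fps_right_inverse_constructor F 1 (Suc r - i))"
        by (simp only: Suc fps_right_inverse_constructor.simps) simp
      have "h (fps_right_inverse_constructor F 1 k) = - (\<Sum>i\<in>{1..Suc r}.
          h (fps_nth F i) * fps_right_inverse_constructor (fps_map h F) 1 (Suc r - i))"
        unfolding eq hom_uminus[OF sum]
        by (subst hom_sum) (auto simp: FS mem mult_mem hom_mult hom simp del: diff_Suc_Suc sum.cl_ivl_Suc)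
      moreover have "fps_right_inverse_constructor F 1 k \<in> S"
        unfolding eq using sum by (rule uminus_mem)
      ultimately show ?thesis
        by (simp only: Suc fps_right_inverse_constructor.simps) simp
    qed
  qed
  then show "fps_right_inverse F 1 \<in> fps_over S" by (simp add: fps_over_def)
  show "fps_map h (fps_right_inverse F 1) = fps_right_inverse (fps_map h F) 1"
    using * by (intro fps_ext) simp
qed

lemma (in subring_hom) fps_powi_hom:
  assumes F: "F \<in> fps_over S"
  shows "fps_powi F e \<in> fps_over S" and "fps_map h (fps_powi F e) = fps_powi (fps_map h F) e"
proof -
  interpret f: subring_hom "fps_over S" "fps_map h"
    by (rule subring_hom_fps) (rule subring_hom_axioms)
  show "fps_powi F e \<in> fps_over S" "fps_map h (fps_powi F e) = fps_powi (fps_map h F) e"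
    using F fps_right_inverse_hom[OF F] by (auto simp: fps_powi_def f.power_mem f.hom_power)
qed

lemma (in subring_hom) det_fps_one_minus_hom:
  assumes A: "A \<in> carrier_mat n n" and S: "\<And>i j. i < n \<Longrightarrow> j < n \<Longrightarrow> A $$ (i, j) \<in> S"
  shows "det (fps_one_minus A) \<in> fps_over S"
    and "fps_map h (det (fps_one_minus A)) = det (fps_one_minus (map_mat h A))"
proof -
  interpret f: subring_hom "fps_over S" "fps_map h"
    by (rule subring_hom_fps) (rule subring_hom_axioms)
  have M: "fps_one_minus A \<in> carrier_mat n n" using A by (auto simp: fps_one_minus_def)
  have mem: "fps_one_minus A $$ (i, j) \<in> fps_over S" if "i < n" "j < n" for i j
    using that A S by (auto simp: fps_one_minus_def fps_over_def intro!: diff_mem zero_mem one_mem uminus_mem)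
  show "det (fps_one_minus A) \<in> fps_over S" using f.det_mem_hom(1)[OF M mem] by simp
  have "map_mat (fps_map h) (fps_one_minus A) = fps_one_minus (map_mat h A)"
    using A S by (intro eq_matI fps_ext)
      (auto simp: fps_one_minus_def hom_diff hom_uminus hom_zero hom_one zero_mem one_mem)
  then show "fps_map h (det (fps_one_minus A)) = det (fps_one_minus (map_mat h A))"
    using f.det_mem_hom(2)[OF M mem] by simp
qed


section \<open>Independence of the determinant from the basis\<close>

text \<open>A basis \<open>b\<close> of \<open>M\<close> together with its coordinate functionals \<open>c\<close>. Both a basis in the sense of
  \<open>ordered_basis\<close>, with coordinates given by \<open>representation\<close>, and the monomials, with coordinates
  given by the coefficients, are of this form.\<close>

definition coord_system ::
  "('n, 'a) mpoly set \<Rightarrow> nat \<Rightarrow> (nat \<Rightarrow> ('n, 'a::comm_ring_1) mpoly) \<Rightarrow> (('n, 'a) mpoly \<Rightarrow> nat \<Rightarrow> 'a) \<Rightarrow> bool"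
where
  "coord_system M n b c \<longleftrightarrow>
     (\<forall>i<n. b i \<in> M) \<and> (\<forall>v\<in>M. v = (\<Sum>i<n. mpoly_scale (c v i) (b i))) \<and>
     (\<forall>i<n. \<forall>j<n. c (b j) i = (if i = j then 1 else 0)) \<and>
     (\<forall>v\<in>M. \<forall>w\<in>M. \<forall>i<n. c (v + w) i = c v i + c w i) \<and>
     (\<forall>v\<in>M. \<forall>a. \<forall>i<n. c (mpoly_scale a v) i = a * c v i)"

lemma coord_systemD:
  assumes "coord_system M n b c"
  shows "i < n \<Longrightarrow> b i \<in> M" and "v \<in> M \<Longrightarrow> v = (\<Sum>i<n. mpoly_scale (c v i) (b i))"
    and "i < n \<Longrightarrow> j < n \<Longrightarrow> c (b j) i = (if i = j then 1 else 0)"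
    and "v \<in> M \<Longrightarrow> w \<in> M \<Longrightarrow> i < n \<Longrightarrow> c (v + w) i = c v i + c w i"
    and "v \<in> M \<Longrightarrow> i < n \<Longrightarrow> c (mpoly_scale a v) i = a * c v i"
  using assms unfolding coord_system_def by blast+

lemma coord_system_sum:
  assumes c: "coord_system M n b c" and M: "mpoly.subspace M" and i: "i < n" and "finite J"
    and w: "\<And>j. j \<in> J \<Longrightarrow> w j \<in> M"
  shows "c (\<Sum>j\<in>J. mpoly_scale (a j) (w j)) i = (\<Sum>j\<in>J. a j * c (w j) i)"
  using \<open>finite J\<close> w
proof (induction J rule: finite_induct)
  case empty
  have "c (mpoly_scale 0 0) i = 0 * c 0 i"
    using coord_systemD(5)[OF c mpoly.subspace_0[OF M] i] .
  then show ?case by simp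
next
  case (insert x J)
  then have "mpoly_scale (a x) (w x) \<in> M" "(\<Sum>j\<in>J. mpoly_scale (a j) (w j)) \<in> M"
    by (auto intro!: mpoly.subspace_scale[OF M] mpoly.subspace_sum[OF M])
  with insert show ?case
    by (simp add: coord_systemD(4)[OF c _ _ i] coord_systemD(5)[OF c _ i])
qed

text \<open>Two bases of a free module over a nonzero commutative ring have the same length: a longer
  one would make an identity matrix factor through a smaller one, and padding the factors with zeros
  to square matrices contradicts multiplicativity of the determinant.\<close>

lemma mat_factor_one_le:
  fixes P :: "'a::comm_ring_1 mat"
  assumes P: "P \<in> carrier_mat n m" and Q: "Q \<in> carrier_mat m n" and PQ: "P * Q = 1\<^sub>m n"
  shows "n \<le> m"
proof (rule ccontr)
  assume "\<not> n \<le> m"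
  then have lt: "m < n" by simp
  define P' where "P' = mat n n (\<lambda>(i, j). if j < m then P $$ (i, j) else 0)"
  define Q' where "Q' = mat n n (\<lambda>(i, j). if i < m then Q $$ (i, j) else 0)"
  have P': "P' \<in> carrier_mat n n" and Q': "Q' \<in> carrier_mat n n" by (auto simp: P'_def Q'_def)
  have "P' * Q' = 1\<^sub>m n"
  proof (rule eq_matI)
    fix i j assume "i < dim_row (1\<^sub>m n :: 'a mat)" "j < dim_col (1\<^sub>m n :: 'a mat)"
    then have i: "i < n" and j: "j < n" by auto
    have "(P' * Q') $$ (i, j) = (\<Sum>k<n. P' $$ (i, k) * Q' $$ (k, j))"
      using i j by (rule mult_mat_index_sum[OF P' Q'])
    also have "\<dots> = (\<Sum>k<m. P $$ (i, k) * Q $$ (k, j))"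
      using lt i j by (intro sum.mono_neutral_cong_right) (auto simp: P'_def Q'_def)
    also have "\<dots> = 1\<^sub>m n $$ (i, j)" using PQ mult_mat_index_sum[OF P Q i j] by simp
    finally show "(P' * Q') $$ (i, j) = 1\<^sub>m n $$ (i, j)" .
  qed (use P' Q' in auto)
  \<comment> \<open>But row \<open>m\<close> of \<open>Q'\<close> is zero.\<close>
  then have "det P' * det Q' = 1" using det_mult[OF P' Q'] by simp
  moreover have "det Q' = 0"
  proof -
    have "Q' = mat\<^sub>r n n (\<lambda>i. if i = m then 0\<^sub>v n else row Q' i)"
      using lt Q' by (intro eq_matI) (auto simp: Q'_def)
    then show ?thesis using det_row_0[of m n "row Q'"] lt Q' by (auto simp: row_def)
  qed
  ultimately show False by simp
qed

definition coord_mat :: "nat \<Rightarrow> (nat \<Rightarrow> ('n, 'a) mpoly) \<Rightarrow> (('n, 'a) mpoly \<Rightarrow> nat \<Rightarrow> 'a)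
    \<Rightarrow> (('n, 'a::comm_ring_1) mpoly \<Rightarrow> ('n, 'a) mpoly) \<Rightarrow> 'a mat" where
  "coord_mat n b c L = mat n n (\<lambda>(i, j). c (L (b j)) i)"

text \<open>The matrices of one linear map in two bases are conjugate by the change of basis \<open>P\<close>, which is square
  because bases have equal length; so \<open>det P\<close> cancels.\<close>

lemma det_coord_mat_independent:
  fixes L :: "('n, 'a::comm_ring_1) mpoly \<Rightarrow> ('n, 'a) mpoly"
  assumes M: "mpoly.subspace M"
    and c: "coord_system M n b c" and c': "coord_system M m b' c'"
    and LM: "\<And>v. v \<in> M \<Longrightarrow> L v \<in> M"
    and L_sum: "\<And>a w (l::nat). (\<And>j. j < l \<Longrightarrow> w j \<in> M) \<Longrightarrow>
      L (\<Sum>j<l. mpoly_scale (a j) (w j)) = (\<Sum>j<l. mpoly_scale (a j) (L (w j)))"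
  shows "det (fps_one_minus (coord_mat n b c L)) = det (fps_one_minus (coord_mat m b' c' L))"
proof -
  have change: "c v i = (\<Sum>j<m. c (b' j) i * c' v j)" if "v \<in> M" "i < n" for v i
  proof -
    have "c v i = c (\<Sum>j<m. mpoly_scale (c' v j) (b' j)) i"
      using coord_systemD(2)[OF c' that(1)] by simp
    then show ?thesis
      using coord_system_sum[OF c M that(2), of "{..<m}" b' "c' v"] coord_systemD(1)[OF c']
      by (simp add: mult.commute)
  qed
  have change': "c' v i = (\<Sum>j<n. c' (b j) i * c v j)" if "v \<in> M" "i < m" for v i
  proof -
    have "c' v i = c' (\<Sum>j<n. mpoly_scale (c v j) (b j)) i"
      using coord_systemD(2)[OF c that(1)] by simp
    then show ?thesis
      using coord_system_sum[OF c' M that(2), of "{..<n}" b "c v"] coord_systemD(1)[OF c]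
      by (simp add: mult.commute)
  qed
  define P where "P = mat n m (\<lambda>(i, j). c (b' j) i)"
  define Q where "Q = mat m n (\<lambda>(i, j). c' (b j) i)"
  define A where "A = coord_mat n b c L"
  define B where "B = coord_mat m b' c' L"
  have P: "P \<in> carrier_mat n m" and Q: "Q \<in> carrier_mat m n"
    and A: "A \<in> carrier_mat n n" and B: "B \<in> carrier_mat m m"
    by (auto simp: P_def Q_def A_def B_def coord_mat_def)
  have Pe: "P $$ (i, j) = c (b' j) i" and Qe: "Q $$ (j, i) = c' (b i) j" if "i < n" "j < m" for i j
    using that by (auto simp: P_def Q_def)
  have Ae: "A $$ (i, j) = c (L (b j)) i" if "i < n" "j < n" for i j
    using that by (simp add: A_def coord_mat_def)
  have Be: "B $$ (i, j) = c' (L (b' j)) i" if "i < m" "j < m" for i j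
    using that by (simp add: B_def coord_mat_def)
  have PQ: "P * Q = 1\<^sub>m n"
    using change[OF coord_systemD(1)[OF c]] coord_systemD(3)[OF c] P Q
    by (intro eq_matI) (auto simp: mult_mat_index_sum[OF P Q] Pe Qe simp del: index_mult_mat(1))
  have QP: "Q * P = 1\<^sub>m m"
    using change'[OF coord_systemD(1)[OF c']] coord_systemD(3)[OF c'] P Q
    by (intro eq_matI) (auto simp: mult_mat_index_sum[OF Q P] Pe Qe simp del: index_mult_mat(1))
  have nm: "m = n" using mat_factor_one_le[OF P Q PQ] mat_factor_one_le[OF Q P QP] by simp
  have AP: "A * P = P * B"
  proof (rule eq_matI)
    fix i j assume "i < dim_row (P * B)" "j < dim_col (P * B)"
    then have i: "i < n" and j: "j < m" using P B by auto
    have b': "b' j \<in> M" using coord_systemD(1)[OF c' j] .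
    have "(A * P) $$ (i, j) = (\<Sum>l<n. c (b' j) l * c (L (b l)) i)"
      using i j by (simp add: mult_mat_index_sum[OF A P] Ae Pe mult.commute
          del: index_mult_mat(1))
    also have "\<dots> = c (\<Sum>l<n. mpoly_scale (c (b' j) l) (L (b l))) i"
      using coord_system_sum[OF c M i, of "{..<n}" "\<lambda>l. L (b l)" "c (b' j)"] LM coord_systemD(1)[OF c]
      by simp
    also have "(\<Sum>l<n. mpoly_scale (c (b' j) l) (L (b l))) = L (b' j)"
      using L_sum[of n b "c (b' j)"] coord_systemD(1)[OF c] coord_systemD(2)[OF c b'] by simp
    also have "c (L (b' j)) i = (P * B) $$ (i, j)"
      using i j change[OF LM[OF b'] i]
      by (simp add: mult_mat_index_sum[OF P B] Pe Be del: index_mult_mat(1))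
    finally show "(A * P) $$ (i, j) = (P * B) $$ (i, j)" .
  qed (use A B P in auto)
  note [simp] = nm
  interpret fc: comm_ring_hom "fps_const :: 'a \<Rightarrow> 'a fps" by unfold_locales auto
  define P' where "P' = map_mat fps_const P"
  have P': "P' \<in> carrier_mat n n" using P by (simp add: P'_def)
  have fA: "fps_one_minus A = 1\<^sub>m n - fps_X \<cdot>\<^sub>m map_mat fps_const A"
    and fB: "fps_one_minus B = 1\<^sub>m n - fps_X \<cdot>\<^sub>m map_mat fps_const B"
    using A B by (auto simp: fps_one_minus_def intro!: eq_matI)
  have A': "map_mat fps_const A \<in> carrier_mat n n" and B': "map_mat fps_const B \<in> carrier_mat n n"
    using A B by auto
  have "map_mat fps_const A * P' = P' * map_mat fps_const B"
    using AP A B P fc.mat_hom_mult[of A n n P n] fc.mat_hom_mult[of P n n B n] by (simp add: P'_def)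
  then have "fps_one_minus A * P' = P' * fps_one_minus B"
    using A' B' P' unfolding fA fB
    by (simp add: minus_mult_distrib_mat[of _ n n _ _ n] mult_minus_distrib_mat[of _ n n _ n]
        mult_smult_assoc_mat[of _ n n _ n] mult_smult_distrib[of _ n n _ n])
  moreover have "fps_one_minus A \<in> carrier_mat n n" "fps_one_minus B \<in> carrier_mat n n"
    using A B by (auto simp: fps_one_minus_def)
  ultimately have "det (fps_one_minus A) * det P' = det P' * det (fps_one_minus B)"
    using det_mult[of "fps_one_minus A" n P'] det_mult[of P' n "fps_one_minus B"] P' by simp
  moreover have "det P' * det (map_mat fps_const Q) = 1"
  proof -
    have "det P * det Q = 1" using det_mult[of P n Q] P Q PQ by simp
    then show ?thesis by (simp add: P'_def)
  qed
  ultimately have "det (fps_one_minus A) = det (fps_one_minus B)"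
    by (smt (verit) mult.assoc mult.commute mult.right_neutral)
  then show ?thesis by (simp add: A_def B_def)
qed

section \<open>The determinant in the basis of monomials\<close>

lemma coord_system_ordered_basis:
  assumes "ordered_basis M bs"
  shows "coord_system M (length bs) (\<lambda>i. bs ! i) (\<lambda>v i. mpoly.representation (set bs) v (bs ! i))"
proof -
  have d: "distinct bs" and ind: "mpoly.independent (set bs)" and sp: "mpoly.span (set bs) = M"
    using assms by (auto simp: ordered_basis_def)
  have "v = (\<Sum>i<length bs. mpoly_scale (mpoly.representation (set bs) v (bs ! i)) (bs ! i))"
    if "v \<in> M" for v
  proof -
    have "v = (\<Sum>b\<in>set bs. mpoly_scale (mpoly.representation (set bs) v b) b)"
      using that sp by (intro mpoly.sum_representation_eq[symmetric] ind) auto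
    also have "\<dots> = (\<Sum>i<length bs. mpoly_scale (mpoly.representation (set bs) v (bs ! i)) (bs ! i))"
      using d by (intro sum.reindex_bij_betw[OF bij_betw_nth, symmetric]) auto
    finally show ?thesis .
  qed
  then show ?thesis
    using d sp mpoly.span_base[of _ "set bs"]
    by (auto simp: coord_system_def mpoly.representation_basis[OF ind] nth_eq_iff_index_eq
        mpoly.representation_add[OF ind] mpoly.representation_scale[OF ind])
qed

definition monomial_list :: "nat \<Rightarrow> ('n::finite) exponent list" where
  "monomial_list D = (SOME us. distinct us \<and> set us = {u. mdeg u \<le> D})"

lemma monomial_list:
  "distinct (monomial_list D :: ('n::finite) exponent list)"
  "set (monomial_list D :: 'n exponent list) = {u. mdeg u \<le> D}"
proof -
  have "\<exists>us. distinct us \<and> set us = {u :: 'n exponent. mdeg u \<le> D}"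
    using finite_distinct_list[OF finite_mdeg_le, of D] by blast
  from someI_ex[OF this]
  show "distinct (monomial_list D :: 'n exponent list)"
    "set (monomial_list D :: 'n exponent list) = {u. mdeg u \<le> D}"
    by (simp_all add: monomial_list_def)
qed

lemma polys_upto_iff: "h \<in> polys_upto D \<longleftrightarrow> (\<forall>u. lookup h u \<noteq> 0 \<longrightarrow> mdeg u \<le> D)"
  by (auto simp: polys_upto_def total_degree_le_iff in_keys_iff)

lemma subspace_polys_upto: "mpoly.subspace (polys_upto D)"
  unfolding mpoly.subspace_def polys_upto_def mem_Collect_eq total_degree_le_iff
  by (auto simp: in_keys_iff lookup_add mpoly_scale_lookup)

lemma coord_system_monomials:
  "coord_system (polys_upto D) (length (monomial_list D :: ('n::finite) exponent list))
     (\<lambda>i. single (monomial_list D ! i) 1)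
     (\<lambda>v i. lookup v (monomial_list D ! i :: 'n exponent) :: 'a::comm_ring_1)"
proof -
  let ?us = "monomial_list D :: 'n exponent list"
  have deg: "mdeg (?us ! i) \<le> D" if "i < length ?us" for i
    using nth_mem[OF that] monomial_list(2)[of D] by auto
  have "v = (\<Sum>i<length ?us. mpoly_scale (lookup v (?us ! i)) (single (?us ! i) 1))"
    if v: "v \<in> polys_upto D" for v :: "('n, 'a) mpoly"
  proof (rule poly_mapping_eqI)
    fix w
    have "(\<Sum>i<length ?us. lookup v (?us ! i) * (if ?us ! i = w then 1 else 0)) =
        (\<Sum>u\<in>set ?us. lookup v u * (if u = w then 1 else 0))"
      using monomial_list(1)[of D] by (intro sum.reindex_bij_betw bij_betw_nth) auto
    also have "\<dots> = lookup v w"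
      using v by (auto simp: monomial_list(2) polys_upto_iff if_distrib finite_mdeg_le cong: if_cong)
    finally show "lookup v w = lookup (\<Sum>i<length ?us.
        mpoly_scale (lookup v (?us ! i)) (single (?us ! i) 1)) w"
      by (simp add: lookup_sum mpoly_scale_lookup lookup_single when_def)
  qed
  then show ?thesis
    using deg monomial_list(1)[where 'n = 'n, of D]
    by (auto simp: coord_system_def lookup_add mpoly_scale_lookup lookup_single when_def
        nth_eq_iff_index_eq polys_upto_iff)
qed

lemma fps_of_poly_det_one_minus:
  fixes L :: "('n::finite, 'a::comm_ring_1) mpoly \<Rightarrow> ('n, 'a) mpoly"
  assumes LM: "\<And>v. v \<in> polys_upto D \<Longrightarrow> L v \<in> polys_upto D"
    and L_sum: "\<And>a w (l::nat). (\<And>j. j < l \<Longrightarrow> w j \<in> polys_upto D) \<Longrightarrow>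
      L (\<Sum>j<l. mpoly_scale (a j) (w j)) = (\<Sum>j<l. mpoly_scale (a j) (L (w j)))"
  shows "fps_of_poly (det_one_minus L (polys_upto D)) =
    det (fps_one_minus (coord_mat (length (monomial_list D :: 'n exponent list))
      (\<lambda>i. single (monomial_list D ! i) 1)
      (\<lambda>v i. lookup v (monomial_list D ! i)) L))"
proof -
  define bs where "bs = (SOME bs. ordered_basis (polys_upto D :: ('n, 'a) mpoly set) bs)"
  have bs: "ordered_basis (polys_upto D :: ('n, 'a) mpoly set) bs"
    unfolding bs_def by (rule someI_ex[OF ordered_basis_polys_upto])
  interpret h: comm_ring_hom "fps_of_poly :: 'a poly \<Rightarrow> 'a fps"
    by unfold_locales (auto simp: fps_of_poly_add fps_of_poly_mult)
  have "fps_of_poly (det_wrt bs L) = det (fps_one_minus (coord_mat (length bs) (\<lambda>i. bs ! i)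
      (\<lambda>v i. mpoly.representation (set bs) v (bs ! i)) L))"
    unfolding det_wrt_def h.hom_det[symmetric]
    by (rule arg_cong[where f = det], rule eq_matI)
       (auto simp: fps_one_minus_def coord_mat_def fps_of_poly_diff fps_of_poly_monom)
  then show ?thesis
    using det_coord_mat_independent[OF subspace_polys_upto coord_system_ordered_basis[OF bs]
      coord_system_monomials LM L_sum]
    by (simp add: det_one_minus_def bs_def)
qed

section \<open>The operator psi and its powers\<close>

definition exp_scale :: "nat \<Rightarrow> 'n exponent \<Rightarrow> 'n exponent" where
  "exp_scale k u = Poly_Mapping.map ((*) k) u"

lemma lookup_exp_scale [simp]: "lookup (exp_scale k u) i = k * lookup u i"
  by (simp add: exp_scale_def map.rep_eq when_def)

lemma exp_scale_add: "exp_scale k (u + w) = exp_scale k u + exp_scale k w"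
  by (rule poly_mapping_eqI) (simp add: lookup_add algebra_simps)

lemma exp_scale_mult: "exp_scale k (exp_scale l u) = exp_scale (k * l) u"
  by (rule poly_mapping_eqI) simp

lemma exp_scale_one [simp]: "exp_scale (Suc 0) u = u"
  by (rule poly_mapping_eqI) simp

lemma exp_scale_inj: "k > 0 \<Longrightarrow> exp_scale k u = exp_scale k w \<longleftrightarrow> u = w"
  by (auto simp: poly_mapping_eq_iff fun_eq_iff)

lemma exp_scale_image: "k > 0 \<Longrightarrow> (\<forall>i. k dvd lookup u i) \<longleftrightarrow> (\<exists>w. u = exp_scale k w)"
proof safe
  assume k: "k > 0" and dvd: "\<forall>i. k dvd lookup u i"
  have "u = exp_scale k (Poly_Mapping.map (\<lambda>a. a div k) u)"
    using dvd by (intro poly_mapping_eqI) (auto simp: map.rep_eq when_def)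
  then show "\<exists>w. u = exp_scale k w" ..
qed auto

lemma mdeg_add: "mdeg (u + w) = mdeg u + mdeg w"
  by (simp add: mdeg_def lookup_add sum.distrib)

lemma mdeg_exp_scale: "mdeg (exp_scale k u) = k * mdeg u"
  by (simp add: mdeg_def sum_distrib_left)

lemma lookup_psi:
  fixes h :: "('n, 'a::comm_ring_1) mpoly"
  assumes q: "q > 0"
  shows "lookup (psi q h) w = lookup h (exp_scale q w)"
proof -
  have "lookup (psi q h) w = (\<Sum>u\<in>keys h.
     if u = exp_scale q w then lookup h u else 0)"
    unfolding psi_def lookup_sum
  proof (intro sum.cong refl)
    fix u
    have dv: "Poly_Mapping.map (\<lambda>k. k div q) (exp_scale q w') = w'" for w' :: "'n exponent"
      using q by (intro poly_mapping_eqI) (auto simp: map.rep_eq when_def)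
    have "(\<forall>i. q dvd lookup u i) \<and> Poly_Mapping.map (\<lambda>k. k div q) u = w \<longleftrightarrow> u = exp_scale q w"
      unfolding exp_scale_image[OF q] by (auto simp: dv)
    then show "lookup (if \<forall>i. q dvd lookup u i
          then single (Poly_Mapping.map (\<lambda>k. k div q) u) (lookup h u) else 0) w =
        (if u = exp_scale q w then lookup h u else 0)"
      by (auto simp: lookup_single when_def)
  qed
  then show ?thesis by (simp add: in_keys_iff)
qed

lemma psi_add: "q > 0 \<Longrightarrow> psi q (g + h) = psi q g + psi q h"
  by (rule poly_mapping_eqI) (simp add: lookup_psi lookup_add)

lemma psi_zero [simp]: "psi q 0 = 0"
  by (simp add: psi_def)

lemma psi_scale: "q > 0 \<Longrightarrow> psi q (mpoly_scale c h) = mpoly_scale c (psi q h)"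
  by (rule poly_mapping_eqI) (simp add: lookup_psi mpoly_scale_lookup)

lemma psi_psi: "q > 0 \<Longrightarrow> r > 0 \<Longrightarrow> psi q (psi r h) = psi (r * q) h"
  by (rule poly_mapping_eqI) (simp add: lookup_psi exp_scale_mult)

lemma psi_one: "psi (Suc 0) h = h"
  by (rule poly_mapping_eqI) (simp add: lookup_psi)

text \<open>The polynomial \<open>g(x ^ k)\<close>.\<close>

definition exp_subst :: "nat \<Rightarrow> ('n, 'a) mpoly \<Rightarrow> ('n, 'a::comm_ring_1) mpoly" where
  "exp_subst k g = (\<Sum>u\<in>keys g. single (exp_scale k u) (lookup g u))"

lemma mpoly_eq_sum_single:
  "g = (\<Sum>u\<in>keys g. single u (lookup g u))"
  by (rule poly_mapping_eqI) (simp add: lookup_sum lookup_single when_def in_keys_iff)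

lemma psi_single_mult:
  assumes q: "q > 0"
  shows "psi q (single (exp_scale q u) c * h) = single u c * psi q h"
proof -
  have single: "psi q (single (exp_scale q u) c * single w a) =
     single u c * psi q (single w a)" for w a
  proof (rule poly_mapping_eqI)
    fix x
    show "lookup (psi q (single (exp_scale q u) c * single w a)) x =
       lookup (single u c * psi q (single w a)) x"
    proof (cases "\<exists>y. w = exp_scale q y")
      case True
      then obtain y where y: "w = exp_scale q y" by blast
      have "psi q (single w a) = single y a"
        using q by (intro poly_mapping_eqI) (simp add: lookup_psi y lookup_single when_def exp_scale_inj)
      then show ?thesis
        using q by (simp add: lookup_psi y mult_single lookup_single when_def exp_scale_inj flip: exp_scale_add)
    next
      case False
      have "psi q (single w a) = 0"
        using q False by (intro poly_mapping_eqI) (auto simp: lookup_psi lookup_single when_def)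
      moreover have "exp_scale q u + w \<noteq> exp_scale q x"
      proof
        assume eq: "exp_scale q u + w = exp_scale q x"
        have "q dvd lookup w i" for i
        proof -
          have "q * lookup u i + lookup w i = q * lookup x i"
            using arg_cong[OF eq, of "\<lambda>z. lookup z i"] by (simp add: lookup_add)
          then show ?thesis by (metis dvd_add_right_iff dvd_triv_left)
        qed
        then show False using False q exp_scale_image[of q w] by auto
      qed
      ultimately show ?thesis
        using q by (simp add: lookup_psi mult_single lookup_single when_def)
    qed
  qed
  have "psi q (single (exp_scale q u) c * (\<Sum>w\<in>K. single w (b w))) =
     single u c * psi q (\<Sum>w\<in>K. single w (b w))" if "finite K" for K b
    using that by (induction K rule: finite_induct) (auto simp: distrib_left psi_add[OF q] single)
  from this[of "keys h" "lookup h"] show ?thesis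
    by (simp flip: mpoly_eq_sum_single)
qed

text \<open>The projection formula: \<open>\<psi>\<^sub>q\<close> is linear over the polynomials in \<open>x ^ q\<close>, since adding a multiple of
  \<open>q\<close> to an exponent does not change whether \<open>q\<close> divides it. It suffices to check monomials.\<close>

lemma psi_exp_subst_mult:
  assumes q: "q > 0"
  shows "psi q (exp_subst q g * h) = g * psi q h"
proof -
  have "psi q ((\<Sum>u\<in>K. single (exp_scale q u) (b u)) * h) =
     (\<Sum>u\<in>K. single u (b u)) * psi q h" if "finite K" for K b
    using that by (induction K rule: finite_induct)
      (auto simp: distrib_right psi_add[OF q] psi_single_mult[OF q])
  from this[of "keys g" "lookup g"] show ?thesis
    by (simp add: exp_subst_def flip: mpoly_eq_sum_single)
qed

text \<open>The product \<open>g(x) * g(x ^ q) * \<dots> * g(x ^ (q ^ (k - 1)))\<close>.\<close>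

primrec frob_product :: "nat \<Rightarrow> ('n, 'a::comm_ring_1) mpoly \<Rightarrow> nat \<Rightarrow> ('n, 'a) mpoly" where
  "frob_product q g 0 = 1"
| "frob_product q g (Suc k) = exp_subst (q ^ k) g * frob_product q g k"

text \<open>All multiplications move to the right of all \<open>\<psi>\<close> by the projection formula, each passage
  through \<open>\<psi>\<^sub>q\<close> replacing \<open>x\<close> by \<open>x ^ q\<close>.\<close>

lemma psi_op_funpow:
  assumes q: "q > 0"
  shows "(psi_op q g ^^ k) h = psi (q ^ k) (frob_product q g k * h)"
proof (induction k)
  case 0 show ?case by (simp add: psi_one)
next
  case (Suc k)
  have "(psi_op q g ^^ Suc k) h = psi q (g * psi (q ^ k) (frob_product q g k * h))"
    by (simp add: Suc psi_op_def)
  also have "\<dots> = psi q (psi (q ^ k) (exp_subst (q ^ k) g * (frob_product q g k * h)))"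
    using q by (simp add: psi_exp_subst_mult)
  also have "\<dots> = psi (q ^ Suc k) (frob_product q g (Suc k) * h)"
    using q by (simp add: psi_psi mult.assoc mult.commute[of q])
  finally show ?case .
qed

section \<open>Reduction of coefficients\<close>

text \<open>Reduction may shrink the support. The index sets are therefore only required to contain the
  supports, so that one pair of them serves for a product and for its reduction.\<close>

lemma lookup_mult_superset:
  fixes a b :: "('n, 'c::comm_ring_1) mpoly"
  assumes AB: "finite A" "finite B" "keys a \<subseteq> A" "keys b \<subseteq> B"
  shows "lookup (a * b) u = (\<Sum>x\<in>A. \<Sum>w\<in>B.
      if x + w = u then lookup a x * lookup b w else 0)"
proof -
  have sup: "c = (\<Sum>x\<in>C. single x (lookup c x))"
    if "finite C" "keys c \<subseteq> C" for c :: "('n, 'c) mpoly" and C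
    using that by (subst mpoly_eq_sum_single) (rule sum.mono_neutral_left, auto simp: in_keys_iff)
  have "a * b = (\<Sum>x\<in>A. single x (lookup a x)) *
      (\<Sum>w\<in>B. single w (lookup b w))"
    by (simp only: sup[OF AB(1,3), symmetric] sup[OF AB(2,4), symmetric])
  also have "\<dots> = (\<Sum>x\<in>A. \<Sum>w\<in>B. single (x + w) (lookup a x * lookup b w))"
    by (simp add: sum_product mult_single)
  finally show ?thesis by (simp add: lookup_sum lookup_single when_def)
qed

context subring_hom
begin

definition coeff_lift :: "('n, 'a) mpoly \<Rightarrow> ('n, 'b) mpoly \<Rightarrow> bool" where
  "coeff_lift f g \<longleftrightarrow>
     (\<forall>u. lookup f u \<in> S \<and> h (lookup f u) = lookup g u)"

lemma coeff_lift_one: "coeff_lift 1 1"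
  by (simp add: coeff_lift_def lookup_one when_def zero_mem one_mem hom_zero hom_one)

lemma coeff_lift_mult:
  assumes f: "coeff_lift f f'" and g: "coeff_lift g g'"
  shows "coeff_lift (f * g) (f' * g')"
proof -
  let ?A = "keys f \<union> keys f'"
  let ?B = "keys g \<union> keys g'"
  have mem: "lookup f x \<in> S" "lookup g x \<in> S" for x
    using f g by (auto simp: coeff_lift_def)
  have hom: "h (lookup f x) = lookup f' x"
    "h (lookup g x) = lookup g' x" for x
    using f g by (auto simp: coeff_lift_def)
  have t: "(if x + w = u then lookup f x * lookup g w else 0) \<in> S" for x w u
    by (simp add: mult_mem mem zero_mem)
  have 1: "lookup (f * g) u = (\<Sum>x\<in>?A. \<Sum>w\<in>?B.
      if x + w = u then lookup f x * lookup g w else 0)"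
    and 2: "lookup (f' * g') u = (\<Sum>x\<in>?A. \<Sum>w\<in>?B.
      if x + w = u then lookup f' x * lookup g' w else 0)" for u
    by (rule lookup_mult_superset; simp)+
  show ?thesis
    unfolding coeff_lift_def
  proof (intro allI conjI)
    fix u
    show "lookup (f * g) u \<in> S" unfolding 1 by (intro sum_mem t)
    have "h (lookup (f * g) u) = (\<Sum>x\<in>?A. \<Sum>w\<in>?B.
        h (if x + w = u then lookup f x * lookup g w else 0))"
      unfolding 1 by (simp add: hom_sum sum_mem t)
    also have "\<dots> = lookup (f' * g') u"
      unfolding 2 by (intro sum.cong refl) (simp add: hom_zero hom_mult mem hom)
    finally show "h (lookup (f * g) u) = lookup (f' * g') u" .
  qed
qed

lemma coeff_lift_power: "coeff_lift f g \<Longrightarrow> coeff_lift (f ^ k) (g ^ k)"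
  by (induction k) (auto intro: coeff_lift_one coeff_lift_mult)

lemma coeff_lift_psi: "k > 0 \<Longrightarrow> coeff_lift f g \<Longrightarrow> coeff_lift (psi k f) (psi k g)"
  by (simp add: coeff_lift_def lookup_psi)

lemma coeff_lift_single_one: "coeff_lift (single u 1) (single u 1)"
  by (simp add: coeff_lift_def lookup_single when_def zero_mem one_mem hom_zero hom_one)

end

section \<open>Degree bounds\<close>

lemma mult_mem_polys_upto:
  assumes "g \<in> polys_upto a" "h \<in> polys_upto b"
  shows "g * h \<in> polys_upto (a + b)"
proof -
  have "mdeg u \<le> a + b" if "u \<in> keys (g * h)" for u
  proof -
    from that obtain x y where "u = x + y" "x \<in> keys g" "y \<in> keys h"
      using keys_mult[of g h] by blast
    then show ?thesis using assms by (auto simp: polys_upto_def total_degree_le_iff mdeg_add add_mono)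
  qed
  then show ?thesis by (auto simp: polys_upto_def total_degree_le_iff)
qed

lemma power_mem_polys_upto:
  assumes "g \<in> polys_upto a"
  shows "g ^ k \<in> polys_upto (k * a)"
proof (induction k)
  case 0 show ?case by (auto simp: polys_upto_iff lookup_one mdeg_def)
next
  case (Suc k)
  from mult_mem_polys_upto[OF assms Suc] show ?case by simp
qed

lemma exp_subst_mem_polys_upto:
  assumes "g \<in> polys_upto a"
  shows "exp_subst k g \<in> polys_upto (k * a)"
  unfolding exp_subst_def
proof (rule mpoly.subspace_sum[OF subspace_polys_upto])
  fix u assume "u \<in> keys g"
  then show "single (exp_scale k u) (lookup g u) \<in> polys_upto (k * a)"
    using assms by (auto simp: polys_upto_iff lookup_single when_def mdeg_exp_scale in_keys_iff)
qed

lemma psi_mem_polys_upto: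
  assumes q: "q > 0" and h: "h \<in> polys_upto (q * D)"
  shows "psi q h \<in> polys_upto D"
  unfolding polys_upto_iff
proof safe
  fix u assume "lookup (psi q h) u \<noteq> 0"
  then have "q * mdeg u \<le> q * D"
    using h by (auto simp: lookup_psi[OF q] polys_upto_iff simp flip: mdeg_exp_scale)
  then show "mdeg u \<le> D" using q by simp
qed

text \<open>Multiplication raises the degree from \<open>D\<close> to at most \<open>q * D\<close>, and \<open>\<psi>\<^sub>q\<close> divides it by \<open>q\<close>.\<close>

lemma psi_op_mem_polys_upto:
  assumes q: "q > 0" and g: "g \<in> polys_upto ((q - 1) * D)" and h: "h \<in> polys_upto D"
  shows "psi_op q g h \<in> polys_upto D"
proof -
  have "g * h \<in> polys_upto ((q - 1) * D + D)" using g h by (rule mult_mem_polys_upto)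
  also have "(q - 1) * D + D = q * D" using q by (simp add: algebra_simps)
  finally show ?thesis unfolding psi_op_def by (rule psi_mem_polys_upto[OF q])
qed

lemma frob_product_mem_polys_upto:
  assumes q: "q > 0" and g: "g \<in> polys_upto ((q - 1) * D)"
  shows "frob_product q g k \<in> polys_upto ((q ^ k - 1) * D)"
proof (induction k)
  case 0 show ?case by (auto simp: polys_upto_iff lookup_one mdeg_def)
next
  case (Suc k)
  have "frob_product q g (Suc k) \<in> polys_upto (q ^ k * ((q - 1) * D) + (q ^ k - 1) * D)"
    unfolding frob_product.simps by (intro mult_mem_polys_upto exp_subst_mem_polys_upto g Suc)
  also have "q ^ k * ((q - 1) * D) + (q ^ k - 1) * D = (q ^ Suc k - 1) * D"
  proof -
    have "q ^ k * (q - 1) + (q ^ k - 1) = q ^ Suc k - 1"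
      using q by (simp add: algebra_simps)
    then show ?thesis by (metis distrib_right mult.assoc)
  qed
  finally show ?case .
qed

section \<open>The trace of a power of the operator\<close>

definition psi_mat :: "nat \<Rightarrow> nat \<Rightarrow> ('n::finite, 'a::comm_ring_1) mpoly \<Rightarrow> 'a mat" where
  "psi_mat D q g = coord_mat (length (monomial_list D :: 'n exponent list))
      (\<lambda>i. single (monomial_list D ! i) 1)
      (\<lambda>v i. lookup v (monomial_list D ! i)) (psi_op q g)"

lemma psi_op_sum:
  assumes "q > 0" and "finite J"
  shows "psi_op q g (\<Sum>j\<in>J. mpoly_scale (a j) (w j)) =
     (\<Sum>j\<in>J. mpoly_scale (a j) (psi_op q g (w j)))"
  using assms(2)
proof (induction J rule: finite_induct)
  case (insert x J)
  have "g * mpoly_scale (a x) (w x) = mpoly_scale (a x) (g * w x)"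
    by (simp add: mpoly_scale_def mult_ac)
  with insert assms(1) show ?case by (simp add: psi_op_def distrib_left psi_add psi_scale)
qed (simp add: psi_op_def)

lemma psi_mat_power_index:
  fixes g :: "('n::finite, 'a::comm_ring_1) mpoly"
  assumes q: "q > 0" and g: "g \<in> polys_upto ((q - 1) * D)"
    and i: "i < length (monomial_list D :: 'n exponent list)"
    and j: "j < length (monomial_list D :: 'n exponent list)"
  shows "(psi_mat D q g ^\<^sub>m k) $$ (i, j) = lookup
     ((psi_op q g ^^ k) (single (monomial_list D ! j) 1)) (monomial_list D ! i)"
  using j
proof (induction k arbitrary: j)
  case 0
  then show ?case using i monomial_list(1)[where 'n = 'n, of D]
    by (auto simp: psi_mat_def coord_mat_def lookup_single when_def nth_eq_iff_index_eq)
next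
  case (Suc k)
  let ?us = "monomial_list D :: 'n exponent list"
  let ?E = "\<lambda>i. single (?us ! i) (1::'a)"
  let ?N = "length ?us"
  have A: "psi_mat D q g \<in> carrier_mat ?N ?N" by (simp add: psi_mat_def coord_mat_def)
  have v: "psi_op q g (?E j) \<in> polys_upto D"
    using coord_systemD(1)[OF coord_system_monomials Suc.prems]
    by (rule psi_op_mem_polys_upto[OF q g])
  have sum: "(psi_op q g ^^ k) (\<Sum>l<?N. mpoly_scale (a l) (w l)) =
      (\<Sum>l<?N. mpoly_scale (a l) ((psi_op q g ^^ k) (w l)))" for a w
    using q by (induction k) (auto simp: psi_op_sum)
  have "(psi_mat D q g ^\<^sub>m Suc k) $$ (i, j) = (\<Sum>l<?N. (psi_mat D q g ^\<^sub>m k) $$ (i, l) *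
      lookup (psi_op q g (?E j)) (?us ! l))"
    using i Suc.prems A mult_mat_index_sum[of "psi_mat D q g ^\<^sub>m k" ?N ?N "psi_mat D q g" ?N i j]
    by (simp del: index_mult_mat(1)) (simp add: psi_mat_def coord_mat_def)
  also have "\<dots> = (\<Sum>l<?N. lookup (psi_op q g (?E j)) (?us ! l) *
      lookup ((psi_op q g ^^ k) (?E l)) (?us ! i))"
    by (intro sum.cong refl) (simp add: Suc.IH mult.commute)
  also have "\<dots> = lookup ((psi_op q g ^^ k)
      (\<Sum>l<?N. mpoly_scale (lookup (psi_op q g (?E j)) (?us ! l)) (?E l))) (?us ! i)"
    by (simp add: sum lookup_sum mpoly_scale_lookup)
  also have "(\<Sum>l<?N. mpoly_scale (lookup (psi_op q g (?E j)) (?us ! l)) (?E l)) =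
      psi_op q g (?E j)"
    by (rule coord_systemD(2)[OF coord_system_monomials v, symmetric])
  finally show ?case by (simp add: funpow_swap1)
qed

text \<open>The diagonal entry at \<open>u\<close> is the coefficient of \<open>x ^ (q ^ k * u)\<close> in the product of \<open>G\<close> and \<open>x ^ u\<close>,
  that is, the coefficient of \<open>G\<close> at \<open>(q ^ k - 1) * u\<close>.\<close>

lemma mat_trace_psi_mat_power:
  fixes g :: "('n::finite, 'a::comm_ring_1) mpoly"
  assumes q: "q > 0" and g: "g \<in> polys_upto ((q - 1) * D)"
  shows "mat_trace (psi_mat D q g ^\<^sub>m k) =
     (\<Sum>u | mdeg u \<le> D. lookup (frob_product q g k) (exp_scale (q ^ k - 1) u))"
proof -
  let ?us = "monomial_list D :: 'n exponent list"
  have lk: "lookup (psi (q ^ k) (frob_product q g k * single u 1)) u =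
     lookup (frob_product q g k) (exp_scale (q ^ k - 1) u)" for u :: "'n exponent"
  proof -
    have e: "exp_scale (q ^ k) u = exp_scale (q ^ k - 1) u + u"
      using q by (intro poly_mapping_eqI) (simp add: lookup_add diff_mult_distrib Suc_leI)
    have "lookup (h * single u 1) (w + u) = lookup h w"
      for h :: "('n, 'a) mpoly" and w
    proof -
      have "h * single u 1 = (\<Sum>x\<in>keys h. single (x + u) (lookup h x))"
        by (subst mpoly_eq_sum_single[of h]) (simp add: sum_distrib_right mult_single)
      then show ?thesis by (simp add: lookup_sum lookup_single when_def in_keys_iff)
    qed
    then show ?thesis using q by (simp add: lookup_psi e)
  qed
  have A: "dim_row (psi_mat D q g) = length ?us" by (simp add: psi_mat_def coord_mat_def)
  have "mat_trace (psi_mat D q g ^\<^sub>m k) = (\<Sum>i<length ?us.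
      lookup (frob_product q g k) (exp_scale (q ^ k - 1) (?us ! i)))"
    using psi_mat_power_index[OF q g, of _ _ k] A
    by (simp add: mat_trace_def psi_op_funpow[OF q] lk[simplified])
  also have "\<dots> = (\<Sum>u\<in>set ?us. lookup (frob_product q g k) (exp_scale (q ^ k - 1) u))"
    using monomial_list(1)[of D] by (intro sum.reindex_bij_betw bij_betw_nth) auto
  finally show ?thesis by (simp add: monomial_list(2))
qed

section \<open>Finite subfields of the algebraic closure of a finite field\<close>

lemma prime_CHAR_finite_field: "prime CHAR('k::{field,finite})"
  by (rule prime_CHAR_semidom) (rule finite_imp_CHAR_pos, simp)

lemma CHAR_dvd_card_finite_field: "CHAR('k::{field,finite}) dvd CARD('k)"
proof -
  have "(\<Sum>x\<in>(UNIV :: 'k set). x + 1) = (\<Sum>x\<in>UNIV. x)"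
    by (rule sum.reindex_bij_witness[of _ "\<lambda>x. x - 1" "\<lambda>x. x + 1"]) auto
  then have "of_nat CARD('k) = (0 :: 'k)" by (simp add: sum.distrib)
  then show ?thesis by (simp add: of_nat_eq_0_iff_char_dvd)
qed

text \<open>A prime divisor of the order of the additive group is the order of a subgroup, hence kills a
  nonzero element, hence is the characteristic.\<close>

lemma card_finite_field_power: "\<exists>r>0. CARD('k::{field,finite}) = CHAR('k) ^ r"
proof -
  define G where "G = \<lparr>carrier = (UNIV :: 'k set), monoid.mult = (\<lambda>x y :: 'k. x + y), one = (0 :: 'k)\<rparr>"
  have grp: "group G"
    by (rule groupI) (auto simp: G_def add.assoc intro!: exI[of _ "- x" for x])
  interpret group G by (rule grp)
  have pow: "x [^]\<^bsub>G\<^esub> l = of_nat l * x" for x and l :: nat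
    by (induction l) (auto simp: G_def algebra_simps nat_pow_def)
  have "l = CHAR('k)" if l: "prime l" "l dvd CARD('k)" for l
  proof -
    obtain c where "CARD('k) = l ^ 1 * c" using l(2) by auto
    then have "\<exists>H. subgroup H G \<and> card H = l ^ 1"
      using l(1) grp by (intro sylow_thm[of l G 1 c]) (simp_all add: Coset.order_def G_def)
    then obtain H where H: "subgroup H G" "card H = l" by auto
    have "\<exists>x\<in>H. x \<noteq> 0"
    proof (rule ccontr)
      assume "\<not> (\<exists>x\<in>H. x \<noteq> 0)"
      then have "H \<subseteq> {0}" by auto
      from card_mono[OF _ this] H(2) prime_gt_1_nat[OF l(1)] show False by simp
    qed
    then obtain x where x: "x \<in> H" "x \<noteq> 0" by blast
    interpret GH: group "G\<lparr>carrier := H\<rparr>" by (rule subgroup_imp_group[OF H(1)])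
    have "x [^]\<^bsub>G\<lparr>carrier := H\<rparr>\<^esub> Coset.order (G\<lparr>carrier := H\<rparr>) = \<one>\<^bsub>G\<lparr>carrier := H\<rparr>\<^esub>"
      using x by (intro GH.pow_order_eq_1) auto
    then have "x [^]\<^bsub>G\<^esub> l = 0"
      using H(2) by (simp add: Coset.order_def nat_pow_def) (simp add: G_def)
    then have "of_nat l = (0 :: 'k)" using x by (simp add: pow)
    then have "CHAR('k) dvd l" by (simp add: of_nat_eq_0_iff_char_dvd)
    then show ?thesis
      using l(1) prime_CHAR_finite_field[where 'k = 'k] primes_dvd_imp_eq by metis
  qed
  then have "prime_factors CARD('k) \<subseteq> {CHAR('k)}"
    by (auto simp: prime_factors_dvd)
  then have "(\<Prod>l\<in>prime_factors CARD('k). l ^ multiplicity l CARD('k)) =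
      (\<Prod>l\<in>{CHAR('k)}. l ^ multiplicity l CARD('k))"
    using CHAR_dvd_card_finite_field prime_CHAR_finite_field
    by (intro prod.mono_neutral_left) (auto simp: prime_factors_multiplicity)
  then have "CARD('k) = CHAR('k) ^ multiplicity CHAR('k) CARD('k)"
    using prime_factorization_nat[of "CARD('k)"] by simp
  moreover have "multiplicity CHAR('k) CARD('k) > 0"
    using CHAR_dvd_card_finite_field prime_CHAR_finite_field
    by (intro multiplicity_gt_zero_iff[THEN iffD2]) auto
  ultimately show ?thesis by blast
qed

lemma finite_field_power_card: "a ^ CARD('k) = (a :: 'k::{field,finite})"
proof (cases "a = 0")
  case True then show ?thesis by (simp add: zero_power)
next
  case False
  have "(\<Prod>x\<in>UNIV - {0}. a * x) = (\<Prod>x\<in>UNIV - {0 :: 'k}. x)"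
    using False by (intro prod.reindex_bij_witness[of _ "\<lambda>x. x / a" "\<lambda>x. a * x"]) auto
  then have "a ^ (CARD('k) - 1) = 1"
    by (simp add: prod.distrib card_Diff_singleton)
  moreover have "CARD('k) = Suc (CARD('k) - 1)" by simp
  ultimately show ?thesis by (metis mult.right_neutral power_Suc)
qed

lemma card_finite_field_gt_1: "CARD('k::{field,finite}) > 1"
  using card_mono[of "UNIV :: 'k set" "{0, 1}"] by simp

lemma frobenius_sum:
  fixes F :: "'i \<Rightarrow> 'k::{field,finite} alg_closure"
  shows "(\<Sum>i\<in>I. F i) ^ (CARD('k) ^ j) = (\<Sum>i\<in>I. F i ^ (CARD('k) ^ j))"
proof -
  obtain r where r: "CARD('k) = CHAR('k) ^ r" using card_finite_field_power by blast
  show ?thesis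
    by (rule freshmans_dream_sum'[of _ "r * j"])
       (auto simp: r power_mult prime_CHAR_finite_field)
qed

lemma to_ac_power_card: "to_ac (a :: 'k::{field,finite}) ^ (CARD('k) ^ j) = to_ac a"
proof -
  have "a ^ (CARD('k) ^ j) = a"
    by (induction j) (auto simp: power_mult finite_field_power_card)
  then show ?thesis by (simp flip: to_ac_power)
qed

text \<open>The polynomial \<open>X ^ Q - X\<close> splits in the algebraic closure and has derivative \<open>- 1\<close>, so its \<open>Q\<close> roots
  are distinct.\<close>

lemma card_finite_subfield:
  assumes "k > 0"
  shows "finite (finite_subfield k :: 'k::{field,finite} alg_closure set)"
    and "card (finite_subfield k :: 'k::{field,finite} alg_closure set) = CARD('k) ^ k"
proof -
  define Q where "Q = CARD('k) ^ k"
  have Q: "Q > 1" unfolding Q_def by (rule one_less_power[OF card_finite_field_gt_1 assms])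
  have Q0: "of_nat Q = (0 :: 'k alg_closure)"
    unfolding of_nat_eq_0_iff_char_dvd Q_def CHAR_alg_closure
    by (rule dvd_trans[OF CHAR_dvd_card_finite_field]) (use assms in simp)
  define P :: "'k alg_closure poly" where "P = monom 1 Q - monom 1 1"
  have "degree (monom (1 :: 'k alg_closure) Q + - monom 1 1) = degree (monom (1 :: 'k alg_closure) Q)"
    using Q by (intro degree_add_eq_left) (simp add: degree_monom_eq)
  then have deg: "degree P = Q" by (simp add: P_def degree_monom_eq)
  then have lc: "lead_coeff P = 1" using Q by (simp add: P_def)
  have P0: "P \<noteq> 0" using deg Q by auto
  obtain A where A: "size A = degree P" "P = smult (lead_coeff P) (\<Prod>x\<in>#A. [:-x, 1:])"
    using alg_closed_imp_factorization[OF P0] by blast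
  have root: "poly P a = 0 \<longleftrightarrow> a \<in> finite_subfield k" for a
    by (simp add: P_def poly_monom finite_subfield_def Q_def)
  have P: "P = (\<Prod>x\<in>#A. [:-x, 1:])" using A(2) lc by simp
  have setA: "set_mset A = finite_subfield k"
  proof -
    have "poly P a = 0 \<longleftrightarrow> a \<in># A" for a
      unfolding P poly_prod_mset by (auto simp: image_iff)
    then show ?thesis using root by auto
  qed
  have "count A a = 1" if "a \<in># A" for a
  proof (rule ccontr)
    assume "count A a \<noteq> 1"
    with that have "count A a \<ge> 2" by (simp add: count_greater_zero_iff[symmetric] del: count_greater_zero_iff)
    then have "{#a, a#} \<subseteq># A" by (simp add: subseteq_mset_def)
    then obtain B where "A = {#a, a#} + B" by (auto simp: mset_subset_eq_exists_conv)
    then have eq: "P = [:-a, 1:] * ([:-a, 1:] * (\<Prod>x\<in>#B. [:-x, 1:]))" by (simp add: P mult.assoc)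
    have "poly (pderiv P) a = 0" unfolding eq pderiv_mult by simp
    moreover have "poly (pderiv P) a = -1"
      using Q0 by (simp add: P_def pderiv_diff pderiv_monom poly_monom)
    ultimately show False by simp
  qed
  then have "size A = card (set_mset A)" by (simp add: size_multiset_overloaded_eq)
  then show "finite (finite_subfield k :: 'k alg_closure set)"
    "card (finite_subfield k :: 'k alg_closure set) = CARD('k) ^ k"
    using A(1) deg by (simp_all add: Q_def setA[symmetric])
qed

lemma finite_subfield_closed:
  fixes a b :: "'k::{field,finite} alg_closure"
  shows "0 \<in> (finite_subfield k :: 'k alg_closure set)" "1 \<in> (finite_subfield k :: 'k alg_closure set)"
    "a \<in> finite_subfield k \<Longrightarrow> b \<in> finite_subfield k \<Longrightarrow> a + b \<in> finite_subfield k"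
    "a \<in> finite_subfield k \<Longrightarrow> b \<in> finite_subfield k \<Longrightarrow> a * b \<in> finite_subfield k"
    "a \<in> finite_subfield k \<Longrightarrow> - a \<in> finite_subfield k"
    "a \<in> finite_subfield k \<Longrightarrow> inverse a \<in> finite_subfield k"
    "to_ac c \<in> (finite_subfield k :: 'k alg_closure set)"
proof -
  let ?Q = "CARD('k) ^ k"
  have Q: "?Q > 0" by simp
  show z: "0 \<in> (finite_subfield k :: 'k alg_closure set)" using Q by (simp add: finite_subfield_def del: zero_less_power)
  show "1 \<in> (finite_subfield k :: 'k alg_closure set)" by (simp add: finite_subfield_def)
  have add: "(a + b) ^ ?Q = a ^ ?Q + b ^ ?Q" for a b :: "'k alg_closure"
    using frobenius_sum[of "\<lambda>i. if i then a else b" UNIV k] by (simp add: UNIV_bool add.commute)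
  then show "a \<in> finite_subfield k \<Longrightarrow> b \<in> finite_subfield k \<Longrightarrow> a + b \<in> finite_subfield k"
    by (simp add: finite_subfield_def)
  show "a \<in> finite_subfield k \<Longrightarrow> b \<in> finite_subfield k \<Longrightarrow> a * b \<in> finite_subfield k"
    by (simp add: finite_subfield_def power_mult_distrib)
  show "a \<in> finite_subfield k \<Longrightarrow> - a \<in> finite_subfield k"
    using add[of a "- a"] z by (simp add: finite_subfield_def add_eq_0_iff)
  show "a \<in> finite_subfield k \<Longrightarrow> inverse a \<in> finite_subfield k"
    by (simp add: finite_subfield_def power_inverse)
  show "to_ac c \<in> (finite_subfield k :: 'k alg_closure set)"
    by (simp add: finite_subfield_def to_ac_power_card)
qed

text \<open>The multiplicative group of a finite field is cyclic.\<close>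

lemma finite_subfield_generator:
  assumes k: "k > 0"
  obtains g :: "'k::{field,finite} alg_closure"
  where "g \<in> finite_subfield k" "g \<noteq> 0"
    "\<And>a. a \<in> finite_subfield k \<Longrightarrow> a \<noteq> 0 \<Longrightarrow> \<exists>i. a = g ^ i"
proof -
  define L where "L = (ring_of_type_algebra :: 'k alg_closure ring)"
  interpret L: field L unfolding L_def by (rule field_from_type_algebra)
  let ?F = "finite_subfield k :: 'k alg_closure set"
  have car: "carrier L = UNIV" and ops: "x \<otimes>\<^bsub>L\<^esub> y = x * y" "x \<oplus>\<^bsub>L\<^esub> y = x + y" "\<one>\<^bsub>L\<^esub> = 1" "\<zero>\<^bsub>L\<^esub> = 0" for x y
    by (auto simp: L_def ring_of_type_algebra_def)
  have neg: "\<ominus>\<^bsub>L\<^esub> x = - x" for x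
    by (rule L.minus_equality) (auto simp: car ops)
  have inv: "inv\<^bsub>L\<^esub> x = inverse x" if "x \<noteq> 0" for x
    using that by (intro L.inv_unique'[symmetric]) (auto simp: car ops)
  have "subring ?F L"
    by (rule L.subringI) (auto simp: car ops neg finite_subfield_closed)
  then have "subfield ?F L"
    by (rule L.subfieldI') (auto simp: ops inv finite_subfield_closed)
  then have fld: "field (L\<lparr>carrier := ?F\<rparr>)" by (rule L.subfield_iff(2))
  interpret F: field "L\<lparr>carrier := ?F\<rparr>" by (rule fld)
  have "finite (carrier (L\<lparr>carrier := ?F\<rparr>))" using card_finite_subfield(1)[OF k] by simp
  from F.finite_field_mult_group_has_gen[OF this] obtain g where
    g: "g \<in> ?F - {0}" "?F - {0} = {g [^]\<^bsub>L\<lparr>carrier := ?F\<rparr>\<^esub> i |i::nat. i \<in> UNIV}"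
    by (auto simp: carrier_mult_of ops)
  have pow: "g [^]\<^bsub>L\<lparr>carrier := ?F\<rparr>\<^esub> i = g ^ i" for i :: nat
    by (induction i) (auto simp: nat_pow_def ops mult.commute)
  show ?thesis
  proof (rule that)
    show "g \<in> ?F" "g \<noteq> 0" using g(1) by auto
    show "\<exists>i. a = g ^ i" if "a \<in> ?F" "a \<noteq> 0" for a
      using that g(2) unfolding pow by blast
  qed
qed

definition torus_points_over :: "nat \<Rightarrow> ('n::finite \<Rightarrow> 'k::{field,finite} alg_closure) set" where
  "torus_points_over k = {x. \<forall>i. x i \<in> finite_subfield k - {0}}"

lemma torus_points_over_PiE:
  "(torus_points_over k :: ('n::finite \<Rightarrow> 'k::{field,finite} alg_closure) set) =
     Pi\<^sub>E UNIV (\<lambda>_. finite_subfield k - {0})"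
  by (auto simp: torus_points_over_def PiE_def)

lemma finite_torus_points_over:
  assumes "k > 0"
  shows "finite (torus_points_over k :: ('n::finite \<Rightarrow> 'k::{field,finite} alg_closure) set)"
  unfolding torus_points_over_PiE
  using card_finite_subfield(1)[OF assms, where 'k = 'k] by (intro finite_PiE) auto

section \<open>The unramified ring of integers\<close>

text \<open>The multiples of \<open>p\<close> among the factors \<open>1, \<dots>, n\<close> are \<open>p\<close> times the factors of the factorial of
  \<open>n div p\<close>.\<close>

lemma multiplicity_fact_div:
  assumes p: "prime (p::nat)"
  shows "multiplicity p (fact n) = n div p + multiplicity p (fact (n div p) :: nat)"
proof (induction n)
  case 0 show ?case by simp
next
  case (Suc n)
  have Suc_n: "multiplicity p (fact (Suc n) :: nat) = multiplicity p (Suc n) + multiplicity p (fact n :: nat)"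
    using p by (simp only: fact_Suc of_nat_id) (intro prime_elem_multiplicity_mult_distrib; simp)
  show ?case
  proof (cases "p dvd Suc n")
    case False
    then have "Suc n div p = n div p" by (simp add: div_Suc dvd_eq_mod_eq_0)
    with False show ?thesis unfolding Suc_n by (simp add: Suc.IH not_dvd_imp_multiplicity_0)
  next
    case True
    then have d: "Suc n div p = Suc (n div p)" by (simp add: div_Suc dvd_eq_mod_eq_0)
    have "multiplicity p (Suc n) = multiplicity p (p * Suc (n div p))"
      using True d by (metis dvd_mult_div_cancel)
    also have "\<dots> = Suc (multiplicity p (Suc (n div p)))"
      using p by (subst prime_elem_multiplicity_mult_distrib) auto
    finally have m: "multiplicity p (Suc n) = Suc (multiplicity p (Suc (n div p)))" .
    have "multiplicity p (fact (Suc (n div p)) :: nat) =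
        multiplicity p (Suc (n div p)) + multiplicity p (fact (n div p) :: nat)"
      using p by (simp only: fact_Suc of_nat_id) (intro prime_elem_multiplicity_mult_distrib; simp)
    then show ?thesis unfolding Suc_n d m by (simp add: Suc.IH)
  qed
qed

lemma multiplicity_fact_less:
  assumes p: "prime (p::nat)"
  shows "n > 0 \<Longrightarrow> multiplicity p (fact n :: nat) < n"
proof (induction n rule: less_induct)
  case (less n)
  show ?case
  proof (cases "n div p = 0")
    case True
    then show ?thesis using less.prems multiplicity_fact_div[OF p, of n] by simp
  next
    case False
    have p2: "p \<ge> 2" using prime_ge_2_nat[OF p] .
    then have "n div p < n" using less.prems by simp
    from less.IH[OF this] False have "multiplicity p (fact (n div p) :: nat) < n div p" by simp
    moreover have "n div p * 2 \<le> n div p * p" using p2 by simp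
    then have "n div p * 2 \<le> n" using div_times_less_eq_dividend[of n p] by linarith
    ultimately show ?thesis using multiplicity_fact_div[OF p, of n] by simp
  qed
qed

lemma nat_prime_decomp:
  assumes "prime (p::nat)" "n > 0"
  obtains b where "n = p ^ multiplicity p n * b" "\<not> p dvd b"
  using multiplicity_decompose'[of n p] assms by (metis not_prime_unit less_not_refl2)

text \<open>\<open>R\<close> is a local ring whose maximal ideal, the kernel of \<open>red\<close>, is generated by \<open>p\<close>. These are the
  properties of the ring of integers of an unramified extension that the argument is based on.\<close>

locale unramified_ring = subring_hom R red
  for R :: "'K::field_char_0 set" and red :: "'K \<Rightarrow> 'k::{field,finite}" +
  fixes p q :: nat
  assumes p_eq: "p = CHAR('k)" and q_eq: "q = CARD('k)"
    and red_eq_0_iff: "x \<in> R \<Longrightarrow> red x = 0 \<longleftrightarrow> (\<exists>y\<in>R. x = of_nat p * y)"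
    and inverse_mem: "x \<in> R \<Longrightarrow> red x \<noteq> 0 \<Longrightarrow> inverse x \<in> R"
begin

lemma prime_p: "prime p"
  unfolding p_eq by (rule prime_CHAR_finite_field)

definition pideal :: "nat \<Rightarrow> 'K set" where
  "pideal M = (\<lambda>y. of_nat (p ^ M) * y) ` R"

lemma pidealI: "y \<in> R \<Longrightarrow> of_nat (p ^ M) * y \<in> pideal M"
  by (auto simp: pideal_def)

lemma pideal_subset: "x \<in> pideal M \<Longrightarrow> x \<in> R"
  unfolding pideal_def by (auto intro: mult_mem of_nat_mem simp del: of_nat_power)

lemma pideal_mono: "M \<le> M' \<Longrightarrow> x \<in> pideal M' \<Longrightarrow> x \<in> pideal M"
proof -
  assume "M \<le> M'" "x \<in> pideal M'"
  then obtain y where y: "y \<in> R" "x = of_nat (p ^ M') * y" by (auto simp: pideal_def)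
  have "x = of_nat (p ^ M) * (of_nat (p ^ (M' - M)) * y)"
    using \<open>M \<le> M'\<close> y by (simp flip: power_add mult.assoc)
  then show ?thesis using pidealI[OF mult_mem[OF of_nat_mem y(1)]] by metis
qed

lemma pideal_add: "x \<in> pideal M \<Longrightarrow> y \<in> pideal M \<Longrightarrow> x + y \<in> pideal M"
  unfolding pideal_def by (auto simp: add_mem simp flip: distrib_left)

lemma pideal_zero: "0 \<in> pideal M"
  using pidealI[OF zero_mem] by simp

lemma pideal_sum: "(\<And>i. i \<in> I \<Longrightarrow> F i \<in> pideal M) \<Longrightarrow> sum F I \<in> pideal M"
  by (induction I rule: infinite_finite_induct) (auto simp: pideal_zero pideal_add)

lemma pideal_mult: "x \<in> pideal M \<Longrightarrow> y \<in> pideal M' \<Longrightarrow> x * y \<in> pideal (M + M')"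
proof -
  assume "x \<in> pideal M" "y \<in> pideal M'"
  then obtain a b where "a \<in> R" "b \<in> R" "x = of_nat (p ^ M) * a" "y = of_nat (p ^ M') * b"
    by (auto simp: pideal_def)
  then show ?thesis
    using pidealI[OF mult_mem[of a b], of "M + M'"] by (simp add: power_add mult_ac)
qed

lemma pideal_mult_left: "x \<in> R \<Longrightarrow> y \<in> pideal M \<Longrightarrow> x * y \<in> pideal M"
  using pideal_mult[of x 0 y M] by (simp add: pideal_def)

lemma inverse_of_nat_mem: "\<not> p dvd b \<Longrightarrow> inverse (of_nat b) \<in> R"
  by (rule inverse_mem[OF of_nat_mem]) (simp add: hom_of_nat of_nat_eq_0_iff_char_dvd p_eq)

lemma pideal_divide:
  assumes x: "x \<in> pideal (M + multiplicity p n)" and n: "n > 0"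
  shows "x / of_nat n \<in> pideal M"
proof -
  obtain b where b: "n = p ^ multiplicity p n * b" "\<not> p dvd b"
    using nat_prime_decomp[OF prime_p n] by blast
  obtain y where y: "y \<in> R" "x = of_nat (p ^ (M + multiplicity p n)) * y"
    using x by (auto simp: pideal_def)
  have p0: "(of_nat p :: 'K) \<noteq> 0" using prime_gt_0_nat[OF prime_p] by simp
  have "of_nat n = (of_nat p ^ multiplicity p n * of_nat b :: 'K)"
    by (subst b(1)) simp
  then have "x / of_nat n = of_nat (p ^ M) * (y * inverse (of_nat b))"
    using p0 by (simp add: y(2) power_add divide_inverse)
  then show ?thesis using pidealI[OF mult_mem[OF y(1) inverse_of_nat_mem[OF b(2)]]] by metis
qed

text \<open>The \<open>i\<close>-th power of \<open>H\<close> is divisible by \<open>p ^ (m * i)\<close>, and its denominator \<open>i!\<close> contains fewer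
  than \<open>i\<close> factors \<open>p\<close>, so that at least \<open>m * i - (i - 1)\<close>, hence at least \<open>m\<close>, of them remain.\<close>

lemma exp_pideal:
  assumes m: "m \<ge> 1" and H: "\<And>k. fps_nth H k \<in> pideal m" and n: "n > 0"
  shows "fps_nth (fps_compose (fps_exp 1) H) n \<in> pideal m"
proof -
  have pow: "fps_nth (H ^ i) k \<in> pideal (m * i)" for i k
  proof (induction i arbitrary: k)
    case 0
    have "fps_nth (1 :: 'K fps) k \<in> R" by (cases k) (auto simp: zero_mem one_mem)
    then show ?case by (simp add: pideal_def)
  next
    case (Suc i)
    show ?case by (auto simp: fps_mult_nth intro!: pideal_sum pideal_mult H Suc)
  qed
  have "fps_nth (fps_exp 1 :: 'K fps) i * fps_nth (H ^ i) n \<in> pideal m" for i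
  proof (cases "i = 0")
    case True then show ?thesis using n by (simp add: pideal_zero)
  next
    case False
    have "multiplicity p (fact i :: nat) < i" using multiplicity_fact_less[OF prime_p] False by simp
    then have "multiplicity p (fact i :: nat) \<le> m * (i - 1)"
      using m by (metis Suc_pred' less_Suc_eq_le mult.commute mult_le_mono2 nat_mult_1_right
          order.trans gr_zeroI False)
    then have "m + multiplicity p (fact i :: nat) \<le> m * i"
      using False by (cases i) auto
    then have "fps_nth (H ^ i) n \<in> pideal (m + multiplicity p (fact i :: nat))"
      using pow by (rule pideal_mono)
    from pideal_divide[OF this] show ?thesis by (simp add: field_simps)
  qed
  then show ?thesis unfolding fps_compose_nth by (intro pideal_sum)
qed

section \<open>Polynomials over the ring of integers and their values in the residue field\<close>

text \<open>
  The ring \<open>R[X]\<close> and its homomorphism to the algebraic closure of the residue field that sends \<open>X\<close>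
  to \<open>g\<close>. They present the unramified extension of \<open>R\<close> with residue field generated by \<open>g\<close> as a
  quotient of \<open>R[X]\<close>.\<close>

definition RX :: "'K poly set" where
  "RX = {a. \<forall>i. coeff a i \<in> R}"

definition redX :: "'k alg_closure \<Rightarrow> 'K poly \<Rightarrow> 'k alg_closure" where
  "redX g a = (\<Sum>i\<le>degree a. to_ac (red (coeff a i)) * g ^ i)"

lemma redX_le: "degree a \<le> n \<Longrightarrow> redX g a = (\<Sum>i\<le>n. to_ac (red (coeff a i)) * g ^ i)"
  unfolding redX_def by (rule sum.mono_neutral_left) (auto simp: coeff_eq_0 hom_zero)

lemma RX_coeff: "a \<in> RX \<Longrightarrow> coeff a i \<in> R"
  by (simp add: RX_def)

lemma const_mem_RX: "c \<in> R \<Longrightarrow> [:c:] \<in> RX"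
  by (auto simp: RX_def coeff_pCons zero_mem split: nat.splits)

lemma redX_const: "redX g [:c:] = to_ac (red c)"
  by (simp add: redX_def)

lemma X_mem_RX: "[:0, 1:] \<in> RX"
  by (auto simp: RX_def coeff_pCons zero_mem one_mem split: nat.splits)

lemma redX_X: "redX g [:0, 1:] = g"
  by (simp add: redX_def hom_zero hom_one)

lemma subring_hom_redX: "subring_hom RX (redX g)"
proof
  show "1 \<in> RX" using const_mem_RX[OF one_mem] by (simp add: one_pCons)
  show "redX g 1 = 1" using redX_const[of g 1] by (simp add: one_pCons hom_one)
next
  fix a b assume a: "a \<in> RX" and b: "b \<in> RX"
  then show "a + b \<in> RX" by (auto simp: RX_def add_mem)
  show "a * b \<in> RX" using a b by (auto simp: RX_def coeff_mult intro!: sum_mem mult_mem)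
  let ?n = "max (degree a) (degree b)"
  have "redX g (a + b) = (\<Sum>i\<le>?n. to_ac (red (coeff (a + b) i)) * g ^ i)"
    by (rule redX_le) (rule degree_add_le_max)
  also have "\<dots> = redX g a + redX g b"
    using a b by (simp add: redX_le[of a ?n] redX_le[of b ?n] hom_add RX_coeff distrib_right sum.distrib)
  finally show "redX g (a + b) = redX g a + redX g b" .
  let ?A = "\<lambda>c :: 'K poly. map_poly (\<lambda>x. to_ac (red x)) c"
  have co: "coeff (?A c) i = to_ac (red (coeff c i))" for c i
    by (rule coeff_map_poly) (simp add: hom_zero)
  have rp: "redX g c = poly (?A c) g" for c
  proof -
    have "degree (?A c) \<le> degree c" by (rule degree_le) (simp add: co coeff_eq_0 hom_zero)
    then have "poly (?A c) g = (\<Sum>i\<le>degree c. coeff (?A c) i * g ^ i)"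
      unfolding poly_altdef by (intro sum.mono_neutral_left) (auto simp: coeff_eq_0)
    then show ?thesis by (simp add: redX_def co)
  qed
  have "?A (a * b) = ?A a * ?A b"
  proof (rule poly_eqI)
    fix i
    have "to_ac (red (coeff (a * b) i)) = (\<Sum>j\<le>i. to_ac (red (coeff a j)) * to_ac (red (coeff b (i - j))))"
      using a b unfolding coeff_mult
      by (subst hom_sum) (auto simp: to_ac_sum hom_mult RX_coeff mult_mem)
    then show "coeff (?A (a * b)) i = coeff (?A a * ?A b) i"
      by (simp add: co coeff_mult)
  qed
  then show "redX g (a * b) = redX g a * redX g b" by (simp add: rp)
next
  fix a assume "a \<in> RX"
  then show "- a \<in> RX" by (auto simp: RX_def uminus_mem)
qed

text \<open>Choose \<open>h\<close> of minimal degree among the monic polynomials over \<open>R\<close> that vanish at \<open>g\<close> in the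
  residue field. If a polynomial of smaller degree vanishes there but is not divisible by \<open>p\<close>,
  dropping the terms above its last unit coefficient and dividing by this coefficient yields a
  monic one that contradicts minimality.\<close>

lemma exists_minimal_lift:
  assumes g: "g ^ N = 1" and N: "N > 0"
  obtains h where "h \<in> RX" "lead_coeff h = 1" "redX g h = 0" "degree h > 0"
    "\<And>r i. r \<in> RX \<Longrightarrow> redX g r = 0 \<Longrightarrow> degree r < degree h \<Longrightarrow> red (coeff r i) = 0"
proof -
  interpret X: subring_hom RX "redX g" by (rule subring_hom_redX)
  define P where "P h \<longleftrightarrow> h \<in> RX \<and> lead_coeff h = 1 \<and> redX g h = 0" for h
  \<comment> \<open>There is such a polynomial, namely \<open>X ^ N - 1\<close>.\<close>
  have "P (monom 1 N + [:-1:])"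
  proof -
    have m: "monom 1 N = [:0, 1:] ^ N" by (simp add: monom_altdef)
    have "monom 1 N \<in> RX" "redX g (monom 1 N) = 1"
      unfolding m using g by (auto simp: X.power_mem X_mem_RX X.hom_power redX_X)
    moreover have "[:-1:] \<in> RX" "redX g [:-1:] = -1"
      using const_mem_RX[OF uminus_mem[OF one_mem]] by (auto simp: redX_const hom_uminus one_mem hom_one)
    ultimately have "monom 1 N + [:-1:] \<in> RX" "redX g (monom 1 N + [:-1:]) = 0"
      by (auto simp: X.add_mem X.hom_add)
    moreover have "degree (monom 1 N + [:-1:] :: 'K poly) = degree (monom (1 :: 'K) N)"
      using N by (intro degree_add_eq_left) (simp add: degree_monom_eq)
    then have "lead_coeff (monom 1 N + [:-1:] :: 'K poly) = 1"
      using N by (cases N) (simp_all add: degree_monom_eq)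
    ultimately show ?thesis by (simp add: P_def)
  qed
  then obtain h where h: "P h" "\<And>h'. P h' \<Longrightarrow> degree h \<le> degree h'"
    using exists_least_iff[of "\<lambda>n. \<exists>h. P h \<and> degree h = n"] by (metis not_less)
  have "degree h > 0"
  proof (rule ccontr)
    assume "\<not> degree h > 0"
    then have "h = [:1:]" using h(1) by (auto simp: P_def elim!: degree_eq_zeroE)
    then show False using h(1) by (simp add: P_def redX_const hom_one)
  qed
  moreover have "red (coeff r i) = 0" if r: "r \<in> RX" "redX g r = 0" "degree r < degree h" for r i
  proof (rule ccontr)
    assume i: "red (coeff r i) \<noteq> 0"
    define S where "S = {i. red (coeff r i) \<noteq> 0}"
    have S: "finite S" "S \<subseteq> {..degree r}"
    proof -
      show "S \<subseteq> {..degree r}" unfolding S_def by (auto intro!: le_degree simp: hom_zero)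
      then show "finite S" by (rule finite_subset) simp
    qed
    define d where "d = Max S"
    have d: "d \<in> S" using S(1) i unfolding d_def by (intro Max_in) (auto simp: S_def)
    have above: "red (coeff r j) = 0" if "j > d" for j
      using Max_ge[OF S(1), of j] that by (auto simp: d_def S_def)
    define u where "u = inverse (coeff r d)"
    have u: "u \<in> R" using d r(1) by (auto simp: u_def S_def RX_def intro!: inverse_mem)
    have cd: "coeff r d \<noteq> 0" using d by (auto simp: S_def hom_zero)
    define w where "w = poly_cutoff (Suc d) (smult u r)"
    have cw: "coeff w j = (if j \<le> d then u * coeff r j else 0)" for j
      by (auto simp: w_def coeff_poly_cutoff)
    have "degree w \<le> d" by (rule degree_le) (simp add: cw)
    moreover have "coeff w d = 1" using cd by (simp add: cw u_def)
    ultimately have dw: "degree w = d" by (metis le_antisym le_degree one_neq_zero)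
    have w: "w \<in> RX" using u r(1) by (auto simp: RX_def cw mult_mem zero_mem)
    have "redX g w = (\<Sum>j\<le>degree r. to_ac (red (coeff w j)) * g ^ j)"
      using d S(2) dw by (intro redX_le) auto
    also have "\<dots> = (\<Sum>j\<le>degree r. to_ac (red u) * (to_ac (red (coeff r j)) * g ^ j))"
      using u r(1) above by (intro sum.cong) (auto simp: cw hom_mult RX_coeff hom_zero)
    also have "\<dots> = 0" using r(2) by (simp add: redX_def flip: sum_distrib_left)
    finally have "P w" using w dw \<open>coeff w d = 1\<close> by (simp add: P_def)
    from h(2)[OF this] show False using dw d S(2) r(3) by auto
  qed
  ultimately show ?thesis using that h(1) by (auto simp: P_def)
qed

end

section \<open>Congruences in an unramified extension\<close>

locale residue_extension = unramified_ring R red p q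
  for R :: "'K::field_char_0 set" and red :: "'K \<Rightarrow> 'k::{field,finite}" and p q :: nat +
  fixes g :: "'k alg_closure" and h :: "'K poly"
  assumes h_mem: "h \<in> RX" and h_monic: "lead_coeff h = 1" and h_root: "redX g h = 0"
    and h_degree: "degree h > 0"
    and h_minimal: "r \<in> RX \<Longrightarrow> redX g r = 0 \<Longrightarrow> degree r < degree h \<Longrightarrow> red (coeff r i) = 0"
begin

sublocale X: subring_hom RX "redX g"
  by (rule subring_hom_redX)

text \<open>The ideal generated by \<open>h\<close> and \<open>p ^ M\<close>: congruence modulo \<open>J M\<close> is congruence modulo \<open>p ^ M\<close> in the
  extension \<open>R[X]/(h)\<close>.\<close>

definition J :: "nat \<Rightarrow> 'K poly set" where
  "J M = {a. \<exists>b\<in>RX. \<exists>c\<in>RX. a = h * b + of_nat (p ^ M) * c}"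

lemma JI: "b \<in> RX \<Longrightarrow> c \<in> RX \<Longrightarrow> h * b + of_nat (p ^ M) * c \<in> J M"
  unfolding J_def by blast

lemma JE:
  assumes "a \<in> J M"
  obtains b c where "b \<in> RX" "c \<in> RX" "a = h * b + of_nat (p ^ M) * c"
  using assms unfolding J_def by blast

lemma J_zero: "0 \<in> J M"
  using JI[OF X.zero_mem X.zero_mem] by simp

lemma J_add: "a \<in> J M \<Longrightarrow> b \<in> J M \<Longrightarrow> a + b \<in> J M"
proof (elim JE)
  fix x y x' y' assume m: "x \<in> RX" "y \<in> RX" "x' \<in> RX" "y' \<in> RX"
    and eq: "a = h * x + of_nat (p ^ M) * y" "b = h * x' + of_nat (p ^ M) * y'"
  have "a + b = h * (x + x') + of_nat (p ^ M) * (y + y')" by (simp add: eq algebra_simps)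
  then show ?thesis using JI[OF X.add_mem[OF m(1,3)] X.add_mem[OF m(2,4)]] by metis
qed

lemma J_mult_left: "a \<in> RX \<Longrightarrow> b \<in> J M \<Longrightarrow> a * b \<in> J M"
proof (elim JE)
  fix x y assume a: "a \<in> RX" and m: "x \<in> RX" "y \<in> RX" and eq: "b = h * x + of_nat (p ^ M) * y"
  have "a * b = h * (a * x) + of_nat (p ^ M) * (a * y)" by (simp add: eq algebra_simps)
  then show ?thesis using JI[OF X.mult_mem[OF a m(1)] X.mult_mem[OF a m(2)]] by metis
qed

lemma J_uminus: "a \<in> J M \<Longrightarrow> - a \<in> J M"
  using J_mult_left[OF X.uminus_mem[OF X.one_mem], of a M] by simp

lemma J_diff: "a \<in> J M \<Longrightarrow> b \<in> J M \<Longrightarrow> a - b \<in> J M"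
  using J_add[OF _ J_uminus] by simp

lemma J_sum: "(\<And>i. i \<in> I \<Longrightarrow> F i \<in> J M) \<Longrightarrow> sum F I \<in> J M"
  by (induction I rule: infinite_finite_induct) (auto simp: J_zero J_add)

lemma J_mono: "M \<le> M' \<Longrightarrow> a \<in> J M' \<Longrightarrow> a \<in> J M"
proof (elim JE)
  fix x y assume le: "M \<le> M'" and m: "x \<in> RX" "y \<in> RX" and eq: "a = h * x + of_nat (p ^ M') * y"
  have "a = h * x + of_nat (p ^ M) * (of_nat (p ^ (M' - M)) * y)"
    using le by (simp add: eq flip: power_add mult.assoc)
  then show ?thesis using JI[OF m(1) X.mult_mem[OF X.of_nat_mem m(2)]] by metis
qed

lemma J_mult: "a \<in> J M \<Longrightarrow> b \<in> J M' \<Longrightarrow> a * b \<in> J (M + M')"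
proof (elim JE)
  fix x y x' y' assume m: "x \<in> RX" "y \<in> RX" "x' \<in> RX" "y' \<in> RX"
    and eq: "a = h * x + of_nat (p ^ M) * y" "b = h * x' + of_nat (p ^ M') * y'"
  have "a * b = h * (x * (h * x' + of_nat (p ^ M') * y') + of_nat (p ^ M) * y * x')
      + of_nat (p ^ (M + M')) * (y * y')"
    by (simp add: eq algebra_simps power_add)
  then show ?thesis
    using m by (auto intro!: JI X.add_mem X.mult_mem h_mem X.of_nat_mem simp del: of_nat_power)
qed

lemma of_nat_mem_J: "p ^ e dvd n \<Longrightarrow> of_nat n \<in> J e"
proof -
  assume "p ^ e dvd n"
  then obtain c where "n = p ^ e * c" by auto
  then have "of_nat n = h * 0 + of_nat (p ^ e) * of_nat c" by simp
  then show ?thesis using JI[OF X.zero_mem X.of_nat_mem] by metis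
qed

lemma euclidean_division:
  assumes "a \<in> RX"
  shows "\<exists>b\<in>RX. \<exists>c\<in>RX. a = h * b + c \<and> degree c < degree h"
  using assms
proof (induction "degree a" arbitrary: a rule: less_induct)
  case less
  show ?case
  proof (cases "degree a < degree h")
    case True
    then show ?thesis using less.prems X.zero_mem by (intro bexI[of _ 0] bexI[of _ a]) auto
  next
    case False
    define s where "s = monom (lead_coeff a) (degree a - degree h)"
    have s: "s \<in> RX" using less.prems by (auto simp: RX_def s_def zero_mem)
    have "degree (h * s) \<le> degree a"
      using False by (intro order.trans[OF degree_mult_le])
        (auto simp: s_def intro!: order.trans[OF add_left_mono[OF degree_monom_le]])
    then have le: "degree (a - h * s) \<le> degree a" by (intro degree_diff_le) auto
    have "coeff (h * s) (degree a) = lead_coeff a"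
      using False h_monic by (simp add: s_def mult.commute[of h] coeff_monom_mult)
    then have co: "coeff (a - h * s) (degree a) = 0" by simp
    have lt: "degree (a - h * s) < degree a"
    proof (rule ccontr)
      assume "\<not> degree (a - h * s) < degree a"
      then have eq: "degree (a - h * s) = degree a" using le by simp
      with co have "a - h * s = 0" by (metis leading_coeff_0_iff)
      then have "degree a = 0" using eq by simp
      then show False using False h_degree by simp
    qed
    have mem: "a - h * s \<in> RX" using less.prems s h_mem by (intro X.diff_mem X.mult_mem)
    from less.hyps[OF lt mem] obtain b c where bc: "b \<in> RX" "c \<in> RX" "a - h * s = h * b + c" "degree c < degree h"
      by blast
    have "a = h * (b + s) + c" using bc(3) by (simp add: algebra_simps)
    then show ?thesis using bc X.add_mem[OF bc(1) s] by blast
  qed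
qed

text \<open>Modulo \<open>h\<close> the polynomial may be replaced by its remainder, which by the choice of \<open>h\<close> vanishes in the
  residue field only if all its coefficients are divisible by \<open>p\<close>.\<close>

lemma redX_eq_0_iff: "a \<in> RX \<Longrightarrow> redX g a = 0 \<longleftrightarrow> a \<in> J 1"
proof
  assume a: "a \<in> RX" "redX g a = 0"
  obtain b c where bc: "b \<in> RX" "c \<in> RX" "a = h * b + c" "degree c < degree h"
    using euclidean_division[OF a(1)] by blast
  have "redX g c = 0"
    using a(2) bc(1,2) by (simp add: bc(3) X.hom_add X.hom_mult X.mult_mem h_mem h_root)
  then have "\<exists>y. y \<in> R \<and> coeff c i = of_nat p * y" for i
    using h_minimal[OF bc(2) _ bc(4), of i] red_eq_0_iff[OF RX_coeff[OF bc(2)]] by blast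
  then obtain y where y: "y i \<in> R" "coeff c i = of_nat p * y i" for i by metis
  define d where "d = smult (inverse (of_nat p)) c"
  have p0: "(of_nat p :: 'K) \<noteq> 0" using prime_gt_0_nat[OF prime_p] by simp
  have "coeff d i = y i" for i using p0 y(2)[of i] by (simp add: d_def)
  then have d: "d \<in> RX" using y(1) by (simp add: RX_def)
  have "of_nat (p ^ 1) * d = c" using p0 by (simp add: d_def of_nat_poly)
  then show "a \<in> J 1" using JI[OF bc(1) d, of 1] bc(3) by simp
next
  assume "a \<in> J 1"
  moreover have "of_nat p = (0 :: 'k alg_closure)"
    by (simp add: of_nat_eq_0_iff_char_dvd p_eq)
  ultimately show "redX g a = 0"
    by (elim JE) (simp add: X.hom_add X.hom_mult X.mult_mem h_mem h_root X.of_nat_mem X.hom_of_nat)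
qed

lemma redX_eq_iff: "a \<in> RX \<Longrightarrow> b \<in> RX \<Longrightarrow> redX g a = redX g b \<longleftrightarrow> a - b \<in> J 1"
  using redX_eq_0_iff[OF X.diff_mem, of a b] by (simp add: X.hom_diff)

text \<open>Since \<open>h\<close> is monic of positive degree, a constant cannot become divisible by \<open>p ^ M\<close> by
  passing to the extension.\<close>

lemma const_mem_J: "[:x:] \<in> J M \<Longrightarrow> x \<in> pideal M"
proof (elim JE)
  fix b c assume bc: "b \<in> RX" "c \<in> RX" and eq: "[:x:] = h * b + of_nat (p ^ M) * c"
  obtain b' c' where b'c': "b' \<in> RX" "c' \<in> RX" "c = h * b' + c'" "degree c' < degree h"
    using euclidean_division[OF bc(2)] by blast
  have e: "[:x:] - of_nat (p ^ M) * c' = h * (b + of_nat (p ^ M) * b')"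
    by (simp add: eq b'c'(3) algebra_simps)
  have "degree ([:x:] - of_nat (p ^ M) * c') < degree h"
    using b'c'(4) h_degree by (intro degree_diff_less) (auto simp: of_nat_poly
      intro: le_less_trans[OF degree_smult_le] simp flip: of_nat_power)
  moreover have "h \<noteq> 0" using h_degree by auto
  ultimately have "b + of_nat (p ^ M) * b' = 0"
    unfolding e by (cases "b + of_nat (p ^ M) * b' = 0") (auto simp: degree_mult_eq)
  then have "[:x:] = of_nat (p ^ M) * c'" using e by simp
  then have "coeff [:x:] 0 = of_nat (p ^ M) * coeff c' 0"
    by (simp add: of_nat_poly del: of_nat_power)
  then show ?thesis using pidealI[OF RX_coeff[OF b'c'(2)], of M 0] by simp
qed

text \<open>In the factorization of \<open>a ^ p - b ^ p\<close>, the cofactor of \<open>a - b\<close> is a sum of \<open>p\<close> terms which become equal in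
  the residue field, so it contributes one more factor \<open>p\<close>.\<close>

lemma power_p_congruent:
  assumes a: "a \<in> RX" and b: "b \<in> RX" and ab: "a - b \<in> J i" and i: "i \<ge> 1"
  shows "a ^ p - b ^ p \<in> J (Suc i)"
proof -
  have ab1: "a - b \<in> J 1" using i ab by (rule J_mono)
  have red: "redX g a = redX g b" using redX_eq_iff[OF a b] ab1 by simp
  define S where "S = (\<Sum>j<p. b ^ (p - Suc j) * a ^ j)"
  have S: "S \<in> RX" unfolding S_def using a b by (intro X.sum_mem X.mult_mem X.power_mem)
  have "redX g S = (\<Sum>j<p. redX g b ^ (p - Suc j) * redX g b ^ j)"
    unfolding S_def using a b
    by (subst X.hom_sum) (auto simp: X.hom_mult X.hom_power X.power_mem X.mult_mem red)
  also have "\<dots> = (\<Sum>j<p. redX g b ^ (p - 1))"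
    by (intro sum.cong) (auto simp flip: power_add)
  also have "\<dots> = 0"
    using of_nat_eq_0_iff_char_dvd[of p, where 'a = "'k alg_closure"] by (simp add: p_eq)
  finally have S1: "S \<in> J 1" using redX_eq_0_iff[OF S] by simp
  have "a ^ p - b ^ p = (a - b) * S"
    unfolding S_def by (rule power_diff_sumr2)
  then show ?thesis using J_mult[OF ab S1] by simp
qed

lemma power_p_power_congruent:
  assumes a: "a \<in> RX" and b: "b \<in> RX" and ab: "a - b \<in> J i" and i: "i \<ge> 1"
  shows "a ^ (p ^ e) - b ^ (p ^ e) \<in> J (i + e)"
proof (induction e)
  case 0 show ?case using ab by simp
next
  case (Suc e)
  have "(a ^ (p ^ e)) ^ p - (b ^ (p ^ e)) ^ p \<in> J (Suc (i + e))"
    using a b i by (intro power_p_congruent X.power_mem Suc) auto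
  then show ?case by (simp add: mult.commute flip: power_mult)
qed

text \<open>An element whose image is a root of unity is a unit: its power with exponent \<open>N * p ^ M\<close> is
  congruent to 1 modulo \<open>J M\<close>.\<close>

lemma J_cancel:
  assumes a: "a \<in> RX" and b: "b \<in> RX" and ab: "a * b \<in> J M" and N: "redX g a ^ N = 1" "N > 0"
  shows "b \<in> J M"
proof -
  have "a ^ N - 1 \<in> J 1"
    using redX_eq_iff[OF X.power_mem[OF a, of N] X.one_mem] a N by (simp add: X.hom_power X.hom_one)
  from power_p_power_congruent[OF X.power_mem[OF a] X.one_mem this order_refl, of M]
  have "(a ^ N) ^ (p ^ M) - 1 \<in> J M" by (intro J_mono[of M "1 + M"]) auto
  then have 1: "b * ((a ^ N) ^ (p ^ M) - 1) \<in> J M" using b by (intro J_mult_left)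
  obtain l where l: "N * p ^ M = Suc l" using N(2) prime_gt_0_nat[OF prime_p] by (cases "N * p ^ M") auto
  have "(a ^ N) ^ (p ^ M) = a ^ Suc l" by (simp only: l flip: power_mult)
  then have "b = a ^ l * (a * b) - b * ((a ^ N) ^ (p ^ M) - 1)"
    by (simp add: algebra_simps)
  moreover have "a ^ l * (a * b) \<in> J M" by (rule J_mult_left[OF X.power_mem[OF a] ab])
  ultimately show ?thesis using J_diff 1 by metis
qed

lemma J_prod_congruent:
  assumes "\<And>i. i \<in> I \<Longrightarrow> F i \<in> RX" "\<And>i. i \<in> I \<Longrightarrow> G i \<in> RX" "\<And>i. i \<in> I \<Longrightarrow> F i - G i \<in> J M"
  shows "(\<Prod>i\<in>I. F i) - (\<Prod>i\<in>I. G i) \<in> J M"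
  using assms
proof (induction I rule: infinite_finite_induct)
  case (insert i I)
  have "(\<Prod>i\<in>insert i I. F i) - (\<Prod>i\<in>insert i I. G i) =
      F i * ((\<Prod>i\<in>I. F i) - (\<Prod>i\<in>I. G i)) + (\<Prod>i\<in>I. G i) * (F i - G i)"
    using insert.hyps by (simp add: algebra_simps)
  also have "\<dots> \<in> J M"
    using insert by (intro J_add J_mult_left X.prod_mem) auto
  finally show ?case .
qed (auto simp: J_zero)

lemma J_power_congruent:
  "a \<in> RX \<Longrightarrow> b \<in> RX \<Longrightarrow> a - b \<in> J M \<Longrightarrow> a ^ j - b ^ j \<in> J M"
  using J_prod_congruent[of "{..<j}" "\<lambda>_. a" "\<lambda>_. b" M] by simp

lemma J_trans: "a - b \<in> J M \<Longrightarrow> b - c \<in> J M \<Longrightarrow> a - c \<in> J M"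
  using J_add[of "a - b" M "b - c"] by simp

end

section \<open>Teichmueller lifts\<close>

locale residue_extension_degree = residue_extension R red p q g h
  for R :: "'K::field_char_0 set" and red :: "'K \<Rightarrow> 'k::{field,finite}" and p q :: nat
    and g :: "'k alg_closure" and h :: "'K poly" +
  fixes k M :: nat
  assumes k_pos: "k > 0" and g_mem: "g \<in> finite_subfield k" and g_nonzero: "g \<noteq> 0"
    and g_gen: "a \<in> finite_subfield k \<Longrightarrow> a \<noteq> 0 \<Longrightarrow> \<exists>i. a = g ^ i"
begin

abbreviation Q where "Q \<equiv> q ^ k"

lemma Q_gt_1: "Q > 1"
  unfolding q_eq by (rule one_less_power[OF card_finite_field_gt_1 k_pos])

lemma power_Q: "a \<in> finite_subfield k \<Longrightarrow> a ^ Q = (a :: 'k alg_closure)"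
  by (simp add: finite_subfield_def q_eq)

lemma power_Q_minus_1: "a \<in> finite_subfield k \<Longrightarrow> a \<noteq> 0 \<Longrightarrow> a ^ (Q - 1) = (1 :: 'k alg_closure)"
proof -
  assume a: "a \<in> finite_subfield k" "a \<noteq> 0"
  have "Suc (Q - 1) = Q" using Q_gt_1 by simp
  then have "a * a ^ (Q - 1) = a * 1" using power_Q[OF a(1)] by (metis mult_1_right power_Suc)
  then show ?thesis using a(2) by simp
qed

lemma exists_rep: "a \<in> finite_subfield k \<Longrightarrow> \<exists>r\<in>RX. redX g r = a"
proof (cases "a = 0")
  case True
  then show ?thesis by (intro bexI[of _ 0]) (auto simp: X.zero_mem X.hom_zero)
next
  case False
  assume "a \<in> finite_subfield k"
  then obtain i where "a = g ^ i" using g_gen False by blast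
  then show ?thesis
    by (intro bexI[of _ "[:0, 1:] ^ i"]) (auto simp: X.power_mem X_mem_RX X.hom_power redX_X)
qed

text \<open>\<open>Q ^ M\<close> is a power of \<open>p\<close> with exponent at least \<open>M\<close>.\<close>

lemma power_Q_power_congruent:
  assumes "a \<in> RX" "b \<in> RX" "redX g a = redX g b"
  shows "a ^ (Q ^ M) - b ^ (Q ^ M) \<in> J M"
proof -
  obtain r where r: "r > 0" "q = p ^ r" using card_finite_field_power unfolding p_eq q_eq by blast
  have "Q ^ M = p ^ (r * k * M)" by (simp add: r(2) flip: power_mult)
  moreover have "a - b \<in> J 1" using assms redX_eq_iff by blast
  ultimately have "a ^ (Q ^ M) - b ^ (Q ^ M) \<in> J (1 + r * k * M)"
    using power_p_power_congruent[OF assms(1,2) _ order_refl] by metis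
  moreover have "1 * 1 * M \<le> r * k * M" using r(1) k_pos by (intro mult_le_mono) auto
  then have "M \<le> 1 + r * k * M" by linarith
  ultimately show ?thesis by (rule J_mono[rotated])
qed

definition rep :: "'k alg_closure \<Rightarrow> 'K poly" where
  "rep a = (SOME r. r \<in> RX \<and> redX g r = a)"

lemma rep: "a \<in> finite_subfield k \<Longrightarrow> rep a \<in> RX \<and> redX g (rep a) = a"
  unfolding rep_def by (rule someI_ex) (use exists_rep in blast)

text \<open>The power with exponent \<open>Q ^ M\<close> depends modulo \<open>J M\<close> only on \<open>a\<close>, not on the chosen representative.
  This makes \<open>teich\<close> multiplicative modulo \<open>J M\<close>, and since \<open>Q ^ M\<close> is a power of \<open>Q\<close> it still reduces
  to \<open>a\<close>.\<close>

definition teich :: "'k alg_closure \<Rightarrow> 'K poly" where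
  "teich a = rep a ^ (Q ^ M)"

lemma teich:
  assumes "a \<in> finite_subfield k"
  shows teich_mem: "teich a \<in> RX" and redX_teich: "redX g (teich a) = a"
proof -
  have a: "a ^ (Q ^ j) = a" for j
  proof (induction j)
    case (Suc j)
    have "a ^ (Q ^ Suc j) = (a ^ Q) ^ (Q ^ j)" by (simp only: power_Suc power_mult)
    then show ?case using Suc by (simp only: power_Q[OF assms])
  qed simp
  show "teich a \<in> RX" using rep[OF assms] by (simp add: teich_def X.power_mem)
  show "redX g (teich a) = a"
    using rep[OF assms] by (simp only: teich_def X.hom_power a)
qed

lemma teich_mult:
  assumes "a \<in> finite_subfield k" "b \<in> finite_subfield k"
  shows "teich a * teich b - teich (a * b) \<in> J M"
proof -
  show ?thesis
    unfolding teich_def power_mult_distrib[symmetric]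
    using rep[OF assms(1)] rep[OF assms(2)] rep[OF finite_subfield_closed(4)[OF assms]]
    by (intro power_Q_power_congruent) (auto simp: X.mult_mem X.hom_mult)
qed

lemma power_mem_finite_subfield:
  "a \<in> (finite_subfield k :: 'k alg_closure set) \<Longrightarrow> a ^ j \<in> finite_subfield k"
  by (induction j) (auto simp: finite_subfield_closed)

lemma teich_one: "teich 1 - 1 \<in> J M"
  using power_Q_power_congruent[of "rep 1" 1] rep[OF finite_subfield_closed(2)]
  by (simp add: teich_def X.one_mem X.hom_one)

lemma teich_power:
  assumes a: "a \<in> finite_subfield k"
  shows "teich a ^ j - teich (a ^ j) \<in> J M"
proof (induction j)
  case 0 show ?case using J_uminus[OF teich_one] by simp
next
  case (Suc j)
  have "teich a * (teich a ^ j - teich (a ^ j)) \<in> J M"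
    using Suc teich_mem[OF a] by (intro J_mult_left)
  moreover have "teich a * teich (a ^ j) - teich (a * a ^ j) \<in> J M"
    using a by (intro teich_mult power_mem_finite_subfield)
  ultimately show ?case using J_add by (fastforce simp: algebra_simps)
qed

abbreviation units where "units \<equiv> finite_subfield k - {0 :: 'k alg_closure}"

lemma finite_units: "finite units"
  using card_finite_subfield(1)[OF k_pos] by simp

lemma card_units: "card units = Q - 1"
  using card_finite_subfield[OF k_pos, where 'k = 'k] finite_subfield_closed(1)[where 'k = 'k]
  by (simp add: card_Diff_singleton q_eq)

text \<open>If \<open>g\<close> had an order \<open>e\<close> below \<open>Q - 1\<close>, its powers could not exhaust the \<open>Q - 1\<close> units.\<close>

lemma generator_power_eq_1: "g ^ u = 1 \<Longrightarrow> Q - 1 dvd u"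
proof -
  assume u: "g ^ u = 1"
  define e where "e = u mod (Q - 1)"
  have "g ^ u = (g ^ (Q - 1)) ^ (u div (Q - 1)) * g ^ e"
    by (simp add: e_def flip: power_mult power_add)
  then have e1: "g ^ e = 1" using u power_Q_minus_1[OF g_mem g_nonzero] by simp
  have e_lt: "e < Q - 1" unfolding e_def using Q_gt_1 by (intro mod_less_divisor) simp
  show "Q - 1 dvd u"
  proof (cases "e = 0")
    case True then show ?thesis unfolding e_def by (simp only: dvd_eq_mod_eq_0)
  next
    case False
    have "units \<subseteq> (\<lambda>i. g ^ i) ` {..<e}"
    proof
      fix a assume "a \<in> units"
      then obtain i where "a = g ^ i" using g_gen[of a] by auto
      also have "\<dots> = (g ^ e) ^ (i div e) * g ^ (i mod e)" by (simp flip: power_mult power_add)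
      also have "\<dots> = g ^ (i mod e)" using e1 by simp
      finally show "a \<in> (\<lambda>i. g ^ i) ` {..<e}" using False by auto
    qed
    then have "Q - 1 \<le> e"
      using surj_card_le[of "{..<e}" units] by (simp add: card_units)
    then show ?thesis using e_lt by simp
  qed
qed

text \<open>Orthogonality. Multiplying the summation variable by \<open>g\<close> permutes the terms and multiplies the sum
  by the \<open>u\<close>-th power of the lift of \<open>g\<close>. If \<open>Q - 1\<close> does not divide \<open>u\<close>, this factor minus 1 is a
  unit, so the sum vanishes.\<close>

lemma sum_teich_power:
  "(\<Sum>a\<in>units. teich a ^ u) - (if Q - 1 dvd u then of_nat (Q - 1) else 0) \<in> J M"
proof (cases "Q - 1 dvd u")
  case True
  have "teich a ^ u - 1 \<in> J M" if a: "a \<in> units" for a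
  proof -
    obtain c where c: "u = (Q - 1) * c" using True by (rule dvdE)
    have "a ^ u = (a ^ (Q - 1)) ^ c" unfolding c by (rule power_mult)
    also have "a ^ (Q - 1) = 1" using a by (intro power_Q_minus_1) auto
    finally have "a ^ u = 1" by simp
    then have "teich a ^ u - teich 1 \<in> J M" using teich_power[of a u] a by auto
    then show ?thesis using teich_one by (rule J_trans)
  qed
  then have "(\<Sum>a\<in>units. teich a ^ u - 1) \<in> J M" by (rule J_sum)
  moreover have "(\<Sum>a\<in>units. teich a ^ u - 1) = (\<Sum>a\<in>units. teich a ^ u) - of_nat (Q - 1)"
    unfolding sum_subtractf sum_constant card_units by simp
  ultimately show ?thesis using True by (simp only: if_True)
next
  case False
  let ?S = "\<Sum>a\<in>units. teich a ^ u"
  have S: "?S \<in> RX" by (intro X.sum_mem X.power_mem teich_mem) auto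
  have gm: "a * g \<in> finite_subfield k" "a * inverse g \<in> finite_subfield k" if "a \<in> finite_subfield k" for a
    using that g_mem by (intro finite_subfield_closed; simp)+
  have perm: "(\<Sum>a\<in>units. teich (a * g) ^ u) = ?S"
    using gm g_nonzero
    by (intro sum.reindex_bij_witness[of _ "\<lambda>a. a * inverse g" "\<lambda>a. a * g"]) auto
  have "(\<Sum>a\<in>units. (teich a * teich g) ^ u - teich (a * g) ^ u) \<in> J M"
  proof (rule J_sum)
    fix a assume "a \<in> units"
    then show "(teich a * teich g) ^ u - teich (a * g) ^ u \<in> J M"
      using g_mem gm by (intro J_power_congruent teich_mult X.mult_mem teich_mem) auto
  qed
  moreover have "(\<Sum>a\<in>units. (teich a * teich g) ^ u - teich (a * g) ^ u) = ?S * teich g ^ u - ?S"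
    unfolding sum_subtractf perm by (simp only: power_mult_distrib sum_distrib_right)
  moreover have "?S * teich g ^ u - ?S = (teich g ^ u - 1) * ?S" by (simp only: left_diff_distrib mult.commute mult_1_left)
  ultimately have mem: "(teich g ^ u - 1) * ?S \<in> J M" by simp
  have "redX g (teich g ^ u - 1) = g ^ u - 1"
    using g_mem by (simp add: X.hom_diff X.power_mem X.one_mem X.hom_power X.hom_one teich_mem redX_teich)
  moreover have "g ^ u - 1 \<noteq> 0" using generator_power_eq_1[of u] False by auto
  moreover have "g ^ u - 1 \<in> finite_subfield k"
    using finite_subfield_closed(3)[OF power_mem_finite_subfield[OF g_mem, of u]
      finite_subfield_closed(5)[OF finite_subfield_closed(2)]] by simp
  ultimately have "redX g (teich g ^ u - 1) ^ (Q - 1) = 1"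
    by (intro power_Q_minus_1) auto
  moreover have "teich g ^ u - 1 \<in> RX" by (intro X.diff_mem X.power_mem X.one_mem teich_mem g_mem)
  ultimately have "?S \<in> J M"
    using Q_gt_1 by (intro J_cancel[OF _ S mem]) auto
  then show ?thesis using False by (simp only: if_False diff_zero)
qed

end

section \<open>Evaluation of polynomials in several variables\<close>

definition mon_eval :: "('n::finite \<Rightarrow> 'b::comm_ring_1) \<Rightarrow> 'n exponent \<Rightarrow> 'b" where
  "mon_eval y u = (\<Prod>i\<in>UNIV. y i ^ lookup u i)"

definition evalX :: "('n::finite, 'a::comm_ring_1) mpoly \<Rightarrow> ('n \<Rightarrow> 'a poly) \<Rightarrow> 'a poly" where
  "evalX f y = (\<Sum>u\<in>keys f. [:lookup f u:] * mon_eval y u)"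

lemma mon_eval_zero [simp]: "mon_eval y 0 = 1"
  by (simp add: mon_eval_def)

lemma mon_eval_add: "mon_eval y (u + w) = mon_eval y u * mon_eval y w"
  by (simp add: mon_eval_def lookup_add power_add prod.distrib)

lemma mon_eval_exp_scale: "mon_eval y (exp_scale k u) = mon_eval (\<lambda>i. y i ^ k) u"
  by (simp add: mon_eval_def power_mult)

lemma evalX_superset:
  "finite S \<Longrightarrow> keys f \<subseteq> S \<Longrightarrow> evalX f y = (\<Sum>u\<in>S. [:lookup f u:] * mon_eval y u)"
  unfolding evalX_def by (rule sum.mono_neutral_left) (auto simp: in_keys_iff)

lemma evalX_add: "evalX (f + g) y = evalX f y + evalX g y"
proof -
  let ?S = "keys f \<union> keys g"
  have "evalX (f + g) y = (\<Sum>u\<in>?S. [:lookup (f + g) u:] * mon_eval y u)"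
    using keys_add[of f g] by (intro evalX_superset) auto
  also have "\<dots> = (\<Sum>u\<in>?S. [:lookup f u:] * mon_eval y u + [:lookup g u:] * mon_eval y u)"
    by (intro sum.cong refl) (simp add: lookup_add smult_add_left)
  also have "\<dots> = evalX f y + evalX g y"
    by (simp add: sum.distrib evalX_superset[of ?S f] evalX_superset[of ?S g])
  finally show ?thesis .
qed

lemma evalX_zero [simp]: "evalX 0 y = 0"
  by (simp add: evalX_def)

lemma evalX_sum: "evalX (\<Sum>i\<in>I. F i) y = (\<Sum>i\<in>I. evalX (F i) y)"
  by (induction I rule: infinite_finite_induct) (auto simp: evalX_add)

lemma evalX_single: "evalX (single u c) y = [:c:] * mon_eval y u"
  by (simp add: evalX_superset[of "{u}"])

lemma evalX_one [simp]: "evalX 1 y = 1"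
  using evalX_single[of 0 1 y] by (simp add: one_pCons)

lemma evalX_mult:
  fixes f g :: "('n::finite, 'a::comm_ring_1) mpoly"
  shows "evalX (f * g) y = evalX f y * evalX g y"
proof -
  have "f * g = (\<Sum>u\<in>keys f. single u (lookup f u)) *
      (\<Sum>w\<in>keys g. single w (lookup g w))"
    by (simp flip: mpoly_eq_sum_single)
  also have "\<dots> = (\<Sum>u\<in>keys f. \<Sum>w\<in>keys g.
      single (u + w) (lookup f u * lookup g w))"
    by (simp add: sum_product mult_single)
  finally have eq: "f * g = \<dots>" .
  have "[:a * b:] * (s * t) = ([:a:] * s) * ([:b:] * t)" for a b :: 'a and s t
    by (simp add: mult.commute)
  then show ?thesis
    unfolding eq evalX_sum evalX_single mon_eval_add
    by (simp only: evalX_def sum_product)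
qed

lemma evalX_power: "evalX (f ^ j) y = evalX f y ^ j"
  by (induction j) (auto simp: evalX_mult)

lemma evalX_exp_subst: "evalX (exp_subst k f) y = evalX f (\<lambda>i. y i ^ k)"
  unfolding exp_subst_def evalX_sum evalX_single mon_eval_exp_scale by (simp only: evalX_def)

lemma evalX_frob_product:
  "evalX (frob_product q f k) y = (\<Prod>i<k. evalX f (\<lambda>j. y j ^ (q ^ i)))"
  by (induction k) (auto simp: evalX_mult evalX_exp_subst mult.commute)

section \<open>Sums over the orbits of a map of finite order\<close>

lemma funpow_frobenius: "((\<lambda>x j. x j ^ q) ^^ e) x = (\<lambda>j. x j ^ (q ^ e))"
  for x :: "'n \<Rightarrow> 'a::comm_monoid_mult"
  by (induction e) (auto simp: mult.commute simp flip: power_mult)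

lemma funpow_period_mult: "(\<phi> ^^ e) x = x \<Longrightarrow> (\<phi> ^^ (e * c)) x = x"
  by (induction c) (auto simp: funpow_add)

text \<open>An orbit of length \<open>e\<close> contributes \<open>e\<close> terms that are equal modulo \<open>I\<close>. Remove the orbits one
  after the other.\<close>

lemma sum_over_orbits:
  fixes F :: "'a \<Rightarrow> 'b::comm_ring_1"
  assumes I_zero: "0 \<in> I" and I_add: "\<And>a b. a \<in> I \<Longrightarrow> b \<in> I \<Longrightarrow> a + b \<in> I"
    and k: "k > 0"
  shows "finite S \<Longrightarrow> (\<And>x. x \<in> S \<Longrightarrow> \<phi> x \<in> S) \<Longrightarrow> (\<And>x. x \<in> S \<Longrightarrow> (\<phi> ^^ k) x = x) \<Longrightarrow>
    (\<And>x. x \<in> S \<Longrightarrow> F (\<phi> x) - F x \<in> I) \<Longrightarrow>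
    (\<And>x e. x \<in> S \<Longrightarrow> e > 0 \<Longrightarrow> e dvd k \<Longrightarrow> (\<phi> ^^ e) x = x \<Longrightarrow> of_nat e * F x \<in> I) \<Longrightarrow>
    (\<Sum>x\<in>S. F x) \<in> I"
proof (induction "card S" arbitrary: S rule: less_induct)
  case (less S)
  note cl = less.prems(2) and per = less.prems(3) and inv = less.prems(4) and ord = less.prems(5)
  show ?case
  proof (cases "S = {}")
    case True then show ?thesis using I_zero by simp
  next
    case False
    then obtain x where x: "x \<in> S" by blast
    have S_pow: "(\<phi> ^^ i) x \<in> S" for i by (induction i) (auto simp: x cl)
    \<comment> \<open>The length of the orbit \<open>B\<close> of \<open>x\<close>.\<close>
    define e where "e = (LEAST e. e > 0 \<and> (\<phi> ^^ e) x = x)"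
    have e: "e > 0 \<and> (\<phi> ^^ e) x = x"
      unfolding e_def by (rule LeastI[of _ k]) (use k per[OF x] in simp)
    have e_min: "e \<le> j" if "j > 0" "(\<phi> ^^ j) x = x" for j
      unfolding e_def by (rule Least_le) (use that in simp)
    have mod: "(\<phi> ^^ j) x = (\<phi> ^^ (j mod e)) x" for j
    proof -
      have "(\<phi> ^^ (j mod e + e * (j div e))) x = (\<phi> ^^ (j mod e)) x"
        unfolding funpow_add comp_def using funpow_period_mult[of e \<phi> x "j div e"] e by simp
      then show ?thesis by simp
    qed
    have e_dvd: "e dvd k"
    proof (rule ccontr)
      assume "\<not> e dvd k"
      then have "k mod e > 0" by (simp add: dvd_eq_mod_eq_0)
      moreover have "(\<phi> ^^ (k mod e)) x = x" using mod[of k] per[OF x] by simp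
      moreover have "k mod e < e" using e by simp
      ultimately show False using e_min[of "k mod e"] by simp
    qed
    define B where "B = (\<lambda>i. (\<phi> ^^ i) x) ` {..<e}"
    have B_eq: "y \<in> B \<longleftrightarrow> (\<exists>i. y = (\<phi> ^^ i) x)" for y
    proof
      show "y \<in> B" if "\<exists>i. y = (\<phi> ^^ i) x"
      proof -
        obtain i where "y = (\<phi> ^^ i) x" using \<open>\<exists>i. y = (\<phi> ^^ i) x\<close> ..
        then have "y = (\<phi> ^^ (i mod e)) x" using mod[of i] by simp
        moreover have "i mod e < e" using e by simp
        ultimately show ?thesis unfolding B_def by blast
      qed
    qed (auto simp: B_def)
    have BS: "B \<subseteq> S" using S_pow by (auto simp: B_def)
    have fB: "finite B" by (simp add: B_def)
    have inj: "inj_on (\<lambda>i. (\<phi> ^^ i) x) {..<e}"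
    proof (rule linorder_inj_onI')
      fix i j assume ij: "i \<in> {..<e}" "j \<in> {..<e}" "i < j"
      show "(\<phi> ^^ i) x \<noteq> (\<phi> ^^ j) x"
      proof
        assume eq: "(\<phi> ^^ i) x = (\<phi> ^^ j) x"
        have "(\<phi> ^^ (e - j)) ((\<phi> ^^ i) x) = (\<phi> ^^ (e - j)) ((\<phi> ^^ j) x)" using eq by simp
        then have "(\<phi> ^^ (e - j + i)) x = (\<phi> ^^ (e - j + j)) x" by (simp only: funpow_add comp_def)
        then have "(\<phi> ^^ (e - j + i)) x = x" using ij e by simp
        then have "e \<le> e - j + i" using ij by (intro e_min) auto
        then show False using ij by auto
      qed
    qed
    have inv_pow: "F ((\<phi> ^^ i) x) - F x \<in> I" for i
    proof (induction i)
      case 0 show ?case using I_zero by simp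
    next
      case (Suc i)
      have "(F (\<phi> ((\<phi> ^^ i) x)) - F ((\<phi> ^^ i) x)) + (F ((\<phi> ^^ i) x) - F x) \<in> I"
        by (intro I_add inv S_pow Suc)
      then show ?case by simp
    qed
    have sumI: "(\<Sum>i<j. F ((\<phi> ^^ i) x) - F x) \<in> I" for j :: nat
      by (induction j) (auto intro: I_zero I_add inv_pow)
    have "(\<Sum>y\<in>B. F y) = (\<Sum>i<e. F ((\<phi> ^^ i) x) - F x) + of_nat e * F x"
      unfolding B_def by (simp add: sum.reindex[OF inj] sum_subtractf)
    then have "(\<Sum>y\<in>B. F y) \<in> I"
      using I_add[OF sumI ord[OF x _ e_dvd]] e by simp
    moreover have "(\<Sum>y\<in>S - B. F y) \<in> I"
    proof (rule less.hyps)
      have "x \<in> B" using B_eq by (metis funpow_0)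
      then have "S - B \<subset> S" using x by blast
      then show "card (S - B) < card S" using less.prems(1) by (rule psubset_card_mono[rotated])
      show "\<phi> y \<in> S - B" if y: "y \<in> S - B" for y
      proof
        show "\<phi> y \<in> S" using y cl by simp
        show "\<phi> y \<notin> B"
        proof
          assume "\<phi> y \<in> B"
          then obtain i where i: "\<phi> y = (\<phi> ^^ i) x" using B_eq by blast
          obtain k' where k': "k = Suc k'" using k by (cases k) auto
          have "y = (\<phi> ^^ k') (\<phi> y)" using per[of y] y by (simp add: k' funpow_swap1)
          also have "\<dots> = (\<phi> ^^ (k' + i)) x" by (simp add: i funpow_add)
          finally show False using y B_eq by blast
        qed
      qed
    qed (use less.prems(1) per inv ord in auto)
    ultimately have "(\<Sum>y\<in>S - B. F y) + (\<Sum>y\<in>B. F y) \<in> I" by (intro I_add)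
    then show ?thesis using sum.subset_diff[OF BS less.prems(1), of F] by simp
  qed
qed

section \<open>Summation over the Teichmueller points of the torus\<close>

context residue_extension
begin

lemma evalX_mem:
  assumes "\<And>u. lookup f u \<in> R" and "\<And>i. y i \<in> RX"
  shows "evalX f y \<in> RX"
  unfolding evalX_def mon_eval_def
  using assms by (intro X.sum_mem X.mult_mem X.prod_mem X.power_mem const_mem_RX)

lemma evalX_congruent:
  assumes f: "\<And>u. lookup f u \<in> R" and y: "\<And>i. y i \<in> RX" "\<And>i. z i \<in> RX"
    and yz: "\<And>i. y i - z i \<in> J M"
  shows "evalX f y - evalX f z \<in> J M"
proof -
  have "evalX f y - evalX f z =
      (\<Sum>u\<in>keys f. [:lookup f u:] * (mon_eval y u - mon_eval z u))"
    by (simp add: evalX_def sum_subtractf right_diff_distrib smult_diff_right)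
  also have "\<dots> \<in> J M"
    unfolding mon_eval_def
    by (intro J_sum J_mult_left const_mem_RX f J_prod_congruent X.power_mem y J_power_congruent yz)
  finally show ?thesis .
qed

lemma redX_evalX:
  assumes f: "\<And>u. lookup f u \<in> R" and y: "\<And>i. y i \<in> RX"
  shows "redX g (evalX f y) = eval_ac (Poly_Mapping.map red f) (\<lambda>i. redX g (y i))"
proof -
  have lk: "lookup (Poly_Mapping.map red f) u = red (lookup f u)" for u
    by (simp add: map.rep_eq when_def hom_zero)
  have "redX g (evalX f y) = (\<Sum>u\<in>keys f.
      to_ac (red (lookup f u)) * (\<Prod>i\<in>UNIV. redX g (y i) ^ lookup u i))"
    unfolding evalX_def mon_eval_def using f y
    by (subst X.hom_sum) (auto simp: X.hom_mult X.hom_prod X.hom_power redX_const const_mem_RX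
        X.power_mem X.prod_mem X.mult_mem simp del: mult_pCons_left)
  also have "\<dots> = eval_ac (Poly_Mapping.map red f) (\<lambda>i. redX g (y i))"
    unfolding eval_ac_def lk
    by (rule sum.mono_neutral_right) (auto simp: in_keys_iff lk hom_zero)
  finally show ?thesis .
qed

end

text \<open>The coefficients are fixed by \<open>a \<mapsto> a ^ q\<close>, and \<open>q\<close> is a power of the characteristic.\<close>

lemma eval_ac_frobenius:
  fixes f :: "('n::finite, 'k::{field,finite}) mpoly"
  shows "eval_ac f (\<lambda>i. x i ^ (CARD('k) ^ j)) = eval_ac f x ^ (CARD('k) ^ j)"
  unfolding eval_ac_def frobenius_sum
  by (intro sum.cong refl)
     (simp add: power_mult_distrib to_ac_power_card prod_power_distrib mult.commute flip: power_mult)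

context residue_extension_degree
begin

abbreviation torus_points :: "('n::finite \<Rightarrow> 'k alg_closure) set" where
  "torus_points \<equiv> torus_points_over k"

lemma sum_mon_eval_teich:
  "(\<Sum>x\<in>torus_points. mon_eval (\<lambda>i. teich (x i)) u) -
     (if \<forall>i. Q - 1 dvd lookup u i then of_nat ((Q - 1) ^ CARD('n)) else 0) \<in> J M"
  for u :: "('n::finite) exponent"
proof -
  let ?c = "\<lambda>i. if Q - 1 dvd lookup u i then of_nat (Q - 1) else 0 :: 'K poly"
  have "(\<Sum>x\<in>torus_points. mon_eval (\<lambda>i. teich (x i)) u) =
      (\<Prod>i\<in>UNIV. \<Sum>a\<in>units. teich a ^ lookup u i)"
    unfolding torus_points_over_PiE mon_eval_def
    by (rule prod_sum_PiE[symmetric]) (simp_all only: finite_units finite_class.finite_UNIV)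
  moreover have "(\<Prod>i\<in>UNIV. \<Sum>a\<in>units. teich a ^ lookup u i) - (\<Prod>i\<in>UNIV. ?c i) \<in> J M"
    by (rule J_prod_congruent[OF _ _ sum_teich_power])
       (auto intro!: X.sum_mem X.power_mem teich_mem X.of_nat_mem X.zero_mem simp del: of_nat_diff)
  moreover have "(\<Prod>i\<in>UNIV. ?c i) =
      (if \<forall>i. Q - 1 dvd lookup u i then of_nat ((Q - 1) ^ CARD('n)) else 0)"
  proof (cases "\<forall>i. Q - 1 dvd lookup u i")
    case True
    then show ?thesis by (simp only: if_True simp_thms prod_constant of_nat_power)
  next
    case False
    then obtain i where "\<not> Q - 1 dvd lookup u i" by blast
    then have "?c i = 0" by (simp only: if_False)
    then have "(\<Prod>i\<in>UNIV. ?c i) = 0" by (intro prod_zero) auto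
    then show ?thesis using False by (simp only: if_False)
  qed
  ultimately show ?thesis by (simp only:)
qed

text \<open>Only the exponents divisible by \<open>Q - 1\<close> survive the summation over the Teichmueller points.\<close>

lemma sum_evalX_teich:
  fixes G :: "('n::finite, 'K) mpoly"
  assumes G: "\<And>u. lookup G u \<in> R" and deg: "G \<in> polys_upto ((Q - 1) * D)"
  shows "(\<Sum>x\<in>torus_points. evalX G (\<lambda>i. teich (x i))) -
     [:of_nat ((Q - 1) ^ CARD('n)) * (\<Sum>u | mdeg u \<le> D. lookup G (exp_scale (Q - 1) u)):] \<in> J M"
proof -
  let ?N = "(Q - 1) ^ CARD('n)"
  let ?c = "\<lambda>u :: 'n exponent. if \<forall>i. Q - 1 dvd lookup u i then of_nat ?N else 0 :: 'K poly"
  have N: "Q - 1 > 0" using Q_gt_1 by simp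
  have "(\<Sum>x\<in>torus_points. evalX G (\<lambda>i. teich (x i))) = (\<Sum>u\<in>keys G.
      [:lookup G u:] * (\<Sum>x\<in>torus_points. mon_eval (\<lambda>i. teich (x i)) u))"
    unfolding evalX_def sum_distrib_left by (rule sum.swap)
  moreover have "(\<Sum>u\<in>keys G. [:lookup G u:] *
      ((\<Sum>x\<in>torus_points. mon_eval (\<lambda>i. teich (x i)) u) - ?c u)) \<in> J M"
    by (intro J_sum J_mult_left const_mem_RX G sum_mon_eval_teich)
  moreover have "(\<Sum>u\<in>keys G. [:lookup G u:] * ?c u) =
      [:of_nat ?N * (\<Sum>u | mdeg u \<le> D. lookup G (exp_scale (Q - 1) u)):]"
  proof -
    have "(\<Sum>u\<in>keys G. [:lookup G u:] * ?c u) =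
        (\<Sum>u\<in>exp_scale (Q - 1) ` {u. mdeg u \<le> D}. [:of_nat ?N * lookup G u:])"
    proof (rule sum.mono_neutral_cong)
      fix u assume u: "u \<in> keys G - exp_scale (Q - 1) ` {u. mdeg u \<le> D}"
      have "\<not> (\<forall>i. Q - 1 dvd lookup u i)"
      proof
        assume "\<forall>i. Q - 1 dvd lookup u i"
        then obtain w where w: "u = exp_scale (Q - 1) w" using exp_scale_image[OF N] by blast
        have "mdeg u \<le> (Q - 1) * D" using u deg by (auto simp: polys_upto_def total_degree_le_iff)
        then have "mdeg w \<le> D" using N by (simp add: w mdeg_exp_scale)
        then show False using u w by blast
      qed
      then show "[:lookup G u:] * ?c u = 0" by (simp only: if_False) simp
    next
      fix u assume "u \<in> exp_scale (Q - 1) ` {u. mdeg u \<le> D} - keys G"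
      then show "[:of_nat ?N * lookup G u:] = 0" by (simp add: in_keys_iff)
    next
      fix u assume "u \<in> keys G \<inter> exp_scale (Q - 1) ` {u. mdeg u \<le> D}"
      then have "\<forall>i. Q - 1 dvd lookup u i" by (auto simp del: One_nat_def)
      then have "?c u = of_nat ?N" by (simp only: simp_thms if_True)
      then show "[:lookup G u:] * ?c u = [:of_nat ?N * lookup G u:]"
        by (simp only:) (simp add: of_nat_poly mult.commute del: of_nat_power)
    qed (auto simp: finite_mdeg_le)
    also have "\<dots> = (\<Sum>u | mdeg u \<le> D. [:of_nat ?N * lookup G (exp_scale (Q - 1) u):])"
      using exp_scale_inj[OF N] by (subst sum.reindex) (auto simp: inj_on_def)
    also have "\<dots> = [:of_nat ?N * (\<Sum>u | mdeg u \<le> D. lookup G (exp_scale (Q - 1) u)):]"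
    proof -
      have "(\<Sum>u\<in>U. [:of_nat ?N * b u:]) = [:of_nat ?N * (\<Sum>u\<in>U. b u):]" for b :: "'n exponent \<Rightarrow> 'K" and U
        by (induction U rule: infinite_finite_induct) (auto simp: distrib_left)
      then show ?thesis .
    qed
    finally show ?thesis .
  qed
  ultimately show ?thesis by (simp only: right_diff_distrib sum_subtractf)
qed

end

section \<open>The contribution of a Frobenius orbit\<close>

lemma power_telescope: "(q - 1) * (\<Sum>i<e. q ^ i) = (q::nat) ^ e - 1" if "q > 0"
proof (induction e)
  case (Suc e)
  have "(q - 1) * (\<Sum>i<Suc e. q ^ i) = (q ^ e - 1) + (q - 1) * q ^ e"
    using Suc by (simp add: distrib_left)
  also have "\<dots> = q ^ Suc e - 1"
    using that by (cases q) (simp_all add: algebra_simps)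
  finally show ?case .
qed simp

context residue_extension
begin

lemma J_prod_periodic:
  assumes B: "\<And>i. B i \<in> RX" and per: "\<And>i. B (i + e) - B i \<in> J M"
  shows "(\<Prod>i<e * c. B i) - (\<Prod>i<e. B i) ^ c \<in> J M"
proof (induction c)
  case (Suc c)
  have shift: "B (i + e * c) - B i \<in> J M" for i c
  proof (induction c)
    case (Suc c)
    have "B (i + e * c + e) - B (i + e * c) \<in> J M" by (rule per)
    then show ?case using J_trans[OF _ Suc] by (simp add: algebra_simps)
  qed (simp add: J_zero)
  have "(\<Prod>i<a + b. B i) = (\<Prod>i<a. B i) * (\<Prod>i<b. B (i + a))" for a b
    by (induction b) (simp_all add: ac_simps)
  from this[of "e * c" e] have split: "(\<Prod>i<e * Suc c. B i) = (\<Prod>i<e * c. B i) * (\<Prod>i<e. B (i + e * c))"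
    by (simp add: add.commute)
  have "(\<Prod>i<e * c. B i) * ((\<Prod>i<e. B (i + e * c)) - (\<Prod>i<e. B i)) \<in> J M"
    by (intro J_mult_left X.prod_mem J_prod_congruent B shift)
  moreover have "(\<Prod>i<e. B i) * ((\<Prod>i<e * c. B i) - (\<Prod>i<e. B i) ^ c) \<in> J M"
    by (intro J_mult_left X.prod_mem B Suc)
  ultimately show ?case
    unfolding split using J_add by (fastforce simp: algebra_simps)
qed (simp add: J_zero)

lemma of_nat_mult_mem_J: "a \<in> J i \<Longrightarrow> e > 0 \<Longrightarrow> of_nat e * a \<in> J (i + multiplicity p e)"
  using J_mult[OF of_nat_mem_J[OF multiplicity_dvd, of e]] by (simp add: add.commute)

end

context residue_extension_degree
begin

text \<open>The values of \<open>f\<close> at the Frobenius conjugates of a Teichmueller point.\<close>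

definition conj_value :: "('n::finite, 'K) mpoly \<Rightarrow> ('n \<Rightarrow> 'k alg_closure) \<Rightarrow> nat \<Rightarrow> 'K poly" where
  "conj_value f x i = evalX f (\<lambda>j. teich (x j) ^ (q ^ i))"

context
  fixes f :: "('n::finite, 'K) mpoly" and fb :: "('n, 'k) mpoly"
  assumes f: "\<And>u. lookup f u \<in> R" and fb: "Poly_Mapping.map red f = fb"
begin

lemma conj_value_mem: "x \<in> torus_points \<Longrightarrow> conj_value f x i \<in> RX"
  unfolding conj_value_def by (intro evalX_mem f X.power_mem teich_mem) (auto simp: torus_points_over_def)

lemma redX_conj_value: "x \<in> torus_points \<Longrightarrow> redX g (conj_value f x i) = eval_ac fb x ^ (q ^ i)"
proof -
  assume x: "x \<in> torus_points"
  then have mem: "x j \<in> finite_subfield k" for j by (auto simp: torus_points_over_def)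
  have "redX g (conj_value f x i) = eval_ac fb (\<lambda>j. redX g (teich (x j) ^ (q ^ i)))"
    unfolding conj_value_def fb[symmetric] by (intro redX_evalX f X.power_mem teich_mem mem)
  also have "(\<lambda>j. redX g (teich (x j) ^ (q ^ i))) = (\<lambda>j. x j ^ (q ^ i))"
    using mem by (simp add: X.hom_power teich_mem redX_teich)
  finally show ?thesis by (simp only: q_eq eval_ac_frobenius)
qed

lemma frobenius_torus_points: "x \<in> torus_points \<Longrightarrow> (\<lambda>j. x j ^ i) \<in> torus_points"
  by (auto simp: torus_points_over_def power_mem_finite_subfield)

lemma conj_value_frobenius:
  assumes x: "x \<in> torus_points"
  shows "conj_value f (\<lambda>j. x j ^ (q ^ e)) i - conj_value f x (i + e) \<in> J M"
proof -
  have mem: "x j \<in> finite_subfield k" for j using x by (auto simp: torus_points_over_def)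
  have "teich (x j ^ (q ^ e)) ^ (q ^ i) - teich (x j) ^ (q ^ (i + e)) \<in> J M" for j
  proof -
    have "teich (x j) ^ (q ^ e) - teich (x j ^ (q ^ e)) \<in> J M" by (rule teich_power[OF mem])
    then have "teich (x j ^ (q ^ e)) - teich (x j) ^ (q ^ e) \<in> J M" using J_uminus by fastforce
    then have "teich (x j ^ (q ^ e)) ^ (q ^ i) - (teich (x j) ^ (q ^ e)) ^ (q ^ i) \<in> J M"
      by (intro J_power_congruent teich_mem X.power_mem mem power_mem_finite_subfield)
    then show ?thesis by (simp add: power_add mult.commute flip: power_mult)
  qed
  then show ?thesis
    unfolding conj_value_def
    by (intro evalX_congruent f X.power_mem teich_mem mem power_mem_finite_subfield)
qed

lemma conj_value_period:
  assumes x: "x \<in> torus_points" and e: "(\<lambda>j. x j ^ (q ^ e)) = x"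
  shows "conj_value f x (i + e) - conj_value f x i \<in> J M"
  using J_uminus[OF conj_value_frobenius[OF x, of e i]] by (simp add: e)

text \<open>On an orbit of length \<open>e\<close> the product \<open>P\<close> of the values \<open>f ^ (q - 1)\<close> reduces to
  \<open>b ^ (q ^ e - 1)\<close>, where \<open>b\<close> is the value of the reduction of \<open>f\<close>, hence to 0 or 1. Raising to the
  power \<open>p ^ (m - 1)\<close> turns this congruence modulo \<open>p\<close> into one modulo \<open>p ^ m\<close>; the exponent
  \<open>k div e\<close> and the length \<open>e\<close> supply the remaining factors \<open>p\<close> of \<open>k\<close>.\<close>

lemma orbit_contribution:
  assumes x: "x \<in> torus_points" and e: "e > 0" "e dvd k" "(\<lambda>j. x j ^ (q ^ e)) = x"
    and m: "m \<ge> 1" and M: "M = m + multiplicity p k"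
  shows "of_nat e * ((\<Prod>i<k. conj_value f x i ^ ((q - 1) * p ^ (m - 1))) -
      (if eval_ac fb x = 0 then 0 else 1)) \<in> J M"
proof -
  let ?b = "eval_ac fb x"
  define eps where "eps = (if ?b = 0 then 0 else 1 :: 'K poly)"
  have eps: "eps \<in> RX" by (simp add: eps_def X.zero_mem X.one_mem)
  define P where "P = (\<Prod>i<e. conj_value f x i ^ (q - 1))"
  have P: "P \<in> RX" unfolding P_def by (intro X.prod_mem X.power_mem conj_value_mem x)
  have q2: "q > 1" unfolding q_eq by (rule card_finite_field_gt_1)
  \<comment> \<open>In the residue field \<open>P\<close> becomes \<open>b ^ (q ^ e - 1)\<close>, and \<open>b\<close> lies in the field with \<open>q ^ e\<close> elements.\<close>
  have "redX g P = (\<Prod>i<e. (?b ^ (q ^ i)) ^ (q - 1))"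
    unfolding P_def using x
    by (subst X.hom_prod) (auto simp: X.power_mem conj_value_mem X.hom_power redX_conj_value)
  also have "\<dots> = ?b ^ (\<Sum>i<e. q ^ i * (q - 1))" by (simp add: power_sum power_mult)
  also have "(\<Sum>i<e. q ^ i * (q - 1)) = q ^ e - 1"
    using power_telescope[of q e] q2 by (simp add: sum_distrib_left mult.commute)
  also have "?b ^ (q ^ e - 1) = redX g eps"
  proof (cases "?b = 0")
    case True
    have "q ^ e - 1 > 0" using one_less_power[OF q2 e(1)] by simp
    then show ?thesis using True by (simp add: eps_def X.hom_zero)
  next
    case False
    have "?b ^ (q ^ e) = ?b"
      using eval_ac_frobenius[of fb x e] e(3) by (simp add: q_eq)
    moreover have "q ^ e = Suc (q ^ e - 1)" using q2 by simp
    ultimately have "?b * ?b ^ (q ^ e - 1) = ?b * 1" by (metis mult_1_right power_Suc)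
    then show ?thesis using False by (simp add: eps_def X.hom_one)
  qed
  finally have P1: "P - eps \<in> J 1" using redX_eq_iff[OF P eps] by simp
  \<comment> \<open>The full product runs \<open>c\<close> times through the orbit.\<close>
  obtain c where c: "k = e * c" using e(2) by (rule dvdE)
  have c0: "c > 0" using c k_pos by (cases c) auto
  obtain b where b: "c = p ^ multiplicity p c * b" using nat_prime_decomp[OF prime_p c0] by blast
  have "(\<Prod>i<e * c. conj_value f x i ^ (q - 1)) - P ^ c \<in> J M"
    unfolding P_def
    by (intro J_prod_periodic X.power_mem conj_value_mem x J_power_congruent conj_value_period e(3))
  then have "(\<Prod>i<k. conj_value f x i ^ (q - 1)) - P ^ c \<in> J M" by (simp only: c[symmetric])
  then have 1: "(\<Prod>i<k. conj_value f x i ^ (q - 1)) ^ (p ^ (m - 1)) - (P ^ c) ^ (p ^ (m - 1)) \<in> J M"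
    by (intro J_power_congruent X.prod_mem X.power_mem conj_value_mem x P)
  let ?l = "m - 1 + multiplicity p c"
  have "P ^ (p ^ ?l) - eps ^ (p ^ ?l) \<in> J (1 + ?l)"
    by (intro power_p_power_congruent P eps P1) simp
  then have "(P ^ (p ^ ?l)) ^ b - (eps ^ (p ^ ?l)) ^ b \<in> J (1 + ?l)"
    by (rule J_power_congruent[OF X.power_mem[OF P] X.power_mem[OF eps]])
  moreover have "(P ^ (p ^ ?l)) ^ b = (P ^ c) ^ (p ^ (m - 1))"
  proof -
    have "p ^ ?l * b = c * p ^ (m - 1)" by (subst b) (simp add: power_add)
    then show ?thesis by (simp only: flip: power_mult)
  qed
  moreover have "(eps ^ (p ^ ?l)) ^ b = eps"
  proof -
    have "b > 0" using b c0 by (cases b) auto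
    then show ?thesis using prime_gt_0_nat[OF prime_p] by (simp add: eps_def)
  qed
  moreover have "1 + ?l = m + multiplicity p c" using m by simp
  ultimately have 2: "(P ^ c) ^ (p ^ (m - 1)) - eps \<in> J (m + multiplicity p c)" by simp
  have mk: "multiplicity p k = multiplicity p e + multiplicity p c"
    unfolding c using prime_p e(1) c0 by (intro prime_elem_multiplicity_mult_distrib) auto
  have "(\<Prod>i<k. conj_value f x i ^ (q - 1)) ^ (p ^ (m - 1)) - eps \<in> J (m + multiplicity p c)"
    by (rule J_trans[OF J_mono[OF _ 1] 2]) (simp add: M mk)
  from of_nat_mult_mem_J[OF this e(1)] show ?thesis
    by (simp add: M mk eps_def prod_power_distrib power_mult add_ac)
qed

text \<open>The terms are invariant under Frobenius modulo \<open>J M\<close>, because applying Frobenius to the point permutes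
  the factors cyclically.\<close>

lemma sum_conj_values:
  assumes m: "m \<ge> 1" and M: "M = m + multiplicity p k"
  shows "(\<Sum>x\<in>torus_points. (\<Prod>i<k. conj_value f x i ^ ((q - 1) * p ^ (m - 1))) -
      (if eval_ac fb x = 0 then 0 else 1)) \<in> J M"
proof (rule sum_over_orbits[where \<phi> = "\<lambda>x j. x j ^ q", OF J_zero J_add k_pos finite_torus_points_over[OF k_pos]])
  let ?E = "(q - 1) * p ^ (m - 1)"
  have Qth: "(\<lambda>j. x j ^ Q) = x" if "x \<in> torus_points" for x :: "'n \<Rightarrow> 'k alg_closure"
    using that power_Q by (auto simp: torus_points_over_def)
  fix x :: "'n \<Rightarrow> 'k alg_closure" assume x: "x \<in> torus_points"
  show "(\<lambda>j. x j ^ q) \<in> torus_points" by (rule frobenius_torus_points[OF x])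
  show "((\<lambda>x j. x j ^ q) ^^ k) x = x" unfolding funpow_frobenius by (rule Qth[OF x])
  have eps: "eval_ac fb (\<lambda>j. x j ^ q) = 0 \<longleftrightarrow> eval_ac fb x = 0"
    using eval_ac_frobenius[of fb x 1] card_finite_field_gt_1[where 'k = 'k] by (simp add: q_eq)
  obtain k' where k': "k = Suc k'" using k_pos by (cases k) auto
  let ?c = "\<lambda>i. conj_value f x i ^ ?E"
  have c: "?c i \<in> RX" for i by (intro X.power_mem conj_value_mem x)
  have "conj_value f (\<lambda>j. x j ^ q) i - conj_value f x (Suc i) \<in> J M" for i
    using conj_value_frobenius[OF x, of 1 i] by simp
  then have "(\<Prod>i<k. conj_value f (\<lambda>j. x j ^ q) i ^ ?E) - (\<Prod>i<k. ?c (Suc i)) \<in> J M"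
    by (intro J_prod_congruent J_power_congruent X.power_mem conj_value_mem frobenius_torus_points x)
  moreover have "(\<Prod>i<k. ?c (Suc i)) - (\<Prod>i<k. ?c i) \<in> J M"
  proof -
    have "(\<Prod>i<k. ?c (Suc i)) - (\<Prod>i<k. ?c i) = (\<Prod>i<k'. ?c (Suc i)) * (?c k - ?c 0)"
      unfolding k' by (subst (2) prod.lessThan_Suc_shift) (simp add: algebra_simps)
    moreover have "?c (0 + k) - ?c 0 \<in> J M"
      by (intro J_power_congruent conj_value_mem x conj_value_period Qth)
    ultimately show ?thesis using c by (simp add: J_mult_left X.prod_mem)
  qed
  ultimately have "(\<Prod>i<k. conj_value f (\<lambda>j. x j ^ q) i ^ ?E) - (\<Prod>i<k. ?c i) \<in> J M"
    by (rule J_trans)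
  then show "(\<Prod>i<k. conj_value f (\<lambda>j. x j ^ q) i ^ ?E) - (if eval_ac fb (\<lambda>j. x j ^ q) = 0 then 0 else 1) -
      ((\<Prod>i<k. ?c i) - (if eval_ac fb x = 0 then 0 else 1)) \<in> J M"
    by (simp add: eps)
  fix e assume "e > 0" "e dvd k" "((\<lambda>x j. x j ^ q) ^^ e) x = x"
  then show "of_nat e * ((\<Prod>i<k. ?c i) - (if eval_ac fb x = 0 then 0 else 1)) \<in> J M"
    unfolding funpow_frobenius by (intro orbit_contribution x m M)
qed

text \<open>Both numbers are congruent modulo \<open>J M\<close> to the sum of the values of \<open>frob_product\<close> at the Teichmueller
  points. As they lie in \<open>R\<close>, they are congruent modulo \<open>p ^ M\<close>.\<close>

lemma frob_product_trace_congruence: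
  assumes m: "m \<ge> 1" and M: "M = m + multiplicity p k" and deg: "f \<in> polys_upto d"
  shows "of_nat ((Q - 1) ^ CARD('n)) *
      mat_trace (psi_mat (d * p ^ (m - 1)) q (f ^ ((q - 1) * p ^ (m - 1))) ^\<^sub>m k) -
    of_nat (card {x \<in> torus_points. eval_ac fb x \<noteq> 0}) \<in> pideal (m + multiplicity p k)"
proof -
  let ?E = "(q - 1) * p ^ (m - 1)" and ?D = "d * p ^ (m - 1)"
  define F where "F = f ^ ?E"
  define G where "G = frob_product q F k"
  have q0: "q > 0" unfolding q_eq by simp
  have "coeff_lift F (Poly_Mapping.map red f ^ ?E)"
    unfolding F_def using f by (intro coeff_lift_power) (simp add: coeff_lift_def map.rep_eq when_def hom_zero)
  then have F: "lookup F u \<in> R" for u by (simp add: coeff_lift_def)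
  have subst_R: "lookup (exp_subst j F) u \<in> R" for j u
    unfolding exp_subst_def lookup_sum lookup_single when_def
    by (intro sum_mem) (simp add: F zero_mem)
  have G: "lookup G u \<in> R" for u
  proof -
    have "\<exists>b. coeff_lift (frob_product q F j) b" for j
    proof (induction j)
      case 0
      show ?case by (auto intro: coeff_lift_one)
    next
      case (Suc j)
      have "coeff_lift (exp_subst (q ^ j) F) (Poly_Mapping.map red (exp_subst (q ^ j) F))"
        using subst_R by (simp add: coeff_lift_def map.rep_eq when_def hom_zero)
      with Suc show ?case unfolding frob_product.simps by (blast intro: coeff_lift_mult)
    qed
    then show ?thesis unfolding G_def coeff_lift_def by blast
  qed
  have "F \<in> polys_upto (?E * d)" unfolding F_def by (rule power_mem_polys_upto[OF deg])
  then have Fdeg: "F \<in> polys_upto ((q - 1) * ?D)" by (simp add: mult_ac)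
  have Gdeg: "G \<in> polys_upto ((Q - 1) * ?D)"
    unfolding G_def by (rule frob_product_mem_polys_upto[OF q0 Fdeg])
  have tr: "mat_trace (psi_mat ?D q F ^\<^sub>m k) =
      (\<Sum>u | mdeg u \<le> ?D. lookup G (exp_scale (Q - 1) u))"
    unfolding G_def by (rule mat_trace_psi_mat_power[OF q0 Fdeg])
  have ev: "evalX G (\<lambda>i. teich (x i)) = (\<Prod>i<k. conj_value f x i ^ ?E)" for x
    unfolding G_def evalX_frob_product F_def evalX_power conj_value_def ..
  have count: "(\<Sum>x\<in>torus_points. if eval_ac fb x = 0 then 0 else 1 :: 'K poly) =
      [:of_nat (card {x \<in> torus_points. eval_ac fb x \<noteq> 0}):]"
  proof -
    have "(\<Sum>x\<in>torus_points. if eval_ac fb x = 0 then 0 else 1 :: 'K poly) =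
        (\<Sum>x\<in>{x \<in> torus_points. eval_ac fb x \<noteq> 0}. 1)"
      by (intro sum.mono_neutral_cong_right finite_torus_points_over[OF k_pos]) auto
    also have "\<dots> = of_nat (card {x \<in> torus_points. eval_ac fb x \<noteq> 0})" by (simp only: sum_constant mult_1_right)
    finally show ?thesis by (simp only: of_nat_poly)
  qed
  let ?S = "\<Sum>x\<in>torus_points. evalX G (\<lambda>i. teich (x i))"
  have a: "?S - [:of_nat ((Q - 1) ^ CARD('n)) * mat_trace (psi_mat ?D q F ^\<^sub>m k):] \<in> J M"
    unfolding tr by (rule sum_evalX_teich[OF G Gdeg])
  have b: "?S - [:of_nat (card {x \<in> torus_points. eval_ac fb x \<noteq> 0}):] \<in> J M"
    using sum_conj_values[OF m M] unfolding sum_subtractf count ev .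
  have diff: "(s - b) - (s - a) = a - b" for a b s :: "'K poly" by simp
  have "[:of_nat ((Q - 1) ^ CARD('n)) * mat_trace (psi_mat ?D q F ^\<^sub>m k):] -
      [:of_nat (card {x \<in> torus_points. eval_ac fb x \<noteq> 0}):] \<in> J M"
    using J_diff[OF b a] unfolding diff .
  then have "[:of_nat ((Q - 1) ^ CARD('n)) * mat_trace (psi_mat ?D q F ^\<^sub>m k) -
      of_nat (card {x \<in> torus_points. eval_ac fb x \<noteq> 0}):] \<in> J M"
    by (simp only: diff_pCons diff_0 minus_zero)
  then show ?thesis using const_mem_J by (simp only: F_def M)
qed

end

end

section \<open>Integrality of the zeta functions\<close>

text \<open>By uniqueness, the solutions for the series that agree with \<open>A\<close> up to order \<open>K\<close> agree with each other up to
  this order, so they have a common limit.\<close>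

lemma has_log_deriv_limit:
  fixes A :: "'a::{idom,ring_char_0} fps"
  assumes ex: "\<And>K. \<exists>D B. has_log_deriv D B \<and> (\<forall>i\<le>K. fps_nth B i = fps_nth A i)"
  shows "\<exists>W. has_log_deriv W A"
proof -
  obtain D B where D: "has_log_deriv (D K) (B K)" and B: "i \<le> K \<Longrightarrow> fps_nth (B K) i = fps_nth A i" for K i
    using ex by metis
  define W where "W = Abs_fps (\<lambda>k. fps_nth (D k) k)"
  have W: "fps_nth W i = fps_nth (D K) i" if "i \<le> K" for i K
  proof -
    have "fps_nth (D i) i = fps_nth (D K) i"
      by (rule has_log_deriv_unique_upto[OF D D _ order_refl]) (use that B in auto)
    then show ?thesis by (simp add: W_def)
  qed
  have "fps_X * fps_deriv W = A * W"
  proof (rule fps_ext)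
    fix K
    have "fps_nth (fps_X * fps_deriv W) K = fps_nth (fps_X * fps_deriv (D K)) K"
      by (simp add: fps_mult_fps_X_deriv_shift W)
    also have "\<dots> = fps_nth (B K * D K) K" using D[of K] by (simp add: has_log_deriv_def)
    also have "\<dots> = fps_nth (A * W) K"
      unfolding fps_mult_nth by (intro sum.cong refl) (simp add: B W[of "K - _" K])
    finally show "fps_nth (fps_X * fps_deriv W) K = fps_nth (A * W) K" .
  qed
  moreover have "fps_nth W 0 = 1" using D[of 0] W[of 0 0] by (simp add: has_log_deriv_def)
  ultimately show ?thesis unfolding has_log_deriv_def by blast
qed

text \<open>The trace of the \<open>k\<close>-th power of the matrix of \<open>\<phi>\<close> counts the fixed points of the \<open>k\<close>-th power of \<open>\<phi>\<close>. So
  the determinant of \<open>1 - A T\<close> for this matrix is a solution with integer coefficients.\<close>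

lemma has_log_deriv_permutation:
  assumes fin: "finite Y" and cl: "\<And>y. y \<in> Y \<Longrightarrow> \<phi> y \<in> Y"
  shows "\<exists>D. has_log_deriv D
    (Abs_fps (\<lambda>k. if k = 0 then 0 else - of_nat (card {y \<in> Y. (\<phi> ^^ k) y = y}) :: 'a::comm_ring_1))"
proof -
  obtain ys where ys: "set ys = Y" "distinct ys" using finite_distinct_list[OF fin] by blast
  define n where "n = length ys"
  define A :: "'a mat" where "A = mat n n (\<lambda>(i, j). if \<phi> (ys ! j) = ys ! i then 1 else 0)"
  have A: "A \<in> carrier_mat n n" by (simp add: A_def)
  have mem: "ys ! i \<in> Y" if "i < n" for i using that ys(1) nth_mem by (auto simp: n_def)
  have Ak: "(A ^\<^sub>m k) $$ (i, j) = (if (\<phi> ^^ k) (ys ! j) = ys ! i then 1 else 0)" if "i < n" "j < n" for i j k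
    using that(2)
  proof (induction k arbitrary: j)
    case 0
    then show ?case using that(1) A ys(2) by (auto simp: n_def nth_eq_iff_index_eq)
  next
    case (Suc k)
    obtain l where l: "l < n" "ys ! l = \<phi> (ys ! j)"
      using cl[OF mem[OF Suc.prems]] ys(1) by (metis in_set_conv_nth n_def)
    have l_iff: "\<phi> (ys ! j) = ys ! l' \<longleftrightarrow> l' = l" if "l' < n" for l'
      using that l ys(2) by (auto simp: n_def nth_eq_iff_index_eq simp flip: l(2))
    have "(A ^\<^sub>m Suc k) $$ (i, j) = (\<Sum>l'<n. (A ^\<^sub>m k) $$ (i, l') * A $$ (l', j))"
      using A that(1) Suc.prems mult_mat_index_sum[of "A ^\<^sub>m k" n n A n i j]
      by (simp del: index_mult_mat(1))
    also have "\<dots> = (\<Sum>l'<n. if l' = l then (A ^\<^sub>m k) $$ (i, l') else 0)"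
      using Suc.prems by (intro sum.cong refl) (simp add: A_def l_iff)
    also have "\<dots> = (A ^\<^sub>m k) $$ (i, l)" using l(1) by simp
    also have "\<dots> = (if (\<phi> ^^ k) (ys ! l) = ys ! i then 1 else 0)" by (rule Suc.IH[OF l(1)])
    finally show ?case by (simp add: l(2) funpow_swap1)
  qed
  have "mat_trace (A ^\<^sub>m k) = of_nat (card {y \<in> Y. (\<phi> ^^ k) y = y})" for k
  proof -
    have "mat_trace (A ^\<^sub>m k) = (\<Sum>i<n. if (\<phi> ^^ k) (ys ! i) = ys ! i then 1 else 0)"
      using A by (simp add: mat_trace_def Ak)
    also have "\<dots> = (\<Sum>y\<in>Y. if (\<phi> ^^ k) y = y then 1 else 0)"
      using ys by (intro sum.reindex_bij_betw bij_betw_nth) (auto simp: n_def)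
    also have "\<dots> = of_nat (card {y \<in> Y. (\<phi> ^^ k) y = y})"
      using fin by (simp add: sum.If_cases Int_def)
    finally show ?thesis .
  qed
  then show ?thesis using has_log_deriv_det[OF A] by (intro exI[of _ "det (fps_one_minus A)"]) (simp cong: if_cong)
qed

lemma subring_hom_of_int: "subring_hom UNIV (of_int :: int \<Rightarrow> 'a::comm_ring_1)"
  by unfold_locales auto

lemma (in subring_hom) has_log_deriv_hom:
  assumes F: "has_log_deriv F A" and mem: "F \<in> fps_over S" "A \<in> fps_over S"
  shows "has_log_deriv (fps_map h F) (fps_map h A)"
proof -
  interpret f: subring_hom "fps_over S" "fps_map h"
    by (rule subring_hom_fps) (rule subring_hom_axioms)
  have "fps_X * fps_deriv (fps_map h F) = fps_map h (fps_X * fps_deriv F)"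
    using mem by (intro fps_ext) (simp add: fps_mult_fps_X_deriv_shift hom_mult of_nat_mem hom_of_nat fps_over_def)
  also have "\<dots> = fps_map h A * fps_map h F"
    using F mem by (simp add: has_log_deriv_def f.hom_mult)
  finally show ?thesis using F by (simp add: has_log_deriv_def hom_one)
qed

lemma has_log_deriv_of_int:
  "has_log_deriv F A \<Longrightarrow> has_log_deriv (fps_map of_int F) (fps_map of_int A :: 'a::comm_ring_1 fps)"
  using subring_hom.has_log_deriv_hom[OF subring_hom_of_int] by (simp add: fps_over_def)

lemma torus_iff: "x \<in> torus \<longleftrightarrow> (\<forall>i. x i \<noteq> 0)"
  by (simp add: torus_def)

definition complement_points :: "('n::finite, 'k::{field,finite}) mpoly \<Rightarrow> nat \<Rightarrow> ('n \<Rightarrow> 'k alg_closure) set" where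
  "complement_points f k = {x \<in> torus_points_over k. eval_ac f x \<noteq> 0}"

lemma num_points_torus:
  "num_points (torus :: ('n::finite \<Rightarrow> 'k::{field,finite} alg_closure) set) k =
     card (torus_points_over k :: ('n \<Rightarrow> 'k alg_closure) set)"
  unfolding num_points_def by (rule arg_cong[where f = card]) (auto simp: torus_iff torus_points_over_def)

lemma num_points_hypersurface:
  fixes f :: "('n::finite, 'k::{field,finite}) mpoly"
  assumes "k > 0"
  shows "int (num_points (torus_hypersurface f) k) - int (num_points (torus :: ('n \<Rightarrow> 'k alg_closure) set) k) =
     - int (card (complement_points f k))"
proof -
  have fin: "finite (torus_points_over k :: ('n \<Rightarrow> 'k alg_closure) set)"
    by (rule finite_torus_points_over[OF assms])
  have "{x \<in> torus_hypersurface f. \<forall>i. x i \<in> finite_subfield k} = torus_points_over k - complement_points f k"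
    by (auto simp: torus_hypersurface_def torus_iff torus_points_over_def complement_points_def)
  moreover have "complement_points f k \<subseteq> torus_points_over k" by (auto simp: complement_points_def)
  ultimately have "num_points (torus_hypersurface f) k =
      card (torus_points_over k :: ('n \<Rightarrow> 'k alg_closure) set) - card (complement_points f k)"
    using fin by (simp add: num_points_def card_Diff_subset finite_subset)
  moreover have "card (complement_points f k) \<le> card (torus_points_over k :: ('n \<Rightarrow> 'k alg_closure) set)"
    using fin by (intro card_mono) (auto simp: complement_points_def)
  ultimately show ?thesis by (simp add: num_points_torus)
qed

text \<open>The torus is the disjoint union of the hypersurface and its complement. With this sign, the series is
  the logarithmic derivative of the zeta function of the hypersurface divided by that of the torus.\<close>

definition complement_series :: "('n::finite, 'k::{field,finite}) mpoly \<Rightarrow> int fps" where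
  "complement_series f = Abs_fps (\<lambda>k. if k = 0 then 0 else - int (card (complement_points f k)))"

text \<open>Up to order \<open>K\<close> the solution is the determinant attached to the permutation that Frobenius
  induces on the points outside the hypersurface over the field with \<open>q ^ K!\<close> elements; the fixed
  points of its \<open>k\<close>-th power are those over the field with \<open>q ^ k\<close> elements.\<close>

lemma exists_complement_log_deriv: "\<exists>W. has_log_deriv W (complement_series f)"
  for f :: "('n::finite, 'k::{field,finite}) mpoly"
proof (rule has_log_deriv_limit)
  fix K
  \<comment> \<open>All \<open>k\<close> with \<open>0 < k \<le> K\<close> divide \<open>K!\<close>, so the field with \<open>q ^ K!\<close> elements contains the ones of
    \<open>q ^ k\<close> elements.\<close>
  define N where "N = (fact K :: nat)"
  define Y where "Y = complement_points f N"
  define \<phi> where "\<phi> = (\<lambda>(x :: 'n \<Rightarrow> 'k alg_closure) j. x j ^ CARD('k))"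
  have fin: "finite Y"
    unfolding Y_def by (rule finite_subset[OF _ finite_torus_points_over[of N]])
      (auto simp: N_def complement_points_def)
  have pow_mem: "a ^ j \<in> finite_subfield N" if "a \<in> finite_subfield N" for a :: "'k alg_closure" and j
    using that by (induction j) (auto simp: finite_subfield_closed)
  have cl: "\<phi> y \<in> Y" if "y \<in> Y" for y
    using that eval_ac_frobenius[of f y 1]
    by (auto simp: Y_def \<phi>_def complement_points_def torus_points_over_def pow_mem)
  from has_log_deriv_permutation[of Y \<phi>, OF fin cl] obtain D :: "int fps" where
    D: "has_log_deriv D (Abs_fps (\<lambda>k. if k = 0 then 0 else - of_nat (card {y \<in> Y. (\<phi> ^^ k) y = y})))"
    by blast
  have "{y \<in> Y. (\<phi> ^^ k) y = y} = complement_points f k" if k: "k > 0" "k \<le> K" for k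
  proof -
    obtain c where c: "N = k * c" using dvd_fact[of k K] k unfolding N_def by (auto elim: dvdE)
    have sub: "a \<in> finite_subfield N" if "a \<in> finite_subfield k" for a :: "'k alg_closure"
    proof -
      have a: "a ^ (CARD('k) ^ k) = a" using that by (simp add: finite_subfield_def)
      have "a ^ (CARD('k) ^ (k * j)) = a" for j
      proof (induction j)
        case (Suc j)
        have "a ^ (CARD('k) ^ (k * Suc j)) = (a ^ (CARD('k) ^ k)) ^ (CARD('k) ^ (k * j))"
          by (simp only: mult_Suc_right power_add power_mult)
        then show ?case using Suc by (simp only: a)
      qed simp
      then show ?thesis by (simp add: finite_subfield_def c)
    qed
    have "(\<phi> ^^ k) y = y \<longleftrightarrow> (\<forall>i. y i \<in> finite_subfield k)" for y
      unfolding \<phi>_def funpow_frobenius by (auto simp: finite_subfield_def fun_eq_iff)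
    then show ?thesis
      using sub by (auto simp: Y_def complement_points_def torus_points_over_def)
  qed
  then have "\<forall>i\<le>K. fps_nth (Abs_fps (\<lambda>k. if k = 0 then 0 else - of_nat (card {y \<in> Y. (\<phi> ^^ k) y = y}))) i =
      fps_nth (complement_series f) i"
    by (auto simp: complement_series_def)
  with D show "\<exists>D B. has_log_deriv D B \<and> (\<forall>i\<le>K. fps_nth B i = fps_nth (complement_series f) i)" by blast
qed

lemma has_log_deriv_zeta:
  "has_log_deriv (zeta Y) (Abs_fps (\<lambda>k. if k = 0 then 0 else of_nat (num_points Y k)))"
proof -
  let ?H = "Abs_fps (\<lambda>k. if k = 0 then 0 else of_nat (num_points Y k) / of_nat k) :: rat fps"
  have "fps_X * fps_deriv ?H = Abs_fps (\<lambda>k. if k = 0 then 0 else of_nat (num_points Y k))"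
    by (rule fps_ext) (simp add: fps_mult_fps_X_deriv_shift)
  then show ?thesis unfolding zeta_def using has_log_deriv_exp[of ?H] by simp
qed

lemma zeta_quotient:
  fixes f :: "('n::finite, 'k::{field,finite}) mpoly"
  assumes W: "has_log_deriv W (complement_series f)"
  shows "fps_map of_int (fps_powi W ((- 1) ^ n)) =
    (zeta (torus_hypersurface f) / zeta (torus :: ('n \<Rightarrow> 'k alg_closure) set)) powi ((- 1) ^ n)"
proof -
  let ?G = "torus :: ('n \<Rightarrow> 'k alg_closure) set" and ?Y = "torus_hypersurface f"
  let ?X = "zeta ?Y" and ?T = "zeta ?G"
  have T0: "fps_nth ?T 0 \<noteq> 0" using has_log_deriv_zeta[of ?G]
    by (simp add: has_log_deriv_def)
  have inv: "has_log_deriv (inverse F) (- A)" if "has_log_deriv F A" for F A :: "rat fps"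
    using that by (intro has_log_deriv_cancel[OF that] inverse_mult_eq_1') (simp add: has_log_deriv_def)
  have "has_log_deriv (?X / ?T) (fps_map of_int (complement_series f))"
  proof -
    have "?X / ?T = ?X * inverse ?T" using T0 by (rule fps_divide_unit)
    moreover have "Abs_fps (\<lambda>k. if k = 0 then 0 else of_nat (num_points ?Y k)) +
        - Abs_fps (\<lambda>k. if k = 0 then 0 else of_nat (num_points ?G k)) =
        (fps_map of_int (complement_series f) :: rat fps)"
    proof (rule fps_ext)
      fix k
      have "k > 0 \<Longrightarrow> (of_int (int (num_points ?Y k) -
          int (num_points ?G k)) :: rat) = of_int (- int (card (complement_points f k)))"
        by (simp only: num_points_hypersurface)
      then show "fps_nth (Abs_fps (\<lambda>k. if k = 0 then 0 else of_nat (num_points ?Y k)) +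
        - Abs_fps (\<lambda>k. if k = 0 then 0 else of_nat (num_points ?G k))) k =
        fps_nth (fps_map of_int (complement_series f) :: rat fps) k"
        by (simp add: complement_series_def)
    qed
    ultimately show ?thesis
      using has_log_deriv_mult[OF has_log_deriv_zeta inv[OF has_log_deriv_zeta],
        of ?Y ?G] by simp
  qed
  note XT = this
  have powi: "has_log_deriv ((?X / ?T) powi ((- 1) ^ n)) (of_int ((- 1) ^ n) * fps_map of_int (complement_series f))"
  proof (cases "even n")
    case True then show ?thesis using XT by simp
  next
    case False then show ?thesis using inv[OF XT] by (simp add: power_int_minus)
  qed
  have map: "fps_map of_int (of_int c * A) = (of_int c * fps_map of_int A :: rat fps)" for c and A :: "int fps"
    by (rule fps_ext) (simp add: fps_of_int[symmetric])
  have "has_log_deriv (fps_map of_int (fps_powi W ((- 1) ^ n)))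
      (of_int ((- 1) ^ n) * fps_map of_int (complement_series f) :: rat fps)"
    using has_log_deriv_of_int[OF has_log_deriv_fps_powi[OF W, of "(- 1) ^ n"], where 'a = rat] unfolding map .
  then show ?thesis using powi by (rule has_log_deriv_unique)
qed

section \<open>The ring of integers of an unramified extension of the p-adic numbers\<close>

lemma nonarch_absD:
  assumes "nonarch_abs v"
  shows "0 \<le> v x" and "v x = 0 \<longleftrightarrow> x = 0" and "v (x * y) = v x * v y" and "v (x + y) \<le> max (v x) (v y)"
    and "v 1 = 1" and "v (- x) = v x" and "v (inverse x) = inverse (v x)"
proof -
  show nn: "0 \<le> v x" for x using assms by (simp add: nonarch_abs_def)
  show z: "v x = 0 \<longleftrightarrow> x = 0" for x using assms by (simp add: nonarch_abs_def)
  show m: "v (x * y) = v x * v y" for x y using assms by (simp add: nonarch_abs_def)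
  show "v (x + y) \<le> max (v x) (v y)" using assms by (simp add: nonarch_abs_def)
  show one: "v 1 = 1" using m[of 1 1] z[of 1] by simp
  have "v (- 1) * v (- 1) = 1" using m[of "- 1" "- 1"] one by simp
  then have "v (- 1) = 1" using nn[of "- 1"] by (simp add: square_eq_1_iff)
  then show "v (- x) = v x" using m[of "- 1" x] by simp
  show "v (inverse x) = inverse (v x)"
  proof (cases "x = 0")
    case True then show ?thesis using z[of 0] by simp
  next
    case False
    then have "v (inverse x) * v x = 1" using m[of "inverse x" x] one by simp
    then show ?thesis by (metis inverse_unique mult.commute)
  qed
qed

text \<open>An integer prime to \<open>p\<close> has absolute value 1, since otherwise a Bezout relation would make 1 a sum of two
  elements of absolute value less than 1.\<close>

lemma nonarch_abs_of_nat:
  assumes v: "nonarch_abs v" and p: "prime p" and vp: "v (of_nat p) = 1 / real p" and n: "n > 0"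
  shows "v (of_nat n :: 'K::field_char_0) = (1 / real p) ^ multiplicity p n"
proof -
  note V = nonarch_absD[OF v]
  have le1: "v (of_nat j) \<le> 1" for j :: nat
  proof (induction j)
    case 0 show ?case using V(2)[of 0] by simp
  next
    case (Suc j)
    have "v (of_nat (Suc j)) \<le> max (v 1) (v (of_nat j))" using V(4)[of 1 "of_nat j"] by simp
    then show ?case using Suc V(5) by simp
  qed
  have le1i: "v (of_int j) \<le> 1" for j
    by (cases j rule: int_cases2) (use le1 V(6) in auto)
  have p1: "1 / real p < 1" using prime_gt_1_nat[OF p] by simp
  obtain b where b: "n = p ^ multiplicity p n * b" "\<not> p dvd b" using nat_prime_decomp[OF p n] by blast
  have "v (of_nat b) = 1"
  proof (rule ccontr)
    assume "v (of_nat b) \<noteq> 1"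
    then have lt: "v (of_nat b) < 1" using le1[of b] by simp
    have "coprime (int b) (int p)" using p b(2) by (metis prime_imp_coprime coprime_commute coprime_int_iff)
    then obtain s t where st: "s * int b + t * int p = 1"
      using bezout_int[of "int b" "int p"] by (metis coprime_iff_gcd_eq_1)
    have "1 = v (of_int (s * int b + t * int p))" using st V(5) by simp
    also have "of_int (s * int b + t * int p) = (of_int s * of_nat b + of_int t * of_nat p :: 'K)" by simp
    also have "v \<dots> \<le> max (v (of_int s * of_nat b)) (v (of_int t * of_nat p))" by (rule V(4))
    finally have "1 \<le> v (of_int s * of_nat b) \<or> 1 \<le> v (of_int t * of_nat p)" by (simp add: le_max_iff_disj)
    moreover have "v (of_int s * of_nat b) \<le> 1 * v (of_nat b)"
      unfolding V(3) by (intro mult_right_mono le1i V(1))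
    moreover have "v (of_int t * of_nat p) \<le> 1 * v (of_nat p)"
      unfolding V(3) by (intro mult_right_mono le1i V(1))
    ultimately show False using lt p1 vp by linarith
  qed
  moreover have pw: "v (x ^ j) = v x ^ j" for x j by (induction j) (simp_all add: V(3,5))
  moreover have "(of_nat n :: 'K) = of_nat p ^ multiplicity p n * of_nat b" by (subst b(1)) simp
  ultimately show ?thesis by (simp add: V(3) vp)
qed

text \<open>In an unramified extension the values of \<open>v\<close> are those on the rationals, that is, powers of
  \<open>p\<close>. So an element of absolute value less than 1 is divisible by \<open>p\<close>.\<close>

lemma unramified_value_gap:
  fixes v :: "'K::field_char_0 \<Rightarrow> real"
  assumes v: "nonarch_abs v" and p: "prime p" and vp: "v (of_nat p) = 1 / real p"
    and un: "unramified v" and x: "v x < 1"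
  shows "v x \<le> 1 / real p"
proof (cases "x = 0")
  case True
  then show ?thesis using nonarch_absD(2)[OF v, of 0] by simp
next
  case False
  note V = nonarch_absD[OF v]
  have "v x \<in> v ` (Qp v - {0})" using un False by (auto simp: unramified_def)
  then obtain y where y: "y \<in> Qp v" "y \<noteq> 0" "v x = v y" by blast
  have "v y > 0" using V(1)[of y] V(2)[of y] y(2) by (simp add: less_le)
  then obtain r where r: "r \<in> \<rat>" "v (y - r) < v y" using y(1) by (auto simp: Qp_def)
  have vr: "v r = v y"
  proof (rule antisym)
    have "v r = v ((r - y) + y)" by simp
    also have "\<dots> \<le> max (v (r - y)) (v y)" by (rule V(4))
    also have "v (r - y) = v (y - r)" using V(6)[of "y - r"] by simp
    finally show "v r \<le> v y" using r(2) by simp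
    have "v y = v ((y - r) + r)" by simp
    also have "\<dots> \<le> max (v (y - r)) (v r)" by (rule V(4))
    finally show "v y \<le> v r" using r(2) by (simp add: max_def split: if_splits)
  qed
  obtain s where s: "r = of_rat s" using r(1) by (auto elim: Rats_cases)
  obtain a b where ab: "s = Rat.Fract a b" "b > 0" by (cases s) auto
  have r_ab: "r = of_int a / of_int b" using ab by (simp add: s of_rat_rat)
  have "r \<noteq> 0" using vr V(2)[of y] V(2)[of r] y(2) by auto
  then have a0: "a \<noteq> 0" using r_ab by auto
  have va: "v (of_int c :: 'K) = (1 / real p) ^ multiplicity p (nat \<bar>c\<bar>)" if "c \<noteq> 0" for c
  proof -
    have "v (of_int c :: 'K) = v (of_nat (nat \<bar>c\<bar>))"
      by (cases c rule: int_cases2) (auto simp: V(6))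
    then show ?thesis using nonarch_abs_of_nat[OF v p vp, of "nat \<bar>c\<bar>"] that by simp
  qed
  let ?i = "multiplicity p (nat \<bar>a\<bar>)" and ?j = "multiplicity p (nat \<bar>b\<bar>)"
  have p1: "real p > 1" using prime_gt_1_nat[OF p] by simp
  have "v r = (1 / real p) ^ ?i / (1 / real p) ^ ?j"
    using va[OF a0] va[of b] ab(2) by (simp add: r_ab divide_inverse V(3,7))
  then have eq: "v x = (1 / real p) ^ ?i / (1 / real p) ^ ?j" using vr y(3) by simp
  have "?j < ?i"
  proof (rule ccontr)
    assume "\<not> ?j < ?i"
    then have "(1 / real p) ^ ?j \<le> (1 / real p) ^ ?i" using p1 by (intro power_decreasing) auto
    then have "1 \<le> v x" using p1 by (simp add: eq le_divide_eq)
    then show False using x by simp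
  qed
  then have "(1 / real p) ^ ?i \<le> (1 / real p) ^ Suc ?j" using p1 by (intro power_decreasing) auto
  then show ?thesis using p1 unfolding eq by (simp add: divide_le_eq)
qed

lemma quotient_map_subring_hom:
  assumes v: "nonarch_abs v" and \<phi>: "quotient_map (int_ring v) I \<phi>"
  shows "subring_hom (int_ring v) \<phi>"
proof -
  note V = nonarch_absD[OF v]
  show ?thesis
  proof
    show "1 \<in> int_ring v" by (simp add: int_ring_def V(5))
    show "\<phi> 1 = 1" using \<phi> by (simp add: quotient_map_def)
  next
    fix x assume "x \<in> int_ring v"
    then show "- x \<in> int_ring v" by (simp add: int_ring_def V(6))
  next
    fix x y assume xy: "x \<in> int_ring v" "y \<in> int_ring v"
    show "x + y \<in> int_ring v" using xy V(4)[of x y] by (simp add: int_ring_def)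
    show "x * y \<in> int_ring v" using xy V(1) by (simp add: int_ring_def V(3) mult_le_one)
    show "\<phi> (x + y) = \<phi> x + \<phi> y" "\<phi> (x * y) = \<phi> x * \<phi> y" using xy \<phi> by (auto simp: quotient_map_def)
  qed
qed

lemma unramified_ring_int_ring:
  fixes v :: "'K::field_char_0 \<Rightarrow> real" and red :: "'K \<Rightarrow> 'k::{field,finite}"
  assumes p: "p = CHAR('k)" and q: "q = CARD('k)" and ext: "padic_extension p v" and un: "unramified v"
    and red: "quotient_map (int_ring v) (max_ideal v) red"
  shows "unramified_ring (int_ring v) red p q"
proof -
  have v: "nonarch_abs v" and vp: "v (of_nat p) = 1 / real p" using ext by (auto simp: padic_extension_def)
  have pr: "prime p" unfolding p by (rule prime_CHAR_finite_field)
  have p1: "real p > 1" using prime_gt_1_nat[OF pr] by simp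
  note V = nonarch_absD[OF v]
  interpret subring_hom "int_ring v" red by (rule quotient_map_subring_hom[OF v red])
  have ker: "red x = 0 \<longleftrightarrow> v x < 1" if "x \<in> int_ring v" for x
    using red that by (simp add: quotient_map_def max_ideal_def)
  show ?thesis
  proof
    show "p = CHAR('k)" "q = CARD('k)" by fact+
    fix x assume x: "x \<in> int_ring v"
    show "red x = 0 \<longleftrightarrow> (\<exists>y\<in>int_ring v. x = of_nat p * y)"
    proof
      assume "red x = 0"
      then have "v x \<le> 1 / real p" using unramified_value_gap[OF v pr vp un] ker[OF x] by simp
      then have "v (x * inverse (of_nat p)) \<le> 1"
        unfolding V(3) V(7) vp using p1 by (simp add: field_simps)
      then show "\<exists>y\<in>int_ring v. x = of_nat p * y"
        using p1 by (intro bexI[of _ "x * inverse (of_nat p)"]) (auto simp: int_ring_def)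
    next
      assume "\<exists>y\<in>int_ring v. x = of_nat p * y"
      then obtain y where y: "v y \<le> 1" "x = of_nat p * y" by (auto simp: int_ring_def)
      then have "v x \<le> 1 / real p" using p1 by (simp add: V(3) vp divide_right_mono)
      also have "\<dots> < 1" using p1 by simp
      finally show "red x = 0" using ker[OF x] by simp
    qed
    assume "red x \<noteq> 0"
    then have "v x = 1" using ker[OF x] x by (simp add: int_ring_def)
    then show "inverse x \<in> int_ring v" by (simp add: int_ring_def V(7))
  qed
qed

section \<open>The congruence of power series\<close>

lemma smult_mat_power:
  fixes A :: "'a::comm_ring_1 mat"
  assumes A: "A \<in> carrier_mat n n"
  shows "(c \<cdot>\<^sub>m A) ^\<^sub>m k = c ^ k \<cdot>\<^sub>m (A ^\<^sub>m k)"
proof (induction k)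
  case 0
  show ?case using A by (intro eq_matI) auto
next
  case (Suc k)
  have "(c \<cdot>\<^sub>m A) ^\<^sub>m Suc k = (c ^ k \<cdot>\<^sub>m (A ^\<^sub>m k)) * (c \<cdot>\<^sub>m A)" by (simp add: Suc)
  also have "\<dots> = c ^ k \<cdot>\<^sub>m (c \<cdot>\<^sub>m (A ^\<^sub>m k * A))"
    using mult_smult_assoc_mat[of "A ^\<^sub>m k" n n "c \<cdot>\<^sub>m A" n] mult_smult_distrib[of "A ^\<^sub>m k" n n A n] A by simp
  also have "\<dots> = c ^ Suc k \<cdot>\<^sub>m (A ^\<^sub>m Suc k)" using A by (intro eq_matI) (auto simp: mult_ac)
  finally show ?case .
qed

lemma mat_trace_smult: "A \<in> carrier_mat n n \<Longrightarrow> mat_trace (c \<cdot>\<^sub>m A) = c * mat_trace A"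
  by (simp add: mat_trace_def sum_distrib_left)

text \<open>Scaling the matrix by \<open>c ^ i\<close> scales the trace of its \<open>k\<close>-th power by \<open>(c ^ k) ^ i\<close>, and the
  alternating sum over \<open>i\<close> is \<open>(1 - c ^ k) ^ n\<close> by the binomial theorem.\<close>

lemma has_log_deriv_koszul_product:
  fixes A :: "'a::comm_ring_1 mat"
  assumes A: "A \<in> carrier_mat N N"
  shows "has_log_deriv (\<Prod>i=0..n. fps_powi (det (fps_one_minus (c ^ i \<cdot>\<^sub>m A))) ((- 1) ^ i * int (n choose i)))
    (Abs_fps (\<lambda>k. if k = 0 then 0 else - ((1 - c ^ k) ^ n * mat_trace (A ^\<^sub>m k))))"
proof -
  let ?B = "\<lambda>i. Abs_fps (\<lambda>k. if k = 0 then 0 else - mat_trace ((c ^ i \<cdot>\<^sub>m A) ^\<^sub>m k))"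
  have "has_log_deriv (\<Prod>i=0..n. fps_powi (det (fps_one_minus (c ^ i \<cdot>\<^sub>m A))) ((- 1) ^ i * int (n choose i)))
      (\<Sum>i=0..n. of_int ((- 1) ^ i * int (n choose i)) * ?B i)"
    using A by (intro has_log_deriv_prod has_log_deriv_fps_powi has_log_deriv_det[of _ N]) auto
  also have "(\<Sum>i=0..n. of_int ((- 1) ^ i * int (n choose i)) * ?B i) =
      Abs_fps (\<lambda>k. if k = 0 then 0 else - ((1 - c ^ k) ^ n * mat_trace (A ^\<^sub>m k)))"
  proof (rule fps_ext)
    fix k
    have tr: "mat_trace ((c ^ i \<cdot>\<^sub>m A) ^\<^sub>m k) = (c ^ k) ^ i * mat_trace (A ^\<^sub>m k)" for i
      using A by (simp add: smult_mat_power mat_trace_smult[of _ N] mult.commute flip: power_mult)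
    have oi: "fps_nth (of_int a * F) k = of_int a * fps_nth F k" for a :: int and F :: "'a fps"
      by (simp flip: fps_of_int)
    have "(1 - c ^ k) ^ n = (- (c ^ k) + 1) ^ n" by simp
    also have "\<dots> = (\<Sum>i\<le>n. of_nat (n choose i) * (- (c ^ k)) ^ i * 1 ^ (n - i))" by (rule binomial_ring)
    also have "\<dots> = (\<Sum>i=0..n. of_int ((- 1) ^ i * int (n choose i)) * (c ^ k) ^ i)"
      unfolding atMost_atLeast0 by (intro sum.cong refl) (subst power_minus, simp add: mult_ac)
    finally have bin: "(1 - c ^ k) ^ n = (\<Sum>i=0..n. of_int ((- 1) ^ i * int (n choose i)) * (c ^ k) ^ i)" .
    show "fps_nth (\<Sum>i=0..n. of_int ((- 1) ^ i * int (n choose i)) * ?B i) k =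
        fps_nth (Abs_fps (\<lambda>k. if k = 0 then 0 else - ((1 - c ^ k) ^ n * mat_trace (A ^\<^sub>m k)))) k"
      unfolding fps_sum_nth oi by (simp add: tr bin sum_distrib_right sum_negf mult.assoc)
  qed
  finally show ?thesis .
qed

lemma coord_mat_scale:
  "coord_mat N b (\<lambda>v i. lookup v (w i)) (\<lambda>v. mpoly_scale c (L v)) =
     c \<cdot>\<^sub>m coord_mat N b (\<lambda>v i. lookup v (w i)) L"
  by (intro eq_matI) (auto simp: coord_mat_def mpoly_scale_lookup)

lemma fps_of_poly_det_psi_op:
  fixes g :: "('n::finite, 'a::comm_ring_1) mpoly"
  assumes q: "q > 0" and g: "g \<in> polys_upto ((q - 1) * D)"
  shows "fps_of_poly (det_one_minus (\<lambda>h. mpoly_scale c (psi_op q g h)) (polys_upto D)) =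
    det (fps_one_minus (c \<cdot>\<^sub>m psi_mat D q g))"
proof -
  have "fps_of_poly (det_one_minus (\<lambda>h. mpoly_scale c (psi_op q g h)) (polys_upto D)) =
    det (fps_one_minus (coord_mat (length (monomial_list D :: 'n exponent list))
      (\<lambda>i. single (monomial_list D ! i) 1)
      (\<lambda>v i. lookup v (monomial_list D ! i)) (\<lambda>h. mpoly_scale c (psi_op q g h))))"
  proof (rule fps_of_poly_det_one_minus)
    show "mpoly_scale c (psi_op q g v) \<in> polys_upto D" if "v \<in> polys_upto D" for v
      by (rule mpoly.subspace_scale[OF subspace_polys_upto psi_op_mem_polys_upto[OF q g that]])
    show "mpoly_scale c (psi_op q g (\<Sum>j<l. mpoly_scale (a j) (w j))) =
        (\<Sum>j<l. mpoly_scale (a j) (mpoly_scale c (psi_op q g (w j))))" for a w and l :: nat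
      by (simp add: psi_op_sum[OF q] mpoly.scale_sum_right mult.commute)
  qed
  then show ?thesis by (simp add: psi_mat_def coord_mat_scale)
qed

context unramified_ring
begin

text \<open>For each \<open>k\<close> a separate extension is used: its residue field has \<open>q ^ k\<close> elements, and the precision
  is the one required in the conclusion.\<close>

lemma trace_congruence:
  fixes f :: "('n::finite, 'K) mpoly"
  assumes f: "\<And>u. lookup f u \<in> R" and fb: "Poly_Mapping.map red f = fb"
    and m: "m \<ge> 1" and deg: "f \<in> polys_upto d" and k: "k > 0"
  shows "of_nat ((q ^ k - 1) ^ CARD('n)) *
      mat_trace (psi_mat (d * p ^ (m - 1)) q (f ^ ((q - 1) * p ^ (m - 1))) ^\<^sub>m k) -
    of_nat (card (complement_points fb k)) \<in> pideal (m + multiplicity p k)"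
proof -
  obtain g :: "'k alg_closure" where g: "g \<in> finite_subfield k" "g \<noteq> 0"
    "\<And>a. a \<in> finite_subfield k \<Longrightarrow> a \<noteq> 0 \<Longrightarrow> \<exists>i. a = g ^ i"
    using finite_subfield_generator[OF k] by blast
  define N where "N = q ^ k - 1"
  have "q ^ k > 1" unfolding q_eq by (rule one_less_power[OF card_finite_field_gt_1 k])
  then have N: "N > 0" "Suc N = q ^ k" by (auto simp: N_def)
  have "g * g ^ N = g * 1"
    using g(1) by (simp add: finite_subfield_def q_eq[symmetric] N(2)[symmetric])
  then have gN: "g ^ N = 1" using g(2) by simp
  obtain h where h: "h \<in> RX" "lead_coeff h = 1" "redX g h = 0" "degree h > 0"
    "\<And>r i. r \<in> RX \<Longrightarrow> redX g r = 0 \<Longrightarrow> degree r < degree h \<Longrightarrow> red (coeff r i) = 0"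
    using exists_minimal_lift[OF gN N(1)] by blast
  interpret E: residue_extension_degree R red p q g h k "m + multiplicity p k"
    by unfold_locales (use h g k in auto)
  have "{x \<in> E.torus_points. eval_ac fb x \<noteq> 0} = complement_points fb k"
    by (auto simp: complement_points_def)
  then show ?thesis using E.frob_product_trace_congruence[OF f fb m refl deg] by simp
qed

text \<open>The product and the power of \<open>W\<close> have logarithmic derivatives whose \<open>k\<close>-th coefficients differ by
  a multiple of \<open>p ^ m * k\<close>, so \<open>E\<close> is the exponential of a series divisible by \<open>p ^ m\<close>.\<close>

lemma koszul_product_congruence:
  fixes f :: "('n::finite, 'K) mpoly"
  assumes f: "\<And>u. lookup f u \<in> R" and fb: "Poly_Mapping.map red f = fb"
    and m: "m \<ge> 1" and deg: "f \<in> polys_upto d" and n: "n = CARD('n)"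
    and W: "has_log_deriv W (complement_series fb)"
  shows "\<exists>E. (\<Prod>i=0..n. fps_powi (det (fps_one_minus (of_nat (q ^ i) \<cdot>\<^sub>m
        psi_mat (d * p ^ (m - 1)) q (f ^ ((q - 1) * p ^ (m - 1)))))) ((- 1) ^ i * int (n choose i))) =
      fps_map of_int (fps_powi W ((- 1) ^ n)) * E \<and>
    fps_nth E 0 = 1 \<and> (\<forall>k>0. fps_nth E k \<in> pideal m)"
proof -
  define A where "A = psi_mat (d * p ^ (m - 1)) q (f ^ ((q - 1) * p ^ (m - 1)))"
  define N where "N = dim_row A"
  have A: "A \<in> carrier_mat N N" by (simp add: N_def A_def psi_mat_def coord_mat_def)
  define c where "c k = (- 1) ^ n * (of_nat (card (complement_points fb k)) -
    of_nat ((q ^ k - 1) ^ n) * mat_trace (A ^\<^sub>m k))" for k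
  define H where "H = Abs_fps (\<lambda>k. if k = 0 then 0 else c k / of_nat k)"
  define E where "E = fps_compose (fps_exp 1) H"
  have c: "c k \<in> pideal (m + multiplicity p k)" if "k > 0" for k
  proof -
    have "c k = (- ((- 1) ^ n)) * (of_nat ((q ^ k - 1) ^ n) * mat_trace (A ^\<^sub>m k) -
        of_nat (card (complement_points fb k)))"
      by (simp add: c_def algebra_simps)
    moreover have "- ((- 1) ^ n) \<in> R" by (intro uminus_mem power_mem one_mem)
    then have "(- ((- 1) ^ n)) * (of_nat ((q ^ k - 1) ^ n) * mat_trace (A ^\<^sub>m k) -
        of_nat (card (complement_points fb k))) \<in> pideal (m + multiplicity p k)"
      using trace_congruence[OF f fb m deg that] unfolding A_def n by (rule pideal_mult_left)
    ultimately show ?thesis by (simp only:)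
  qed
  have H: "fps_nth H k \<in> pideal m" for k
    using c[of k] by (simp add: H_def pideal_zero pideal_divide)
  have ldE: "has_log_deriv E (Abs_fps (\<lambda>k. if k = 0 then 0 else c k))"
  proof -
    have "fps_X * fps_deriv H = Abs_fps (\<lambda>k. if k = 0 then 0 else c k)"
      by (rule fps_ext) (simp add: fps_mult_fps_X_deriv_shift H_def)
    then show ?thesis using has_log_deriv_exp[of H] by (simp add: E_def H_def)
  qed
  have ldW: "has_log_deriv (fps_map of_int (fps_powi W ((- 1) ^ n)) :: 'K fps)
      (fps_map of_int (of_int ((- 1) ^ n) * complement_series fb))"
    by (intro has_log_deriv_of_int has_log_deriv_fps_powi W)
  have "has_log_deriv (fps_map of_int (fps_powi W ((- 1) ^ n)) * E)
      (Abs_fps (\<lambda>k. if k = 0 then 0 else - ((1 - of_nat q ^ k) ^ n * mat_trace (A ^\<^sub>m k))))"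
  proof -
    have "fps_map of_int (of_int ((- 1) ^ n) * complement_series fb) + Abs_fps (\<lambda>k. if k = 0 then 0 else c k) =
        Abs_fps (\<lambda>k. if k = 0 then 0 else - ((1 - of_nat q ^ k) ^ n * mat_trace (A ^\<^sub>m k)))"
    proof (rule fps_ext)
      fix k
      have oi: "fps_nth (of_int a * F) k = a * fps_nth F k" for a :: int and F :: "int fps"
        by (simp flip: fps_of_int)
      have series: "fps_nth (fps_map of_int (of_int ((- 1) ^ n) * complement_series fb) :: 'K fps) k =
          (if k = 0 then 0 else - ((- 1) ^ n * of_nat (card (complement_points fb k))))"
        unfolding fps_map_nth oi by (simp add: complement_series_def)
      have "q ^ k \<ge> 1" using q_eq by simp
      then have Qk: "of_nat ((q ^ k - 1) ^ n) = (of_nat q ^ k - 1 :: 'K) ^ n" by (simp add: of_nat_diff)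
      have "(1 - of_nat q ^ k) ^ n = ((- 1) * (of_nat q ^ k - 1) :: 'K) ^ n" by simp
      then have sign: "(1 - of_nat q ^ k) ^ n = (- 1) ^ n * (of_nat q ^ k - 1 :: 'K) ^ n"
        by (simp only: power_mult_distrib)
      show "fps_nth (fps_map of_int (of_int ((- 1) ^ n) * complement_series fb) +
          Abs_fps (\<lambda>k. if k = 0 then 0 else c k)) k =
        fps_nth (Abs_fps (\<lambda>k. if k = 0 then 0 else - ((1 - of_nat q ^ k) ^ n * mat_trace (A ^\<^sub>m k)))) k"
        unfolding fps_add_nth series c_def Qk
        by (cases "k = 0") (simp_all add: sign Qk[simplified] algebra_simps)
    qed
    then show ?thesis using has_log_deriv_mult[OF ldW ldE] by simp
  qed
  from has_log_deriv_unique[OF has_log_deriv_koszul_product[OF A] this]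
  have "(\<Prod>i=0..n. fps_powi (det (fps_one_minus (of_nat q ^ i \<cdot>\<^sub>m A))) ((- 1) ^ i * int (n choose i))) =
      fps_map of_int (fps_powi W ((- 1) ^ n)) * E" .
  moreover have "fps_nth E 0 = 1" using ldE by (simp add: has_log_deriv_def)
  moreover have "\<forall>k>0. fps_nth E k \<in> pideal m" unfolding E_def using exp_pideal[OF m H] by blast
  ultimately show ?thesis unfolding A_def by (intro exI[of _ E]) simp
qed

end

theorem theorem5p2:
  fixes v :: "'K::field_char_0 \<Rightarrow> real"
    and red :: "'K \<Rightarrow> 'k::{field,finite}"
    and pr :: "'K \<Rightarrow> 'r::comm_ring_1"
    and rho :: "'r \<Rightarrow> 'k"
    and fbar :: "('n::finite, 'k) mpoly"
    and f :: "('n, 'r) mpoly"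
    and p q m n d :: nat
  assumes "p = CHAR('k)" and "q = CARD('k)" and "n = CARD('n)" and "m \<ge> 1"
    and "padic_extension p v" and "unramified v"
    and "quotient_map (int_ring v) (max_ideal v) red"
    and "quotient_map (int_ring v) (power_ideal p m v) pr"
    and "\<forall>x\<in>int_ring v. rho (pr x) = red x"
    and "total_degree fbar = d"
    and "total_degree f = d"
    and "Poly_Mapping.map rho f = fbar"
  shows "psi_op q (f ^ ((q - 1) * p ^ (m - 1))) ` polys_upto (d * p ^ (m - 1))
           \<subseteq> polys_upto (d * p ^ (m - 1)) \<and>
    (\<exists>W :: int fps.
       fps_map of_int W =
         (zeta (torus_hypersurface fbar) / zeta (torus :: ('n \<Rightarrow> 'k alg_closure) set)) powi ((- 1) ^ n) \<and>
       fps_map of_int W =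
         (\<Prod>i=0..n. fps_powi
            (fps_of_poly (det_one_minus
               (\<lambda>h. mpoly_scale (of_nat (q ^ i)) (psi_op q (f ^ ((q - 1) * p ^ (m - 1))) h))
               (polys_upto (d * p ^ (m - 1)))))
            ((- 1) ^ i * int (n choose i))))"
proof -
  let ?D = "d * p ^ (m - 1)" and ?e = "(q - 1) * p ^ (m - 1)"
  interpret unramified_ring "int_ring v" red p q
    by (rule unramified_ring_int_ring) fact+
  have v: "nonarch_abs v" using assms(5) by (simp add: padic_extension_def)
  interpret Pr: subring_hom "int_ring v" pr
    by (rule quotient_map_subring_hom[OF v assms(8)])
  have pr_ker: "pr x = 0" if "x \<in> pideal m" for x
    using assms(8) pideal_subset[OF that] that
    by (auto simp: quotient_map_def power_ideal_def pideal_def)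
  have q0: "q > 0" using assms(2) by simp
  have power_deg: "g ^ ?e \<in> polys_upto ((q - 1) * ?D)" if "g \<in> polys_upto d" for g :: "('n, 'a::comm_ring_1) mpoly"
    using power_mem_polys_upto[OF that, of ?e] by (simp add: mult_ac)
  have fdeg: "f \<in> polys_upto d" using assms(11) by (simp add: polys_upto_def)
  note Fdeg = power_deg[OF fdeg]
  have maps: "psi_op q (f ^ ?e) ` polys_upto ?D \<subseteq> polys_upto ?D"
    using psi_op_mem_polys_upto[OF q0 Fdeg] by blast
  \<comment> \<open>A lift of \<open>f\<close> to characteristic zero.\<close>
  have "pr ` int_ring v = UNIV" using assms(8) by (simp add: quotient_map_def)
  then have "\<forall>c. \<exists>x. x \<in> int_ring v \<and> pr x = c" by (metis UNIV_I imageE)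
  then obtain lift where lift: "lift c \<in> int_ring v" "pr (lift c) = c" for c by metis
  define f0 where "f0 = Poly_Mapping.map lift f"
  have lk: "lookup f0 u = (if lookup f u = 0 then 0 else lift (lookup f u))" for u
    by (simp add: f0_def map.rep_eq when_def)
  have f0: "lookup f0 u \<in> int_ring v" for u by (simp add: lk lift zero_mem)
  have f0_lift: "Pr.coeff_lift f0 f" by (simp add: Pr.coeff_lift_def lk lift zero_mem Pr.hom_zero)
  have f0deg: "f0 \<in> polys_upto d" using fdeg by (auto simp: polys_upto_iff lk split: if_splits)
  have "rho 0 = 0" using assms(9) zero_mem by (metis Pr.hom_zero hom_zero)
  then have fb: "Poly_Mapping.map red f0 = fbar"
    unfolding assms(12)[symmetric]
  proof (intro poly_mapping_eqI)
    fix u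
    have "red (lift c) = rho c" for c using assms(9) lift[of c] by metis
    then show "lookup (Poly_Mapping.map red f0) u = lookup (Poly_Mapping.map rho f) u"
      using \<open>rho 0 = 0\<close> hom_zero by (auto simp: map.rep_eq when_def lk) metis
  qed
  let ?A = "psi_mat ?D q (f0 ^ ?e)" and ?B = "psi_mat ?D q (f ^ ?e)"
  let ?N = "length (monomial_list ?D :: 'n exponent list)"
  have A: "?A \<in> carrier_mat ?N ?N" by (simp add: psi_mat_def coord_mat_def)
  have entries: "?A $$ (i, j) \<in> int_ring v \<and> pr (?A $$ (i, j)) = ?B $$ (i, j)" if "i < ?N" "j < ?N" for i j
  proof -
    have "Pr.coeff_lift (psi_op q (f0 ^ ?e) (single (monomial_list ?D ! j) 1))
        (psi_op q (f ^ ?e) (single (monomial_list ?D ! j) 1))"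
      unfolding psi_op_def
      by (intro Pr.coeff_lift_psi Pr.coeff_lift_mult Pr.coeff_lift_power Pr.coeff_lift_single_one f0_lift q0)
    then show ?thesis using that by (simp add: psi_mat_def coord_mat_def Pr.coeff_lift_def)
  qed
  have AB: "map_mat pr (of_nat (q ^ i) \<cdot>\<^sub>m ?A) = of_nat (q ^ i) \<cdot>\<^sub>m ?B" for i
    using A entries
    by (intro eq_matI) (auto simp: psi_mat_def coord_mat_def Pr.hom_mult Pr.of_nat_mem Pr.hom_of_nat simp del: of_nat_power)
  have det: "det (fps_one_minus (of_nat (q ^ i) \<cdot>\<^sub>m ?A)) \<in> fps_over (int_ring v)"
    "fps_map pr (det (fps_one_minus (of_nat (q ^ i) \<cdot>\<^sub>m ?A))) = det (fps_one_minus (of_nat (q ^ i) \<cdot>\<^sub>m ?B))" for i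
  proof -
    have M: "of_nat (q ^ i) \<cdot>\<^sub>m ?A \<in> carrier_mat ?N ?N" using A by (rule smult_carrier_mat)
    have S: "(of_nat (q ^ i) \<cdot>\<^sub>m ?A) $$ (j, l) \<in> int_ring v" if "j < ?N" "l < ?N" for j l
      using A entries[OF that] that by (simp add: Pr.mult_mem Pr.of_nat_mem del: of_nat_power)
    show "det (fps_one_minus (of_nat (q ^ i) \<cdot>\<^sub>m ?A)) \<in> fps_over (int_ring v)"
      by (rule Pr.det_fps_one_minus_hom(1)[OF M S])
    show "fps_map pr (det (fps_one_minus (of_nat (q ^ i) \<cdot>\<^sub>m ?A))) = det (fps_one_minus (of_nat (q ^ i) \<cdot>\<^sub>m ?B))"
      using Pr.det_fps_one_minus_hom(2)[OF M S] unfolding AB .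
  qed
  interpret PF: subring_hom "fps_over (int_ring v)" "fps_map pr"
    by (rule subring_hom_fps) (rule Pr.subring_hom_axioms)
  obtain W0 where W0: "has_log_deriv W0 (complement_series fbar)" using exists_complement_log_deriv by blast
  define W where "W = fps_powi W0 ((- 1) ^ n)"
  obtain E where E: "(\<Prod>i=0..n. fps_powi (det (fps_one_minus (of_nat (q ^ i) \<cdot>\<^sub>m ?A))) ((- 1) ^ i * int (n choose i))) =
      fps_map of_int W * E" "fps_nth E 0 = 1" "\<forall>k>0. fps_nth E k \<in> pideal m"
    using koszul_product_congruence[OF f0 fb assms(4) f0deg assms(3) W0] unfolding W_def by blast
  have E_mem: "E \<in> fps_over (int_ring v)"
    using E(2,3) pideal_subset one_mem by (auto simp: fps_over_def) (metis gr0I)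
  have "fps_map pr E = 1"
  proof (rule fps_ext)
    fix k
    show "fps_nth (fps_map pr E) k = fps_nth 1 k"
      using E(2,3) pr_ker by (cases "k = 0") (auto simp: Pr.hom_one)
  qed
  moreover have "fps_map of_int W \<in> fps_over (int_ring v)" "fps_map pr (fps_map of_int W) = fps_map of_int W"
    by (auto simp: fps_over_def Pr.of_int_mem Pr.hom_of_int intro!: fps_ext)
  ultimately have "fps_map pr (\<Prod>i=0..n. fps_powi (det (fps_one_minus (of_nat (q ^ i) \<cdot>\<^sub>m ?A)))
      ((- 1) ^ i * int (n choose i))) = fps_map of_int W"
    unfolding E(1) using E_mem by (simp only: PF.hom_mult mult_1_right)
  then have "fps_map of_int W = (\<Prod>i=0..n. fps_powi (det (fps_one_minus (of_nat (q ^ i) \<cdot>\<^sub>m ?B)))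
      ((- 1) ^ i * int (n choose i)))"
    by (subst (asm) PF.hom_prod) (simp_all only: Pr.fps_powi_hom[OF det(1)] det(2))
  moreover have "fps_map of_int W =
      (zeta (torus_hypersurface fbar) / zeta (torus :: ('n \<Rightarrow> 'k alg_closure) set)) powi ((- 1) ^ n)"
    unfolding W_def by (rule zeta_quotient[OF W0])
  ultimately show ?thesis
    using maps fps_of_poly_det_psi_op[OF q0 Fdeg] by (intro conjI exI[of _ W]) (simp_all only:)
qed

end
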